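(* Let $G$ be a matching-covered connected graph satisfying the odd cycle condition. Then the edge ring $\Bbbk[G]$ is pseudo-Gorenstein.
   Context: All graphs are finite, with no loops and no multiple edges. $\Bbbk$ is an algebraically closed field of characteristic $0$. For a graph $G$ on $[d]=\{1,\ldots,d\}$, the edge ring is $\Bbbk[G]=\Bbbk[t_it_j:\{i,j\}\in E(G)]\subset\Bbbk[t_1,\ldots,t_d]$, graded by $\deg(t_it_j)=1$ for every edge. A connected graph $G$ satisfies the odd cycle condition if for each pair of odd cycles $C$ and $C'$ of $G$ with no common vertex there is an edge $\{v,v'\}\in E(G)$ with $v\in V(C)$ and $v'\in V(C')$. (For connected $G$ this is equivalent to normality of $\Bbbk[G]$, and it implies that $\Bbbk[G]$ is Cohen--Macaulay.) A graph is matching-covered if it is connected and each of its edges is contained in some perfect matching. For a Cohen--Macaulay standard graded domain $R=\bigoplus_{k\ge 0}R_k$ with $R_0=\Bbbk$ and Krull dimension $D$, write $\sum_{k\ge0}(\dim_\Bbbk R_k)t^k=\dfrac{h_0+\cdots+h_st^s}{(1-t)^D}$ with $h_s\ne0$. $R$ is pseudo-Gorenstein if $h_s=1$. *)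

theory Defs
  imports
    "HOL-Algebra.Ideal"
    "HOL-Library.Poly_Mapping"
    "HOL-Library.Extended_Nat"
    "HOL-Computational_Algebra.Computational_Algebra"
begin

text \<open>A graph on \<open>{1..d}\<close> is given by its set of edges, which are two-element sets of vertices; this
  excludes loops and multiple edges.\<close>

definition simple_graph :: "nat \<Rightarrow> nat set set \<Rightarrow> bool" where
  "simple_graph d E \<longleftrightarrow> (\<forall>e\<in>E. e \<subseteq> {1..d} \<and> card e = 2)"

definition connected_graph :: "nat \<Rightarrow> nat set set \<Rightarrow> bool" where
  "connected_graph d E \<longleftrightarrow>
     1 \<le> d \<and> (\<forall>u\<in>{1..d}. \<forall>v\<in>{1..d}. (u, v) \<in> {(x, y). {x, y} \<in> E}\<^sup>*)"

text \<open>A cycle is represented by the list of its vertices in cyclic order, the first vertex not being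
  repeated at the end. Hence the length of the list is the length of the cycle.\<close>

definition graph_cycle :: "nat set set \<Rightarrow> nat list \<Rightarrow> bool" where
  "graph_cycle E c \<longleftrightarrow>
     3 \<le> length c \<and> distinct c \<and>
     (\<forall>i<length c. {c ! i, c ! (Suc i mod length c)} \<in> E)"

definition odd_cycle_condition :: "nat set set \<Rightarrow> bool" where
  "odd_cycle_condition E \<longleftrightarrow>
     (\<forall>c c'. graph_cycle E c \<and> odd (length c) \<and> graph_cycle E c' \<and> odd (length c') \<and>
             set c \<inter> set c' = {} \<longrightarrow>
             (\<exists>v\<in>set c. \<exists>v'\<in>set c'. {v, v'} \<in> E))"

definition perfect_matching :: "nat \<Rightarrow> nat set set \<Rightarrow> nat set set \<Rightarrow> bool" where
  "perfect_matching d E M \<longleftrightarrow> M \<subseteq> E \<and> (\<forall>v\<in>{1..d}. \<exists>!e. e \<in> M \<and> v \<in> e)"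

definition matching_covered :: "nat \<Rightarrow> nat set set \<Rightarrow> bool" where
  "matching_covered d E \<longleftrightarrow>
     connected_graph d E \<and> (\<forall>e\<in>E. \<exists>M. perfect_matching d E M \<and> e \<in> M)"

text \<open>Polynomials over \<open>'k\<close> in the variables \<open>t\<^sub>i\<close>, \<open>i :: nat\<close>: finitely supported functions from
  exponent vectors to coefficients, with the convolution product of
  \<^theory>\<open>HOL-Library.Poly_Mapping\<close>. For a graph on \<open>{1..d}\<close> only \<open>t\<^sub>1, \<dots>, t\<^sub>d\<close> occur in the edge ring.\<close>

type_synonym 'k mpoly = "(nat \<Rightarrow>\<^sub>0 nat) \<Rightarrow>\<^sub>0 'k"

definition mpoly_const :: "'k::field \<Rightarrow> 'k mpoly" where
  "mpoly_const c = Poly_Mapping.single 0 c"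

definition mpoly_var :: "nat \<Rightarrow> 'k::field mpoly" where
  "mpoly_var i = Poly_Mapping.single (Poly_Mapping.single i 1) 1"

definition mpoly_scale :: "'k::field \<Rightarrow> 'k mpoly \<Rightarrow> 'k mpoly" where
  "mpoly_scale c p = mpoly_const c * p"

lemma vector_space_mpoly_scale: "vector_space (mpoly_scale :: 'k::field \<Rightarrow> 'k mpoly \<Rightarrow> 'k mpoly)"
  by unfold_locales
     (simp_all add: mpoly_scale_def mpoly_const_def single_add algebra_simps mult_single
        flip: mult.assoc)

definition edge_monomial :: "nat set \<Rightarrow> 'k::field mpoly" where
  "edge_monomial e = (\<Prod>i\<in>e. mpoly_var i)"

inductive_set edge_ring_carrier :: "nat set set \<Rightarrow> 'k::field mpoly set" for E where
  const: "mpoly_const c \<in> edge_ring_carrier E"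
| edge: "e \<in> E \<Longrightarrow> edge_monomial e \<in> edge_ring_carrier E"
| add: "p \<in> edge_ring_carrier E \<Longrightarrow> q \<in> edge_ring_carrier E \<Longrightarrow> p + q \<in> edge_ring_carrier E"
| mult: "p \<in> edge_ring_carrier E \<Longrightarrow> q \<in> edge_ring_carrier E \<Longrightarrow> p * q \<in> edge_ring_carrier E"

definition edge_ring :: "nat set set \<Rightarrow> 'k::field mpoly ring" where
  "edge_ring E =
     \<lparr>carrier = edge_ring_carrier E, monoid.mult = (*), one = 1, zero = 0, add = (+)\<rparr>"

lemma cring_edge_ring: "cring (edge_ring E :: 'k::field mpoly ring)"
proof -
  have zero: "0 \<in> edge_ring_carrier E" and one: "1 \<in> edge_ring_carrier E"
    using edge_ring_carrier.const[of 0 E] edge_ring_carrier.const[of 1 E]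
    by (simp_all add: mpoly_const_def)
  have neg: "- p \<in> edge_ring_carrier E" if "p \<in> edge_ring_carrier E" for p :: "'k mpoly"
  proof -
    have "mpoly_const (- 1) * p = - p"
      by (simp add: mpoly_const_def single_uminus)
    then show ?thesis
      using edge_ring_carrier.mult[OF edge_ring_carrier.const that, of "- 1"] by simp
  qed
  show ?thesis
    by (intro cringI abelian_groupI comm_monoidI)
       (auto simp: edge_ring_def algebra_simps zero one
          intro: edge_ring_carrier.add edge_ring_carrier.mult
          intro!: bexI[OF _ neg])
qed

text \<open>The homogeneous component of degree \<open>k\<close> for the grading in which every generator
  \<open>t\<^sub>i t\<^sub>j\<close> has degree \<open>1\<close>.\<close>

definition edge_ring_component :: "nat set set \<Rightarrow> nat \<Rightarrow> 'k::field mpoly set" where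
  "edge_ring_component E k =
     module.span mpoly_scale
       {prod_list (map edge_monomial es) |es. set es \<subseteq> E \<and> length es = k}"

definition krull_dim :: "('a, 'b) ring_scheme \<Rightarrow> enat" where
  "krull_dim R =
     Sup {enat n |n. \<exists>P. (\<forall>i\<le>n. primeideal (P i) R) \<and> (\<forall>i<n. P i \<subset> P (Suc i))}"

definition hilbert_series ::
  "('k::field \<Rightarrow> 'a::ab_group_add \<Rightarrow> 'a) \<Rightarrow> (nat \<Rightarrow> 'a set) \<Rightarrow> int fps" where
  "hilbert_series scale A = Abs_fps (\<lambda>k. int (vector_space.dim scale (A k)))"

text \<open>Here \<open>A k\<close> is the component of degree \<open>k\<close> of \<open>R\<close>, and \<open>h = h\<^sub>0 + \<dots> + h\<^sub>s t\<^sup>s\<close> with \<open>h\<^sub>s \<noteq> 0\<close> is the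
  numerator of the Hilbert series over \<open>(1 - t)\<^sup>D\<close>, where \<open>D\<close> is the Krull dimension; thus
  \<open>h\<^sub>s\<close> is \<^term>\<open>lead_coeff h\<close>. The notion is customarily used for standard graded
  Cohen--Macaulay domains, but these properties do not enter the defining condition \<open>h\<^sub>s = 1\<close> and
  are not part of the predicate.\<close>

definition pseudo_gorenstein ::
  "('k::field \<Rightarrow> 'a::ab_group_add \<Rightarrow> 'a) \<Rightarrow> ('a, 'b) ring_scheme \<Rightarrow> (nat \<Rightarrow> 'a set) \<Rightarrow> bool" where
  "pseudo_gorenstein scale R A \<longleftrightarrow>
     (\<exists>D h. krull_dim R = enat D \<and>
            hilbert_series scale A * (1 - fps_X) ^ D = fps_of_poly h \<and>
            lead_coeff h = 1)"

end

theory Submission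
  imports Defs "HOL-Library.Function_Algebras" "HOL-Library.Indicator_Function"
begin

text \<open>By the odd cycle condition, the exponents of the monomials in the edge ring are exactly the
  points with integral coordinates and even coordinate sum in the cone spanned by the edge vectors.
  A regular triangulation of the cone, made half-open by pushing the points slightly towards a
  generic interior point, splits these lattice points into half-open simplicial cones. Hence the
  numerator of the Hilbert series over \<open>(1 - t)\<^sup>D\<close>, with \<open>D\<close> the dimension of the cone, counts by degree
  the lattice points of half-open boxes. The reflection \<open>p \<mapsto> \<Sum>B - p\<close> maps each box onto the oppositely
  half-open one, and the oppositely half-open simplicial cones partition the lattice points in the
  interior of the cone. So the leading coefficient of the numerator is the number of interior
  lattice points of minimal degree. Interior points have positive coordinates, and because every
  edge lies in a perfect matching, the all-one vector is interior; it is the only one of minimal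
  degree.\<close>

section \<open>Simplicial cones\<close>

text \<open>The cells of a triangulation share faces. Shifting every point slightly in one direction
  \<open>center\<close> assigns each point to exactly one cell and avoids inclusion-exclusion;
  shifting the other way does the same for the interior, so reciprocity reduces to a change of sign.
  The cells need not be unimodular, hence the boxes. One weight \<open>w\<close> supplies both the
  heights of the triangulation and the direction of the shift, and disjointness and covering become
  duality and the simplex method for one linear program. Two facts tie this to the ring. The odd
  cycle condition serves only to identify lattice points with monomials. And \<open>D\<close> is a
  Krull dimension, defined by chains of primes: kernels of substitutions give a chain as long as the
  dimension of the span of the edge vectors, and counting monomials excludes longer ones.\<close>

lemma ex_generic_weight:
  fixes R :: "('a \<Rightarrow> real) set"
  assumes "finite A" "finite R" and R: "\<And>r. r \<in> R \<Longrightarrow> \<exists>a\<in>A. r a \<noteq> 0"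
  shows "\<exists>w. (\<forall>a. 0 < w a) \<and> (\<forall>r\<in>R. (\<Sum>a\<in>A. w a * r a) \<noteq> 0)"
proof -
  obtain i :: "'a \<Rightarrow> nat" where inj: "inj_on i A"
    using finite_imp_inj_to_nat_seg[OF assms(1)] by auto
  \<comment> \<open>Weights are sought on the moment curve \<open>w a = q ^ i a\<close>: each form
    then becomes a nonzero polynomial in \<open>q\<close>, and only finitely many \<open>q\<close>
    are roots of one of them.\<close>
  define p where "p r = (\<Sum>a\<in>A. monom (r a) (i a))" for r :: "'a \<Rightarrow> real"
  have coeff: "coeff (p r) (i a) = r a" if "a \<in> A" for r a
  proof -
    have "coeff (p r) (i a) = (\<Sum>a'\<in>A. if a' = a then r a else 0)"
      unfolding p_def coeff_sum using that inj by (intro sum.cong) (auto simp: inj_on_def)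
    then show ?thesis using that assms(1) by simp
  qed
  have "p r \<noteq> 0" if "r \<in> R" for r
    using R[OF that] coeff by (metis coeff_0)
  then have "finite (\<Union>r\<in>R. {x. poly (p r) x = 0})"
    using assms(2) poly_roots_finite by blast
  then have "infinite ({0<..} - (\<Union>r\<in>R. {x. poly (p r) x = 0}))"
    using infinite_Ioi Diff_infinite_finite by blast
  then have "{0<..} - (\<Union>r\<in>R. {x. poly (p r) x = 0}) \<noteq> {}"
    by (rule infinite_imp_nonempty)
  then obtain q where q: "q > 0" "\<And>r. r \<in> R \<Longrightarrow> poly (p r) q \<noteq> 0"
    by blast
  have "poly (p r) q = (\<Sum>a\<in>A. q ^ i a * r a)" for r
    by (simp add: p_def poly_sum poly_monom mult.commute)
  with q show ?thesis
    by (intro exI[of _ "\<lambda>a. q ^ i a"]) auto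
qed

text \<open>Positivity of \<open>p + \<epsilon> * q\<close> for infinitesimal positive \<epsilon>,
  so that half-open cones can be defined without choosing \<epsilon>.\<close>

definition lexpos :: "real \<Rightarrow> real \<Rightarrow> bool" where
  "lexpos p q \<longleftrightarrow> 0 < p \<or> p = 0 \<and> 0 < q"

lemma eventually_lexpos:
  assumes "q \<noteq> 0"
  shows "\<forall>\<^sub>F \<epsilon> in at_right 0. (0 < p + \<epsilon> * q \<longleftrightarrow> lexpos p q) \<and> p + \<epsilon> * q \<noteq> 0"
proof -
  have lim: "((\<lambda>\<epsilon>. p + \<epsilon> * q) \<longlongrightarrow> p + 0 * q) (at_right 0)"
    by (intro tendsto_intros)
  have pos: "\<forall>\<^sub>F \<epsilon>::real in at_right 0. 0 < \<epsilon>"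
    by (rule eventually_at_right_less)
  consider "p = 0" | "0 < p" | "p < 0" by linarith
  then show ?thesis
  proof cases
    case 1
    show ?thesis using pos
      by eventually_elim (use assms 1 in \<open>auto simp: lexpos_def zero_less_mult_iff\<close>)
  next
    case 2
    then have "\<forall>\<^sub>F \<epsilon> in at_right 0. 0 < p + \<epsilon> * q"
      using order_tendstoD(1)[OF lim, of 0] by simp
    then show ?thesis
      by eventually_elim (use 2 in \<open>auto simp: lexpos_def\<close>)
  next
    case 3
    then have "\<forall>\<^sub>F \<epsilon> in at_right 0. p + \<epsilon> * q < 0"
      using order_tendstoD(2)[OF lim, of 0] by simp
    then show ?thesis
      by eventually_elim (use 3 in \<open>auto simp: lexpos_def\<close>)
  qed
qed

text \<open>All generators lie on the hyperplane \<open>deg = 1\<close>. Subtracting a generator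
  therefore lowers the degree by one, which produces the factors \<open>1 - t\<close>, and the
  coordinates of a generator in any basis sum to 1, which guarantees a pivot in the simplex
  method.\<close>

locale graded_cone = vector_space scale
  for scale :: "real \<Rightarrow> 'b::ab_group_add \<Rightarrow> 'b" (infixr "*s" 75) +
  fixes A :: "'b set" and deg :: "'b \<Rightarrow> real"
  assumes finite_A: "finite A"
    and deg_add: "deg (x + y) = deg x + deg y"
    and deg_scale: "deg (c *s x) = c * deg x"
    and deg_generator: "a \<in> A \<Longrightarrow> deg a = 1"
begin

definition cone :: "'b set" where
  "cone = {(\<Sum>a\<in>A. \<gamma> a *s a) |\<gamma>. \<forall>a\<in>A. 0 \<le> \<gamma> a}"

text \<open>The relative interior of the cone, described by generators instead of facets.\<close>

definition open_cone :: "'b set" where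
  "open_cone = {(\<Sum>a\<in>A. \<gamma> a *s a) |\<gamma>. \<forall>a\<in>A. 0 < \<gamma> a}"

definition bases :: "'b set set" where
  "bases = {B. B \<subseteq> A \<and> independent B \<and> A \<subseteq> span B}"

lemma deg_0 [simp]: "deg 0 = 0"
  using deg_scale[of 0 0] by simp

lemma deg_diff: "deg (x - y) = deg x - deg y"
  using deg_add[of "x - y" y] by simp

lemma deg_sum: "deg (\<Sum>i\<in>I. f i) = (\<Sum>i\<in>I. deg (f i))"
  by (induction I rule: infinite_finite_induct) (simp_all add: deg_add)

lemma finite_bases: "finite bases"
  unfolding bases_def using finite_A by simp

lemma cone_subset_span: "cone \<subseteq> span A"
  by (auto simp: cone_def intro: span_sum span_scale span_base)

lemma basesD:
  assumes "B \<in> bases"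
  shows "B \<subseteq> A" "independent B" "span B = span A" "finite B" "card B = dim A"
proof -
  show B: "B \<subseteq> A" "independent B" using assms by (auto simp: bases_def)
  show sp: "span B = span A"
    using assms B span_mono[OF B(1)] span_minimal[of A "span B"] by (auto simp: bases_def)
  show "finite B" using B finite_A finite_subset by auto
  show "card B = dim A" using dim_eq_card sp B by metis
qed

section \<open>Coordinates with respect to a basis of generators\<close>

lemma rep_add:
  assumes "B \<in> bases" "x \<in> span A" "y \<in> span A"
  shows "representation B (x + y) b = representation B x b + representation B y b"
  using basesD[OF assms(1)] assms(2,3) by (simp add: representation_add)

lemma rep_diff:
  assumes "B \<in> bases" "x \<in> span A" "y \<in> span A"
  shows "representation B (x - y) b = representation B x b - representation B y b"
  using basesD[OF assms(1)] assms(2,3) by (simp add: representation_diff)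

lemma rep_scale:
  assumes "B \<in> bases" "x \<in> span A"
  shows "representation B (c *s x) b = c * representation B x b"
  using basesD[OF assms(1)] assms(2) by (simp add: representation_scale)

lemma rep_sum:
  assumes "B \<in> bases" "\<And>i. i \<in> I \<Longrightarrow> f i \<in> span A"
  shows "representation B (\<Sum>i\<in>I. f i) b = (\<Sum>i\<in>I. representation B (f i) b)"
  using basesD[OF assms(1)] assms(2) by (simp add: representation_sum)

lemma rep_basis:
  assumes "B \<in> bases" "b \<in> B"
  shows "representation B b b' = (if b' = b then 1 else 0)"
  using basesD[OF assms(1)] assms(2) by (simp add: representation_basis)

lemma sum_rep:
  assumes "B \<in> bases" "x \<in> span A"
  shows "(\<Sum>b\<in>B. representation B x b *s b) = x"
  using basesD[OF assms(1)] assms(2) by (intro sum_representation_eq) auto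

lemma rep_sum_scale:
  assumes "B \<in> bases" "b \<in> B"
  shows "representation B (\<Sum>b\<in>B. f b *s b) b = f b"
proof -
  have "B \<subseteq> span A" using basesD[OF assms(1)] span_superset by auto
  then have "representation B (\<Sum>b\<in>B. f b *s b) b = (\<Sum>b'\<in>B. f b' * representation B b' b)"
    using assms(1) by (simp add: rep_sum rep_scale span_scale subset_iff)
  also have "\<dots> = (\<Sum>b'\<in>B. if b' = b then f b else 0)"
    using assms by (intro sum.cong) (auto simp: rep_basis)
  finally show ?thesis using assms basesD(4) by simp
qed

lemma deg_rep:
  assumes "B \<in> bases" "x \<in> span A"
  shows "deg x = (\<Sum>b\<in>B. representation B x b)"
proof -
  have "deg x = deg (\<Sum>b\<in>B. representation B x b *s b)"
    using sum_rep[OF assms] by simp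
  also have "\<dots> = (\<Sum>b\<in>B. representation B x b)"
    unfolding deg_sum deg_scale using basesD(1)[OF assms(1)] deg_generator
    by (intro sum.cong) auto
  finally show ?thesis .
qed

lemma cone_if_rep_nonneg:
  assumes "B \<in> bases" "x \<in> span A" "\<And>b. b \<in> B \<Longrightarrow> 0 \<le> representation B x b"
  shows "x \<in> cone"
proof -
  have "x = (\<Sum>a\<in>A. (if a \<in> B then representation B x a else 0) *s a)"
    using sum_rep[OF assms(1,2)] basesD(1)[OF assms(1)] finite_A
    by (subst sum.mono_neutral_cong_right[of A B]) auto
  then show ?thesis
    unfolding cone_def using assms(3) by (intro CollectI exI[of _ "\<lambda>a. if a \<in> B then representation B x a else 0"]) auto
qed

text \<open>Caratheodory's theorem: a representation with support of minimal size is supported on an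
  independent set.\<close>

lemma cone_in_simplicial_cone:
  assumes "x \<in> cone"
  shows "\<exists>B\<in>bases. \<forall>b\<in>B. 0 \<le> representation B x b"
proof -
  define P where "P F \<longleftrightarrow> F \<subseteq> A \<and> (\<exists>\<gamma>. (\<forall>a\<in>F. 0 < \<gamma> a) \<and> x = (\<Sum>a\<in>F. \<gamma> a *s a))" for F
  obtain \<gamma>0 where \<gamma>0: "\<forall>a\<in>A. 0 \<le> \<gamma>0 a" "x = (\<Sum>a\<in>A. \<gamma>0 a *s a)"
    using assms by (auto simp: cone_def)
  have "P {a\<in>A. \<gamma>0 a \<noteq> 0}"
    unfolding P_def
  proof (intro conjI exI[of _ \<gamma>0])
    show "x = (\<Sum>a\<in>{a\<in>A. \<gamma>0 a \<noteq> 0}. \<gamma>0 a *s a)"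
      unfolding \<gamma>0(2) using finite_A by (intro sum.mono_neutral_right) auto
  qed (use \<gamma>0 in \<open>auto simp: order_less_le\<close>)
  then obtain F where F: "P F" and min: "\<And>F'. P F' \<Longrightarrow> card F \<le> card F'"
    using ex_has_least_nat[of P _ card] by blast
  obtain \<gamma> where FA: "F \<subseteq> A" and \<gamma>: "\<forall>a\<in>F. 0 < \<gamma> a" "x = (\<Sum>a\<in>F. \<gamma> a *s a)"
    using F by (auto simp: P_def)
  have finF: "finite F" using FA finite_A finite_subset by auto
  have "independent F"
  proof
    assume "dependent F"
    then obtain r0 where r0: "\<exists>v\<in>F. r0 v \<noteq> 0" "(\<Sum>v\<in>F. r0 v *s v) = 0"
      using dependent_finite[OF finF] by auto
    \<comment> \<open>After negation if necessary the relation has a positive coefficient, so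
      subtracting growing multiples of it eventually makes a coefficient of \<open>x\<close>
      vanish.\<close>
    obtain r where r: "\<exists>v\<in>F. 0 < r v" "(\<Sum>v\<in>F. r v *s v) = 0"
    proof (cases "\<exists>v\<in>F. 0 < r0 v")
      case True then show ?thesis using that r0 by blast
    next
      case False
      show ?thesis
      proof (rule that[of "\<lambda>v. - r0 v"])
        show "\<exists>v\<in>F. 0 < - r0 v" using False r0 by (metis neg_0_less_iff_less linorder_cases)
        show "(\<Sum>v\<in>F. - r0 v *s v) = 0" using r0(2) by (simp add: sum_negf)
      qed
    qed
    \<comment> \<open>The vector whose coefficient vanishes first; at that moment all others are
      still nonnegative.\<close>
    define v0 where "v0 = arg_min_on (\<lambda>v. \<gamma> v / r v) {v\<in>F. 0 < r v}"
    have fne: "finite {v\<in>F. 0 < r v}" "{v\<in>F. 0 < r v} \<noteq> {}" using finF r by auto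
    have v0: "v0 \<in> F" "0 < r v0"
      using arg_min_if_finite(1)[OF fne, of "\<lambda>v. \<gamma> v / r v"] by (auto simp: v0_def)
    have le: "\<gamma> v0 / r v0 \<le> \<gamma> v / r v" if "v \<in> F" "0 < r v" for v
      using arg_min_least[OF fne, of v "\<lambda>v. \<gamma> v / r v"] that by (auto simp: v0_def)
    define \<theta> where "\<theta> = \<gamma> v0 / r v0"
    define \<gamma>' where "\<gamma>' v = \<gamma> v - \<theta> * r v" for v
    have \<theta>: "0 < \<theta>" using v0 \<gamma> by (simp add: \<theta>_def)
    have nonneg: "0 \<le> \<gamma>' v" if "v \<in> F" for v
    proof (cases "0 < r v")
      case True
      then show ?thesis using le[OF that True] by (simp add: \<gamma>'_def \<theta>_def field_simps)
    next
      case False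
      then have "\<theta> * r v \<le> 0" using \<theta> by (simp add: mult_le_0_iff)
      moreover have "0 < \<gamma> v" using \<gamma>(1) that by blast
      ultimately show ?thesis by (simp add: \<gamma>'_def)
    qed
    have z: "\<gamma>' v0 = 0" using v0 by (simp add: \<gamma>'_def \<theta>_def)
    define F' where "F' = {v\<in>F. \<gamma>' v \<noteq> 0}"
    have "x = (\<Sum>v\<in>F. \<gamma>' v *s v)"
    proof -
      have "(\<Sum>v\<in>F. \<gamma>' v *s v) = (\<Sum>v\<in>F. \<gamma> v *s v) - \<theta> *s (\<Sum>v\<in>F. r v *s v)"
        by (simp add: \<gamma>'_def scale_left_diff_distrib sum_subtractf scale_sum_right)
      then show ?thesis using r \<gamma> by simp
    qed
    also have "\<dots> = (\<Sum>v\<in>F'. \<gamma>' v *s v)"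
      using finF by (intro sum.mono_neutral_right) (auto simp: F'_def)
    finally have "P F'"
      unfolding P_def using FA nonneg by (auto simp: F'_def order_less_le)
    moreover have "card F' < card F"
      using finF v0 z by (intro psubset_card_mono) (auto simp: F'_def)
    ultimately show False using min by (meson not_le)
  qed
  \<comment> \<open>The independent support need not span; the vectors that complete it to a basis
    get coefficient 0.\<close>
  then obtain B where B: "F \<subseteq> B" "B \<subseteq> A" "independent B" "A \<subseteq> span B"
    using maximal_independent_subset_extend[OF FA] by metis
  then have BB: "B \<in> bases" by (auto simp: bases_def)
  have xB: "x = (\<Sum>b\<in>B. (if b \<in> F then \<gamma> b else 0) *s b)"
    using \<gamma>(2) B(1) basesD(4)[OF BB] by (subst sum.mono_neutral_cong_right[of B F]) auto
  have "representation B x b = (if b \<in> F then \<gamma> b else 0)" if "b \<in> B" for b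
    by (subst xB) (rule rep_sum_scale[OF BB that])
  then show ?thesis using \<gamma>(1) by (intro bexI[OF _ BB]) (auto simp: less_imp_le)
qed

end

section \<open>Half-open triangulations\<close>

text \<open>\<open>w\<close> serves twice: as coefficients of an interior point, which by
  \<open>generic_center\<close> has no zero coordinate in any basis, and as heights, for which
  \<open>generic_price\<close> excludes ties.\<close>

locale generic_cone = graded_cone +
  fixes w :: "'a \<Rightarrow> real"
  assumes w_pos: "0 < w a"
    and generic_center: "\<lbrakk>B \<in> bases; b \<in> B\<rbrakk> \<Longrightarrow> representation B (\<Sum>a\<in>A. w a *s a) b \<noteq> 0"
    and generic_price: "\<lbrakk>B \<in> bases; e \<in> A - B\<rbrakk> \<Longrightarrow> (\<Sum>b\<in>B. representation B e b * w b) \<noteq> w e"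

text \<open>Genericity asks that finitely many linear forms in \<open>w\<close> be nonzero. The
  forms are nontrivial, since \<open>r1 B b\<close> is 1 at \<open>b\<close> and
  \<open>r2 B e\<close> is 1 at \<open>e\<close>.\<close>

lemma (in graded_cone) ex_generic: "\<exists>w. generic_cone scale A deg w"
proof -
  define r1 where "r1 B b = (\<lambda>a. representation B a b)" for B b
  define r2 where "r2 B e = (\<lambda>a. if a = e then 1 else if a \<in> B then - representation B e a else 0)"
    for B e
  define R where "R = (\<lambda>(B, b). r1 B b) ` (SIGMA B:bases. B) \<union> (\<lambda>(B, e). r2 B e) ` (SIGMA B:bases. A - B)"
  have "finite R"
    unfolding R_def using finite_bases finite_A basesD(4)
    by (intro finite_UnI finite_imageI finite_SigmaI) auto
  moreover have "\<exists>a\<in>A. r a \<noteq> 0" if "r \<in> R" for r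
    using that unfolding R_def
  proof (elim UnE imageE SigmaE2)
    fix p assume "p \<in> (SIGMA B:bases. B)" "r = (\<lambda>(B, b). r1 B b) p"
    then obtain B b where "B \<in> bases" "b \<in> B" "r = r1 B b" by auto
    then show ?thesis using basesD(1) by (intro bexI[of _ b]) (auto simp: r1_def rep_basis)
  next
    fix p assume "p \<in> (SIGMA B:bases. A - B)" "r = (\<lambda>(B, b). r2 B b) p"
    then obtain B e where "B \<in> bases" "e \<in> A - B" "r = r2 B e" by auto
    then show ?thesis by (intro bexI[of _ e]) (auto simp: r2_def)
  qed
  ultimately obtain w where w: "\<forall>a. 0 < w a" and gen: "\<forall>r\<in>R. (\<Sum>a\<in>A. w a * r a) \<noteq> 0"
    using ex_generic_weight[OF finite_A, of R] by metis
  have "generic_cone scale A deg w"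
  proof unfold_locales
    fix B b assume B: "B \<in> bases" "b \<in> B"
    have "r1 B b \<in> R" unfolding R_def using B by force
    with gen have "(\<Sum>a\<in>A. w a * representation B a b) \<noteq> 0" by (auto simp: r1_def)
    then show "representation B (\<Sum>a\<in>A. w a *s a) b \<noteq> 0"
      using B by (simp add: rep_sum rep_scale span_scale span_base)
  next
    fix B e assume B: "B \<in> bases" "e \<in> A - B"
    have "r2 B e \<in> R" unfolding R_def using B by force
    with gen have "(\<Sum>a\<in>A. w a * r2 B e a) \<noteq> 0" by auto
    also have "(\<Sum>a\<in>A. w a * r2 B e a) = w e * r2 B e e + (\<Sum>a\<in>A-{e}. w a * r2 B e a)"
      using B finite_A by (intro sum.remove) auto
    also have "(\<Sum>a\<in>A-{e}. w a * r2 B e a) = (\<Sum>b\<in>B. w b * - representation B e b)"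
      using B finite_A basesD(1)[OF B(1)] by (intro sum.mono_neutral_cong_right) (auto simp: r2_def)
    finally show "(\<Sum>b\<in>B. representation B e b * w b) \<noteq> w e"
      by (simp add: r2_def sum_negf mult.commute)
  qed (use w in auto)
  then show ?thesis by blast
qed

context generic_cone
begin

definition center :: 'a where
  "center = (\<Sum>a\<in>A. w a *s a)"

text \<open>The linear functional on the span of \<open>A\<close> that agrees with \<open>w\<close>
  on \<open>B\<close>; in the linear program, the objective value at the basic solution for
  \<open>x\<close>.\<close>

definition price :: "'a set \<Rightarrow> 'a \<Rightarrow> real" where
  "price B x = (\<Sum>b\<in>B. representation B x b * w b)"

text \<open>The maximal cells of the regular triangulation with heights \<open>w\<close>: for \<open>e \<notin> B\<close> the condition
  says that in the linear program minimizing \<open>w\<close> over the nonnegative representations of a vector,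
  the basis \<open>B\<close> has positive reduced costs.\<close>

definition triangulation :: "'a set set" where
  "triangulation = {B \<in> bases. \<forall>e\<in>A - B. price B e < w e}"

text \<open>The points \<open>x\<close> such that \<open>x + \<epsilon> \<sigma> center\<close> lies in the interior of the simplicial cone over \<open>B\<close>
  for all small \<open>\<epsilon> > 0\<close>.\<close>

definition half_open :: "real \<Rightarrow> 'a set \<Rightarrow> 'a set" where
  "half_open \<sigma> B = {x \<in> span A. \<forall>b\<in>B. lexpos (representation B x b) (\<sigma> * representation B center b)}"

lemma triangulationD: "B \<in> triangulation \<Longrightarrow> B \<in> bases"
  by (simp add: triangulation_def)

lemma finite_triangulation: "finite triangulation"
  using finite_bases by (simp add: triangulation_def)

lemma center_in_span: "center \<in> span A"
  by (auto simp: center_def intro: span_sum span_scale span_base)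

lemma rep_perturbed:
  assumes "B \<in> bases" "x \<in> span A"
  shows "representation B (x + c *s center) b = representation B x b + c * representation B center b"
  using assms center_in_span by (simp add: rep_add rep_scale span_scale)

lemma rep_center_nonzero: "\<lbrakk>B \<in> bases; b \<in> B\<rbrakk> \<Longrightarrow> representation B center b \<noteq> 0"
  using generic_center by (simp add: center_def)

text \<open>Only finitely many coordinates are involved, and \<open>center\<close> has none equal to
  0, so one \<epsilon> serves all bases at once. The bound \<delta> leaves room to keep the shifted
  point in the cone.\<close>

lemma ex_perturbation:
  assumes x: "x \<in> span A" and "\<sigma> \<noteq> 0" "0 < \<delta>"
  shows "\<exists>\<epsilon>>0. \<epsilon> < \<delta> \<and> (\<forall>B\<in>bases. \<forall>b\<in>B. representation B (x + (\<epsilon> * \<sigma>) *s center) b \<noteq> 0 \<and>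
           (0 < representation B (x + (\<epsilon> * \<sigma>) *s center) b \<longleftrightarrow>
              lexpos (representation B x b) (\<sigma> * representation B center b)))"
proof -
  have "\<forall>\<^sub>F \<epsilon> in at_right 0. \<forall>B\<in>bases. \<forall>b\<in>B.
      (0 < representation B x b + \<epsilon> * (\<sigma> * representation B center b) \<longleftrightarrow>
         lexpos (representation B x b) (\<sigma> * representation B center b)) \<and>
      representation B x b + \<epsilon> * (\<sigma> * representation B center b) \<noteq> 0"
    using assms finite_bases basesD(4) rep_center_nonzero
    by (intro eventually_ball_finite ballI eventually_lexpos) auto
  moreover have "\<forall>\<^sub>F \<epsilon> in at_right 0. \<epsilon> < \<delta>"
    using \<open>0 < \<delta>\<close> by (rule eventually_at_rightI[of 0 \<delta>, rotated]) auto
  moreover have "\<forall>\<^sub>F \<epsilon> in at_right 0. 0 < (\<epsilon>::real)"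
    by (rule eventually_at_right_less)
  ultimately have "\<forall>\<^sub>F \<epsilon> in at_right 0. 0 < \<epsilon> \<and> \<epsilon> < \<delta> \<and> (\<forall>B\<in>bases. \<forall>b\<in>B.
      (0 < representation B x b + \<epsilon> * (\<sigma> * representation B center b) \<longleftrightarrow>
         lexpos (representation B x b) (\<sigma> * representation B center b)) \<and>
      representation B x b + \<epsilon> * (\<sigma> * representation B center b) \<noteq> 0)"
    by eventually_elim blast
  then obtain \<epsilon> where "0 < \<epsilon>" "\<epsilon> < \<delta>" "\<forall>B\<in>bases. \<forall>b\<in>B.
      (0 < representation B x b + \<epsilon> * (\<sigma> * representation B center b) \<longleftrightarrow>
         lexpos (representation B x b) (\<sigma> * representation B center b)) \<and>
      representation B x b + \<epsilon> * (\<sigma> * representation B center b) \<noteq> 0"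
    using eventually_happens'[OF trivial_limit_at_right_real] by blast
  then show ?thesis
    using x by (intro exI[of _ \<epsilon>]) (auto simp: rep_perturbed mult.assoc)
qed

section \<open>Prices and the cells of the triangulation\<close>

lemma price_sum_scale:
  assumes "B \<in> bases" "F \<subseteq> A"
  shows "price B (\<Sum>a\<in>F. f a *s a) = (\<Sum>a\<in>F. f a * price B a)"
proof -
  have "price B (\<Sum>a\<in>F. f a *s a) = (\<Sum>b\<in>B. \<Sum>a\<in>F. f a * (representation B a b * w b))"
    using assms unfolding price_def
    by (intro sum.cong refl) (auto simp: rep_sum rep_scale span_scale span_base subset_iff sum_distrib_right mult.assoc)
  also have "\<dots> = (\<Sum>a\<in>F. f a * price B a)"
    unfolding price_def sum_distrib_left by (rule sum.swap)
  finally show ?thesis .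
qed

lemma price_basis:
  assumes "B \<in> bases" "b \<in> B"
  shows "price B b = w b"
proof -
  have "price B b = (\<Sum>b'\<in>B. if b' = b then w b else 0)"
    unfolding price_def using assms by (intro sum.cong) (auto simp: rep_basis)
  then show ?thesis using assms basesD(4) by simp
qed

text \<open>Weak duality and complementary slackness: \<open>price B\<close> is at most
  \<open>w\<close> on the generators, with equality only on \<open>B\<close>, and \<open>x\<close>
  is a combination of \<open>B'\<close> with positive coefficients.\<close>

lemma price_le_on_cell:
  assumes B: "B \<in> triangulation" "B' \<in> triangulation" and x: "x \<in> span A"
    and pos: "\<And>b. b \<in> B' \<Longrightarrow> 0 < representation B' x b"
  shows "price B x \<le> price B' x" "price B x = price B' x \<Longrightarrow> B' \<subseteq> B"
proof -
  have BB: "B \<in> bases" "B' \<in> bases" using B triangulationD by auto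
  have le: "price B b \<le> w b" and eq: "price B b = w b \<Longrightarrow> b \<in> B" if "b \<in> A" for b
  proof -
    have "price B b < w b" if "b \<notin> B"
      using B(1) \<open>b \<in> A\<close> that by (auto simp: triangulation_def)
    then show "price B b \<le> w b" "price B b = w b \<Longrightarrow> b \<in> B"
      using price_basis[OF BB(1), of b] by (cases "b \<in> B"; simp)+
  qed
  have px: "price B x = (\<Sum>b\<in>B'. representation B' x b * price B b)"
    using price_sum_scale[OF BB(1) basesD(1)[OF BB(2)]] sum_rep[OF BB(2) x] by metis
  have le': "representation B' x b * price B b \<le> representation B' x b * w b" if "b \<in> B'" for b
    using le pos[OF that] basesD(1)[OF BB(2)] that by (intro mult_left_mono) (auto simp: less_imp_le)
  show "price B x \<le> price B' x"
    unfolding px price_def[of B'] by (intro sum_mono le')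
  assume "price B x = price B' x"
  then have "representation B' x b * price B b = representation B' x b * w b" if "b \<in> B'" for b
    using le' that basesD(4)[OF BB(2)] unfolding px price_def[of B']
    by (intro sum_mono_inv[of "\<lambda>b. representation B' x b * price B b" B'
          "\<lambda>b. representation B' x b * w b" b]) auto
  then show "B' \<subseteq> B"
    using pos eq basesD(1)[OF BB(2)] by fastforce
qed

text \<open>The shifted point is interior to both cells. Each of its prices bounds the other, so
  they agree, and the equality case gives both inclusions.\<close>

lemma half_open_disjoint:
  assumes B: "B \<in> triangulation" "B' \<in> triangulation" and "\<sigma> \<noteq> 0"
    and x: "x \<in> half_open \<sigma> B" "x \<in> half_open \<sigma> B'"
  shows "B = B'"
proof -
  have sp: "x \<in> span A" using x by (simp add: half_open_def)
  obtain \<epsilon> where eps: "\<forall>B\<in>bases. \<forall>b\<in>B.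
      0 < representation B (x + (\<epsilon> * \<sigma>) *s center) b \<longleftrightarrow>
        lexpos (representation B x b) (\<sigma> * representation B center b)"
    using ex_perturbation[OF sp \<open>\<sigma> \<noteq> 0\<close> zero_less_one] by blast
  define z where "z = x + (\<epsilon> * \<sigma>) *s center"
  have z: "z \<in> span A" using sp center_in_span by (simp add: z_def span_add span_scale)
  have pos: "0 < representation B z b" if "b \<in> B" for b
    using eps x(1) triangulationD[OF B(1)] that by (auto simp: z_def half_open_def)
  have pos': "0 < representation B' z b" if "b \<in> B'" for b
    using eps x(2) triangulationD[OF B(2)] that by (auto simp: z_def half_open_def)
  have "price B z = price B' z"
    using price_le_on_cell(1)[OF B z pos'] price_le_on_cell(1)[OF B(2,1) z pos]
    by simp
  then show ?thesis
    using price_le_on_cell(2)[OF B z pos'] price_le_on_cell(2)[OF B(2,1) z pos]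
    by simp
qed

text \<open>The simplex algorithm: a basis of minimal price among those whose cone contains \<open>x\<close> has
  positive reduced costs, since otherwise a pivot step would decrease the price.\<close>

lemma triangulation_covers:
  assumes x: "x \<in> cone" and gen: "\<And>B b. \<lbrakk>B \<in> bases; b \<in> B\<rbrakk> \<Longrightarrow> representation B x b \<noteq> 0"
  shows "\<exists>B\<in>triangulation. \<forall>b\<in>B. 0 < representation B x b"
proof -
  define C where "C = {B\<in>bases. \<forall>b\<in>B. 0 \<le> representation B x b}"
  have C: "finite C" "C \<noteq> {}"
    using finite_bases cone_in_simplicial_cone[OF x] by (auto simp: C_def)
  have sp: "x \<in> span A" using x cone_subset_span by auto
  define B where "B = arg_min_on (\<lambda>B. price B x) C"
  have "B \<in> C" unfolding B_def using arg_min_if_finite(1)[OF C] .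
  then have B: "B \<in> bases" and pos: "\<And>b. b \<in> B \<Longrightarrow> 0 < representation B x b"
    using gen by (auto simp: C_def order_less_le)
  have min: "price B x \<le> price B' x" if "B' \<in> C" for B'
    unfolding B_def using arg_min_least[OF C that, of "\<lambda>B. price B x"] .
  have "B \<in> triangulation"
  proof (rule ccontr)
    assume "B \<notin> triangulation"
    then obtain e where e: "e \<in> A - B" "\<not> price B e < w e"
      using B by (auto simp: triangulation_def)
    then have red: "w e < price B e" using generic_price[OF B e(1)] by (simp add: price_def)
    define \<mu> where "\<mu> = representation B e"
    define l where "l = representation B x"
    have spe: "e \<in> span A" using e by (simp add: span_base)
    \<comment> \<open>Some coordinate of \<open>e\<close> is positive because they sum to 1, so the
      pivot step cannot be unbounded.\<close>
    have "(\<Sum>b\<in>B. \<mu> b) = 1"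
      using deg_rep[OF B spe] deg_generator[of e] e by (simp add: \<mu>_def)
    then have "\<exists>b\<in>B. 0 < \<mu> b"
      by (metis not_le sum_nonpos zero_less_one)
    then have fne: "finite {b\<in>B. 0 < \<mu> b}" "{b\<in>B. 0 < \<mu> b} \<noteq> {}" using basesD(4)[OF B] by auto
    \<comment> \<open>Ratio test: \<open>b0\<close> is the basis vector whose coordinate reaches 0
      first as \<open>e\<close> enters, so it leaves the basis.\<close>
    define b0 where "b0 = arg_min_on (\<lambda>b. l b / \<mu> b) {b\<in>B. 0 < \<mu> b}"
    have b0: "b0 \<in> B" "0 < \<mu> b0"
      using arg_min_if_finite(1)[OF fne, of "\<lambda>b. l b / \<mu> b"] by (auto simp: b0_def)
    have le: "l b0 / \<mu> b0 \<le> l b / \<mu> b" if "b \<in> B" "0 < \<mu> b" for b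
      using arg_min_least[OF fne, of b "\<lambda>b. l b / \<mu> b"] that by (auto simp: b0_def)
    define \<theta> where "\<theta> = l b0 / \<mu> b0"
    have \<theta>: "0 < \<theta>" using b0 pos by (simp add: \<theta>_def l_def)
    have nonneg: "0 \<le> l b - \<theta> * \<mu> b" if "b \<in> B" for b
    proof (cases "0 < \<mu> b")
      case True
      then show ?thesis using le[OF that True] by (simp add: \<theta>_def field_simps)
    next
      case False
      then have "\<theta> * \<mu> b \<le> 0" using \<theta> by (simp add: mult_le_0_iff)
      moreover have "0 < l b" using pos that by (simp add: l_def)
      ultimately show ?thesis by simp
    qed
    define B0 where "B0 = B - {b0}"
    define B' where "B' = insert e B0"
    have e_notin: "e \<notin> span B0"
    proof
      assume "e \<in> span B0"
      moreover have "finite B0" using basesD(4)[OF B] by (simp add: B0_def)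
      ultimately obtain f where f: "e = (\<Sum>b\<in>B0. f b *s b)"
        using span_finite by auto
      have "(\<Sum>b\<in>B0. f b *s b) = (\<Sum>b\<in>B. (if b = b0 then 0 else f b) *s b)"
        using basesD(4)[OF B] by (intro sum.mono_neutral_cong_left) (auto simp: B0_def)
      then have "\<mu> b0 = 0"
        using rep_sum_scale[OF B b0(1), of "\<lambda>b. if b = b0 then 0 else f b"] f
        by (simp add: \<mu>_def)
      with b0 show False by simp
    qed
    have B': "B' \<in> bases"
    proof -
      have "independent B'" unfolding B'_def B0_def
        using e_notin independent_mono[OF basesD(2)[OF B], of B0]
        by (intro independent_insertI) (auto simp: B0_def)
      moreover have "b0 \<in> span B'"
        unfolding B'_def B0_def using e_notin spe basesD(3)[OF B]
        by (intro in_span_delete) (auto simp: B0_def)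
      then have "B \<subseteq> span B'"
        by (auto simp: B'_def B0_def intro: span_base)
      then have "A \<subseteq> span B'"
        using basesD(3)[OF B] span_superset[of A] span_minimal[OF _ subspace_span] by blast
      ultimately show ?thesis
        using basesD(1)[OF B] e by (auto simp: bases_def B'_def B0_def)
    qed
    define f where "f b = (if b = e then \<theta> else l b - \<theta> * \<mu> b)" for b
    have xe: "x = (\<Sum>b\<in>B'. f b *s b)"
    proof -
      have "(\<Sum>b\<in>B'. f b *s b) = \<theta> *s e + (\<Sum>b\<in>B0. f b *s b)"
        using e basesD(4)[OF B] by (simp add: B'_def B0_def f_def)
      also have "(\<Sum>b\<in>B0. f b *s b) = (\<Sum>b\<in>B. (l b - \<theta> * \<mu> b) *s b)"
        using e b0 basesD(4)[OF B] by (intro sum.mono_neutral_cong_left) (auto simp: B0_def f_def \<theta>_def)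
      also have "\<dots> = x - \<theta> *s e"
        using sum_rep[OF B sp] sum_rep[OF B spe]
        by (simp add: scale_left_diff_distrib sum_subtractf l_def \<mu>_def flip: scale_scale scale_sum_right)
      finally show ?thesis by simp
    qed
    have "representation B' x b = f b" if "b \<in> B'" for b
      by (subst xe) (rule rep_sum_scale[OF B' that])
    then have "B' \<in> C"
      using B' \<theta> nonneg by (auto simp: C_def B'_def B0_def f_def)
    moreover have "price B' x < price B x"
    proof -
      have "price B' x = (\<Sum>b\<in>B'. f b * w b)"
        unfolding price_def using \<open>\<And>b. b \<in> B' \<Longrightarrow> representation B' x b = f b\<close> by simp
      also have "\<dots> = \<theta> * w e + (\<Sum>b\<in>B0. f b * w b)"
        using e basesD(4)[OF B] by (simp add: B'_def B0_def f_def)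
      also have "(\<Sum>b\<in>B0. f b * w b) = (\<Sum>b\<in>B. (l b - \<theta> * \<mu> b) * w b)"
        using e b0 basesD(4)[OF B] by (intro sum.mono_neutral_cong_left) (auto simp: B0_def f_def \<theta>_def)
      also have "\<dots> = price B x - \<theta> * price B e"
        by (simp add: left_diff_distrib sum_subtractf l_def \<mu>_def price_def sum_distrib_left mult.assoc)
      finally have "price B' x = price B x - \<theta> * (price B e - w e)"
        by (simp add: right_diff_distrib)
      then show ?thesis using \<theta> red by simp
    qed
    ultimately show False using min by fastforce
  qed
  then show ?thesis using pos by blast
qed

text \<open>The shifted point has no zero coordinate in any basis, so the simplex argument places it
  inside a cell; by the choice of \<epsilon> the signs there are those tested in
  \<open>half_open\<close>.\<close>

lemma half_open_covers:
  assumes x: "x \<in> span A" and "\<sigma> \<noteq> 0" "0 < \<delta>"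
    and "\<And>\<epsilon>. \<lbrakk>0 < \<epsilon>; \<epsilon> < \<delta>\<rbrakk> \<Longrightarrow> x + (\<epsilon> * \<sigma>) *s center \<in> cone"
  shows "\<exists>B\<in>triangulation. x \<in> half_open \<sigma> B"
proof -
  obtain \<epsilon> where "0 < \<epsilon>" "\<epsilon> < \<delta>" and eps: "\<forall>B\<in>bases. \<forall>b\<in>B.
      representation B (x + (\<epsilon> * \<sigma>) *s center) b \<noteq> 0 \<and>
      (0 < representation B (x + (\<epsilon> * \<sigma>) *s center) b \<longleftrightarrow>
        lexpos (representation B x b) (\<sigma> * representation B center b))"
    using ex_perturbation[OF x \<open>\<sigma> \<noteq> 0\<close> \<open>0 < \<delta>\<close>] by blast
  obtain B where "B \<in> triangulation" "\<forall>b\<in>B. 0 < representation B (x + (\<epsilon> * \<sigma>) *s center) b"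
    using triangulation_covers[of "x + (\<epsilon> * \<sigma>) *s center"] eps assms(4)[OF \<open>0 < \<epsilon>\<close> \<open>\<epsilon> < \<delta>\<close>] by blast
  then show ?thesis
    using eps x triangulationD by (auto simp: half_open_def)
qed

section \<open>The half-open cells cover the cone and its interior\<close>

lemma cone_covered:
  assumes "x \<in> cone"
  shows "\<exists>B\<in>triangulation. x \<in> half_open 1 B"
proof (rule half_open_covers[of _ _ 1])
  show "x \<in> span A" using assms cone_subset_span by auto
  fix \<epsilon> :: real assume \<epsilon>: "0 < \<epsilon>" "\<epsilon> < 1"
  obtain \<gamma> where \<gamma>: "x = (\<Sum>a\<in>A. \<gamma> a *s a)" "\<forall>a\<in>A. 0 \<le> \<gamma> a"
    using assms by (auto simp: cone_def)
  have "x + (\<epsilon> * 1) *s center = (\<Sum>a\<in>A. (\<gamma> a + \<epsilon> * w a) *s a)"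
    by (simp add: \<gamma>(1) center_def scale_sum_right sum.distrib scale_left_distrib)
  then show "x + (\<epsilon> * 1) *s center \<in> cone"
    unfolding cone_def using \<gamma>(2) \<epsilon> w_pos
    by (intro CollectI exI[of _ "\<lambda>a. \<gamma> a + \<epsilon> * w a"]) (auto simp: less_imp_le)
qed auto

lemma open_cone_covered:
  assumes "x \<in> open_cone"
  shows "\<exists>B\<in>triangulation. x \<in> half_open (- 1) B"
proof -
  obtain \<gamma> where \<gamma>: "x = (\<Sum>a\<in>A. \<gamma> a *s a)" "\<forall>a\<in>A. 0 < \<gamma> a"
    using assms by (auto simp: open_cone_def)
  \<comment> \<open>Up to this step size all coefficients
    \<open>\<gamma> a - \<epsilon> * w a\<close> stay nonnegative; the 1 keeps the set nonempty when
    \<open>A\<close> is empty.\<close>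
  define \<delta> where "\<delta> = Min (insert 1 ((\<lambda>a. \<gamma> a / w a) ` A))"
  have "0 < \<delta>"
    using finite_A \<gamma>(2) w_pos by (auto simp: \<delta>_def)
  have \<delta>: "\<delta> \<le> \<gamma> a / w a" if "a \<in> A" for a
    using finite_A that by (auto simp: \<delta>_def)
  show ?thesis
  proof (rule half_open_covers[OF _ _ \<open>0 < \<delta>\<close>])
    show "x \<in> span A" by (auto simp: \<gamma> intro: span_sum span_scale span_base)
    fix \<epsilon> :: real assume \<epsilon>: "0 < \<epsilon>" "\<epsilon> < \<delta>"
    have "x + (\<epsilon> * - 1) *s center = (\<Sum>a\<in>A. (\<gamma> a - \<epsilon> * w a) *s a)"
      by (simp add: \<gamma>(1) center_def scale_sum_right sum_subtractf sum_negf scale_left_diff_distrib)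
    moreover have "0 \<le> \<gamma> a - \<epsilon> * w a" if "a \<in> A" for a
    proof -
      have "\<epsilon> \<le> \<gamma> a / w a" using \<delta>[OF that] \<epsilon> by simp
      then show ?thesis using w_pos[of a] by (simp add: field_simps)
    qed
    ultimately show "x + (\<epsilon> * - 1) *s center \<in> cone"
      unfolding cone_def by (intro CollectI exI[of _ "\<lambda>a. \<gamma> a - \<epsilon> * w a"]) auto
  qed auto
qed

lemma half_open_subset_cone:
  assumes "B \<in> bases"
  shows "half_open \<sigma> B \<subseteq> cone"
  using cone_if_rep_nonneg[OF assms] by (auto simp: half_open_def lexpos_def order_le_less)

text \<open>Undoing the shift adds a multiple of \<open>center\<close>, hence a positive amount of
  every generator, to a point of the cone.\<close>

lemma half_open_subset_open_cone:
  assumes B: "B \<in> bases"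
  shows "half_open (- 1) B \<subseteq> open_cone"
proof
  fix x assume x: "x \<in> half_open (- 1) B"
  then have sp: "x \<in> span A" by (simp add: half_open_def)
  obtain \<epsilon> where \<epsilon>: "0 < \<epsilon>" and eps: "\<forall>B\<in>bases. \<forall>b\<in>B.
      (0 < representation B (x + (\<epsilon> * - 1) *s center) b \<longleftrightarrow>
        lexpos (representation B x b) (- 1 * representation B center b))"
    using ex_perturbation[OF sp, of "- 1" 1] by auto
  have "x + (\<epsilon> * - 1) *s center \<in> cone"
    using B x eps sp center_in_span
    by (intro cone_if_rep_nonneg[OF B] span_add span_scale) (auto simp: half_open_def less_imp_le)
  then obtain \<gamma> where \<gamma>: "x + (\<epsilon> * - 1) *s center = (\<Sum>a\<in>A. \<gamma> a *s a)" "\<forall>a\<in>A. 0 \<le> \<gamma> a"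
    by (auto simp: cone_def)
  have "x = (x + (\<epsilon> * - 1) *s center) + \<epsilon> *s center" by simp
  also have "\<dots> = (\<Sum>a\<in>A. (\<gamma> a + \<epsilon> * w a) *s a)"
    unfolding \<gamma>(1) by (simp add: center_def scale_sum_right sum.distrib scale_left_distrib)
  finally show "x \<in> open_cone"
    unfolding open_cone_def using \<gamma>(2) \<epsilon> w_pos
    by (intro CollectI exI[of _ "\<lambda>a. \<gamma> a + \<epsilon> * w a"]) (auto simp: add_nonneg_pos)
qed

end

section \<open>Reciprocity\<close>

text \<open>For \<open>s \<noteq> 0\<close> exactly one of a pair and its negative is
  lexicographically positive; under reflection this turns closed facets into open ones and
  conversely.\<close>

lemma lexpos_dual: "s \<noteq> 0 \<Longrightarrow> lexpos (- r) (- s) \<longleftrightarrow> \<not> lexpos r s"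
  by (auto simp: lexpos_def)

text \<open>\<open>L\<close> is a subgroup containing the generators but need not be generated by
  them. By \<open>finite_component\<close> and \<open>deg_nat\<close>, counting by natural degrees
  loses no lattice point of the cone. The strict inequality in \<open>u_minimal\<close> is what
  makes the leading coefficient 1.\<close>

locale lattice_cone = graded_cone +
  fixes L :: "'a set" and u :: 'a
  assumes zero_in_L: "0 \<in> L"
    and diff_in_L: "\<lbrakk>x \<in> L; y \<in> L\<rbrakk> \<Longrightarrow> x - y \<in> L"
    and A_subset_L: "A \<subseteq> L"
    and finite_component: "finite {x \<in> L \<inter> cone. deg x = real k}"
    and deg_nat: "\<lbrakk>x \<in> L; x \<in> cone\<rbrakk> \<Longrightarrow> deg x \<in> \<nat>"
    and u_in: "u \<in> L" "u \<in> open_cone"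
    and u_minimal: "\<lbrakk>x \<in> L; x \<in> open_cone; x \<noteq> u\<rbrakk> \<Longrightarrow> deg u < deg x"
begin

definition count :: "'a set \<Rightarrow> int fps" where
  "count X = Abs_fps (\<lambda>k. int (card {x \<in> X. deg x = real k}))"

lemma add_in_L: "\<lbrakk>x \<in> L; y \<in> L\<rbrakk> \<Longrightarrow> x + y \<in> L"
  using diff_in_L[of x "0 - y"] diff_in_L[OF zero_in_L, of y] by simp

lemma sum_in_L: "(\<And>i. i \<in> I \<Longrightarrow> f i \<in> L) \<Longrightarrow> sum f I \<in> L"
  by (induction I rule: infinite_finite_induct) (auto simp: zero_in_L add_in_L)

end

locale generic_lattice_cone = generic_cone + lattice_cone
begin

text \<open>For \<open>F = B\<close> these are the lattice points of the half-open fundamental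
  parallelepiped, for empty \<open>F\<close> those of the half-open cone; the sets in between allow
  the factors \<open>1 - t\<close> to be split off one at a time.\<close>

definition box :: "real \<Rightarrow> 'a set \<Rightarrow> 'a set \<Rightarrow> 'a set" where
  "box \<sigma> B F = {x \<in> L. x \<in> half_open \<sigma> B \<and> (\<forall>b\<in>F. x - b \<notin> half_open \<sigma> B)}"

lemma generator_in_span: "\<lbrakk>B \<in> bases; b \<in> B\<rbrakk> \<Longrightarrow> b \<in> span A"
  using basesD(1) by (auto intro: span_base)

lemma half_open_add:
  assumes "B \<in> bases" "b \<in> B" "x \<in> half_open \<sigma> B"
  shows "x + b \<in> half_open \<sigma> B"
proof -
  have sp: "x \<in> span A" "b \<in> span A"
    using assms generator_in_span by (auto simp: half_open_def)
  have "lexpos (r + (if b' = b then 1 else 0)) s" if "lexpos r s" for b' r s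
    using that by (auto simp: lexpos_def)
  then show ?thesis
    using assms(2,3) sp rep_add[OF assms(1) sp] rep_basis[OF assms(1,2)]
    by (simp add: half_open_def span_add)
qed

lemma half_open_diff:
  assumes "B \<in> bases" "b \<in> B" "x \<in> half_open \<sigma> B"
  shows "x - b \<in> half_open \<sigma> B \<longleftrightarrow> lexpos (representation B x b - 1) (\<sigma> * representation B center b)"
proof -
  have sp: "x \<in> span A" "b \<in> span A"
    using assms generator_in_span by (auto simp: half_open_def)
  have "representation B (x - b) b' = representation B x b' - (if b' = b then 1 else 0)" for b'
    using rep_diff[OF assms(1) sp] rep_basis[OF assms(1,2)] by simp
  then show ?thesis
    using assms(2,3) sp by (auto simp: half_open_def span_diff)
qed

lemma box_iff:
  assumes "B \<in> bases" "F \<subseteq> B"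
  shows "x \<in> box \<sigma> B F \<longleftrightarrow> x \<in> L \<and> x \<in> half_open \<sigma> B \<and>
           (\<forall>b\<in>F. \<not> lexpos (representation B x b - 1) (\<sigma> * representation B center b))"
proof (cases "x \<in> half_open \<sigma> B")
  case True
  have "x - b \<in> half_open \<sigma> B \<longleftrightarrow> lexpos (representation B x b - 1) (\<sigma> * representation B center b)"
    if "b \<in> F" for b
    using half_open_diff[OF assms(1) _ True] that assms(2) by blast
  then show ?thesis using True by (simp add: box_def)
qed (simp add: box_def)

lemma box_subset: "box \<sigma> B F \<subseteq> half_open \<sigma> B" "box \<sigma> B F \<subseteq> L"
  by (auto simp: box_def)

lemma finite_box_component:
  assumes "B \<in> bases"
  shows "finite {x \<in> box \<sigma> B F. deg x = real k}"
proof (rule finite_subset[OF _ finite_component[of k]])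
  show "{x \<in> box \<sigma> B F. deg x = real k} \<subseteq> {x \<in> L \<inter> cone. deg x = real k}"
    using half_open_subset_cone[OF assms] by (auto simp: box_def)
qed

text \<open>If \<open>b\<close> can be subtracted, the point is a translate of another point of the
  same box, because the coordinates in \<open>F\<close> do not change; otherwise it lies in the
  smaller box.\<close>

lemma box_insert:
  assumes B: "B \<in> bases" and F: "insert b F \<subseteq> B" "b \<notin> F"
  shows "box \<sigma> B F = box \<sigma> B (insert b F) \<union> (\<lambda>x. x + b) ` box \<sigma> B F"
    and "box \<sigma> B (insert b F) \<inter> (\<lambda>x. x + b) ` box \<sigma> B F = {}"
proof -
  have b: "b \<in> B" "b \<in> L" and FB: "F \<subseteq> B"
    using F basesD(1)[OF B] A_subset_L by auto
  have rep_add_b: "representation B (x + b) f = representation B x f"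
    if "x \<in> span A" "f \<in> F" for x f
    using that F B b generator_in_span[OF B b(1)] by (auto simp: rep_add rep_basis)
  have rep_diff_b: "representation B (x - b) f = representation B x f"
    if "x \<in> span A" "f \<in> F" for x f
    using that F B b generator_in_span[OF B b(1)] by (auto simp: rep_diff rep_basis)
  show "box \<sigma> B F = box \<sigma> B (insert b F) \<union> (\<lambda>x. x + b) ` box \<sigma> B F"
  proof (intro equalityI subsetI)
    fix x assume x: "x \<in> box \<sigma> B F"
    then have sp: "x \<in> span A" using box_subset by (auto simp: half_open_def)
    show "x \<in> box \<sigma> B (insert b F) \<union> (\<lambda>x. x + b) ` box \<sigma> B F"
    proof (cases "x - b \<in> half_open \<sigma> B")
      case True
      then have "x - b \<in> box \<sigma> B F"
        using x b sp diff_in_L by (simp add: box_iff[OF B FB] rep_diff_b)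
      then show ?thesis by (intro UnI2 image_eqI[of _ _ "x - b"]) auto
    qed (use x in \<open>auto simp: box_def\<close>)
  next
    fix x assume "x \<in> box \<sigma> B (insert b F) \<union> (\<lambda>x. x + b) ` box \<sigma> B F"
    then consider "x \<in> box \<sigma> B (insert b F)" | y where "x = y + b" "y \<in> box \<sigma> B F" by blast
    then show "x \<in> box \<sigma> B F"
    proof cases
      case 2
      then have "y \<in> span A" using box_subset by (auto simp: half_open_def)
      then show ?thesis
        using 2 b add_in_L half_open_add[OF B b(1)] by (simp add: box_iff[OF B FB] rep_add_b)
    qed (auto simp: box_def)
  qed
  show "box \<sigma> B (insert b F) \<inter> (\<lambda>x. x + b) ` box \<sigma> B F = {}"
    by (auto simp: box_def)
qed

lemma count_box_insert:
  assumes B: "B \<in> bases" and F: "insert b F \<subseteq> B" "b \<notin> F"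
  shows "count (box \<sigma> B (insert b F)) = count (box \<sigma> B F) * (1 - fps_X)"
proof -
  have "count (box \<sigma> B F) $ k = (count (box \<sigma> B (insert b F)) + fps_X * count (box \<sigma> B F)) $ k" for k
  proof -
    have "{x \<in> box \<sigma> B F. deg x = real k} =
      {x \<in> box \<sigma> B (insert b F). deg x = real k} \<union> (\<lambda>x. x + b) ` {x \<in> box \<sigma> B F. deg x = real k - 1}"
    proof -
      have "deg (x + b) = deg x + 1" for x
        using deg_add deg_generator F basesD(1)[OF B] by auto
      then show ?thesis
        by (subst box_insert(1)[OF assms]) auto
    qed
    moreover have "{x \<in> box \<sigma> B (insert b F). deg x = real k} \<inter>
        (\<lambda>x. x + b) ` {x \<in> box \<sigma> B F. deg x = real k - 1} = {}"
      using box_insert(2)[OF assms] by blast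
    \<comment> \<open>The subtraction is one of reals: for \<open>k = 0\<close> the degree is -1,
      which no point of the cone has.\<close>
    moreover have "finite {x \<in> box \<sigma> B F. deg x = real k - 1} \<and>
        int (card {x \<in> box \<sigma> B F. deg x = real k - 1}) = (fps_X * count (box \<sigma> B F)) $ k"
    proof (cases k)
      case 0
      have "{x \<in> box \<sigma> B F. deg x = real k - 1} = {}"
      proof -
        have "deg x \<ge> 0" if "x \<in> box \<sigma> B F" for x
        proof -
          have "deg x \<in> \<nat>"
            using that half_open_subset_cone[OF B] by (intro deg_nat) (auto simp: box_def)
          then show ?thesis by (auto elim: Nats_cases)
        qed
        then show ?thesis using 0 by force
      qed
      then show ?thesis using 0 by (simp only: card.empty finite.emptyI) simp
    next
      case (Suc m)
      then show ?thesis using finite_box_component[OF B, of \<sigma> F m] by (simp add: count_def)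
    qed
    ultimately show ?thesis
      using finite_box_component[OF B, of \<sigma> "insert b F" k]
      by (simp add: count_def card_Un_disjoint card_image inj_on_def)
  qed
  then have "count (box \<sigma> B F) = count (box \<sigma> B (insert b F)) + fps_X * count (box \<sigma> B F)"
    by (rule fps_ext)
  then show ?thesis by (simp add: algebra_simps)
qed

lemma count_box:
  assumes B: "B \<in> bases"
  shows "count (box \<sigma> B B) = count (box \<sigma> B {}) * (1 - fps_X) ^ dim A"
proof -
  have *: "count (box \<sigma> B F) = count (box \<sigma> B {}) * (1 - fps_X) ^ card F" if "finite F" "F \<subseteq> B" for F
    using that
  proof (induction F)
    case (insert b F)
    then show ?case using count_box_insert[OF B, of b F \<sigma>] by simp
  qed simp
  show ?thesis using *[OF basesD(4)[OF B] subset_refl] basesD(5)[OF B] by simp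
qed

lemma count_cone: "count (L \<inter> cone) = (\<Sum>B\<in>triangulation. count (box 1 B {}))"
proof (rule fps_ext)
  fix k
  have "{x \<in> L \<inter> cone. deg x = real k} = (\<Union>B\<in>triangulation. {x \<in> box 1 B {}. deg x = real k})"
    using cone_covered half_open_subset_cone[OF triangulationD] by (auto simp: box_def)
  moreover have "card (\<Union>B\<in>triangulation. {x \<in> box 1 B {}. deg x = real k}) =
      (\<Sum>B\<in>triangulation. card {x \<in> box 1 B {}. deg x = real k})"
  proof (rule card_UN_disjoint[OF finite_triangulation]; intro ballI impI)
    show "finite {x \<in> box 1 B {}. deg x = real k}" if "B \<in> triangulation" for B
      using finite_box_component[OF triangulationD[OF that]] .
    show "{x \<in> box 1 B {}. deg x = real k} \<inter> {x \<in> box 1 B' {}. deg x = real k} = {}"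
      if "B \<in> triangulation" "B' \<in> triangulation" "B \<noteq> B'" for B B'
      using half_open_disjoint[OF that(1,2), of 1] that(3) by (auto simp: box_def)
  qed
  ultimately show "count (L \<inter> cone) $ k = (\<Sum>B\<in>triangulation. count (box 1 B {})) $ k"
    by (simp add: count_def fps_sum_nth)
qed

text \<open>With \<open>s\<close> the coordinate of the shift, the box asks of each coordinate
  \<open>r\<close> that \<open>lexpos r s\<close> hold and \<open>lexpos (r - 1) s\<close> fail.
  Replacing \<open>r\<close> by \<open>1 - r\<close> and \<open>s\<close> by \<open>- s\<close>
  exchanges the two conditions, by \<open>lexpos_dual\<close>.\<close>

lemma box_dual:
  assumes B: "B \<in> bases" and "\<sigma> \<noteq> 0" and x: "x \<in> box \<sigma> B B"
  shows "\<Sum>B - x \<in> box (- \<sigma>) B B"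
proof -
  have sp: "x \<in> span A" using x by (auto simp: box_def half_open_def)
  have BL: "\<Sum>B \<in> L" using basesD(1)[OF B] A_subset_L by (intro sum_in_L) auto
  have Bsp: "\<Sum>B \<in> span A" using generator_in_span[OF B] by (auto intro: span_sum)
  have rep: "representation B (\<Sum>B - x) b = 1 - representation B x b" if "b \<in> B" for b
    using rep_sum_scale[OF B that, of "\<lambda>_. 1"] by (simp add: rep_diff[OF B Bsp sp])
  have nz: "\<sigma> * representation B center b \<noteq> 0" if "b \<in> B" for b
    using rep_center_nonzero[OF B that] \<open>\<sigma> \<noteq> 0\<close> by simp
  have "lexpos (1 - r) (- \<sigma> * c) \<longleftrightarrow> \<not> lexpos (r - 1) (\<sigma> * c)"
    "lexpos (1 - r - 1) (- \<sigma> * c) \<longleftrightarrow> \<not> lexpos r (\<sigma> * c)" if "\<sigma> * c \<noteq> 0" for r c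
    using lexpos_dual[OF that, of "r - 1"] lexpos_dual[OF that, of r] by simp_all
  then show ?thesis
    using x BL Bsp sp nz diff_in_L
    by (simp add: box_iff[OF B subset_refl] half_open_def span_diff rep del: mult_minus_left)
qed

lemma deg_sum_basis:
  assumes B: "B \<in> bases"
  shows "deg (\<Sum>B) = real (dim A)"
proof -
  have "(\<Sum>b\<in>B. deg b) = (\<Sum>b\<in>B. 1)"
    using basesD(1)[OF B] deg_generator by (intro sum.cong) auto
  then show ?thesis using deg_sum[of "\<lambda>x. x" B] basesD(5)[OF B] by simp
qed

lemma card_box_dual:
  assumes B: "B \<in> bases"
  shows "card {x \<in> box 1 B B. deg x = r} = card {x \<in> box (- 1) B B. deg x = real (dim A) - r}"
proof (rule bij_betw_same_card[OF bij_betw_byWitness[of _ "\<lambda>x. \<Sum>B - x" "\<lambda>x. \<Sum>B - x"]])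
  show "(\<lambda>x. \<Sum>B - x) ` {x \<in> box 1 B B. deg x = r} \<subseteq> {x \<in> box (- 1) B B. deg x = real (dim A) - r}"
    "(\<lambda>x. \<Sum>B - x) ` {x \<in> box (- 1) B B. deg x = real (dim A) - r} \<subseteq> {x \<in> box 1 B B. deg x = r}"
    using box_dual[OF B, of 1] box_dual[OF B, of "- 1"] deg_sum_basis[OF B]
    by (auto simp: deg_diff)
qed auto

lemma numerator:
  "\<exists>h. count (L \<inter> cone) * (1 - fps_X) ^ dim A = fps_of_poly h \<and> lead_coeff h = 1"
proof -
  define c where "c k = (\<Sum>B\<in>triangulation. int (card {x \<in> box 1 B B. deg x = real k}))" for k
  have "count (L \<inter> cone) * (1 - fps_X) ^ dim A = (\<Sum>B\<in>triangulation. count (box 1 B B))"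
    unfolding count_cone sum_distrib_right using count_box triangulationD by (intro sum.cong) auto
  then have nth: "(count (L \<inter> cone) * (1 - fps_X) ^ dim A) $ k = c k" for k
    by (simp add: c_def fps_sum_nth count_def)
  have c_dual: "c k = (\<Sum>B\<in>triangulation. int (card {x \<in> box (- 1) B B. deg x = real (dim A) - real k}))" for k
    unfolding c_def using card_box_dual triangulationD by (intro sum.cong) auto
  have box_interior: "x \<in> L \<and> x \<in> open_cone" if "B \<in> triangulation" "x \<in> box (- 1) B B" for B x
    using that half_open_subset_open_cone triangulationD box_subset by blast
  obtain B0 where B0: "B0 \<in> triangulation" "u \<in> half_open (- 1) B0"
    using open_cone_covered[OF u_in(2)] by blast
  \<comment> \<open>Lying in the half-open cone is not enough, \<open>u\<close> must lie in the box:
    if a generator could be subtracted, the result would be an interior lattice point of smaller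
    degree.\<close>
  have "u - b \<notin> half_open (- 1) B0" if "b \<in> B0" for b
  proof
    have b: "b \<in> A" using that basesD(1) triangulationD B0(1) by blast
    assume "u - b \<in> half_open (- 1) B0"
    then have "u - b \<in> L" "u - b \<in> open_cone"
      using half_open_subset_open_cone[OF triangulationD[OF B0(1)]] diff_in_L u_in b A_subset_L by auto
    moreover have "deg (u - b) = deg u - 1" using b by (simp add: deg_diff deg_generator)
    ultimately show False using u_minimal[of "u - b"] by (cases "u - b = u") auto
  qed
  then have uB: "u \<in> box (- 1) B0 B0" using u_in B0 by (simp add: box_def)
  \<comment> \<open>Integrality comes from the reflected point, which is a lattice point of the
    cone.\<close>
  have "real (dim A) - deg u \<in> \<nat>"
  proof -
    have bB: "B0 \<in> bases" using B0 triangulationD by simp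
    have "\<Sum>B0 - u \<in> box 1 B0 B0" using box_dual[OF bB _ uB] by simp
    then have "deg (\<Sum>B0 - u) \<in> \<nat>"
      using half_open_subset_cone[OF bB] box_subset deg_nat by blast
    then show ?thesis using deg_sum_basis[OF bB] by (simp add: deg_diff)
  qed
  \<comment> \<open>\<open>n\<close> will be the degree of the numerator: coefficient
    \<open>k\<close> counts interior points of degree \<open>dim A - k\<close>, and none has degree
    below that of \<open>u\<close>.\<close>
  then obtain n where n: "real (dim A) - deg u = real n" by (auto elim: Nats_cases)
  have c0: "c k = 0" if "n < k" for k
  proof -
    have "{x \<in> box (- 1) B B. deg x = real (dim A) - real k} = {}" if B: "B \<in> triangulation" for B
    proof -
      have "deg u \<le> deg x" if "x \<in> box (- 1) B B" for x
        using box_interior[OF B that] u_minimal[of x] by (cases "x = u") auto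
      moreover have "real (dim A) - real k < deg u" using n \<open>n < k\<close> by linarith
      ultimately show ?thesis by fastforce
    qed
    then show ?thesis unfolding c_dual by (intro sum.neutral ballI) (simp only: card.empty of_nat_0)
  qed
  have "{x \<in> box (- 1) B B. deg x = real (dim A) - real n} = (if B = B0 then {u} else {})"
    if B: "B \<in> triangulation" for B
  proof -
    have deg_u: "real (dim A) - real n = deg u" using n by linarith
    have only_u: "x = u" if "x \<in> box (- 1) B B" "deg x = deg u" for x
      using box_interior[OF B that(1)] u_minimal[of x] that(2) by force
    show ?thesis
    proof (cases "B = B0")
      case True
      have "{x \<in> box (- 1) B B. deg x = deg u} = {u}"
        using only_u uB unfolding True by blast
      then show ?thesis unfolding deg_u using True by simp
    next
      case False
      then have "u \<notin> box (- 1) B B"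
        using half_open_disjoint[OF B B0(1), of "- 1" u] B0(2) by (auto simp: box_def)
      then have "{x \<in> box (- 1) B B. deg x = deg u} = {}" using only_u by blast
      then show ?thesis unfolding deg_u using False by simp
    qed
  qed
  then have "c n = (\<Sum>B\<in>triangulation. if B = B0 then 1 else 0)"
    unfolding c_dual by (intro sum.cong refl) simp
  then have cn: "c n = 1" using B0 finite_triangulation by simp
  define h where "h = (\<Sum>k\<le>n. monom (c k) k)"
  have coeff: "coeff h k = c k" for k
    using c0[of k] by (auto simp: h_def coeff_sum not_le)
  have "degree h = n"
    using cn c0 by (intro antisym degree_le le_degree) (auto simp: coeff)
  then have "lead_coeff h = 1" by (simp add: coeff cn)
  moreover have "count (L \<inter> cone) * (1 - fps_X) ^ dim A = fps_of_poly h"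
    by (rule fps_ext) (simp add: nth coeff)
  ultimately show ?thesis by blast
qed

end

theorem (in lattice_cone) hilbert_numerator:
  "\<exists>h. count (L \<inter> cone) * (1 - fps_X) ^ dim A = fps_of_poly h \<and> lead_coeff h = 1"
proof -
  obtain w where "generic_cone scale A deg w" using ex_generic by blast
  then interpret generic_cone scale A deg w .
  interpret generic_lattice_cone scale A deg w L u ..
  show ?thesis by (rule numerator)
qed

section \<open>Normality of the edge monoid\<close>

definition pointwise_scale :: "real \<Rightarrow> (nat \<Rightarrow> real) \<Rightarrow> nat \<Rightarrow> real" where
  "pointwise_scale c f = (\<lambda>i. c * f i)"

lemma pointwise_scale_apply [simp]: "pointwise_scale c f i = c * f i"
  by (simp add: pointwise_scale_def)

interpretation pointwise: vector_space pointwise_scale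
  by unfold_locales (simp_all add: pointwise_scale_def fun_eq_iff algebra_simps)

lemma sum_fun_apply: "(\<Sum>i\<in>I. f i) x = (\<Sum>i\<in>I. f i x)"
  by (induction I rule: infinite_finite_induct) simp_all

lemma indicat_real_inj: "inj (\<lambda>A. indicat_real A)"
proof (rule injI)
  fix A B :: "'a set" assume "indicat_real A = indicat_real B"
  then have "indicat_real A x = indicat_real B x" for x by simp
  then have "x \<in> A \<longleftrightarrow> x \<in> B" for x
    by (metis indicator_eq_0_iff)
  then show "A = B" by blast
qed

text \<open>The monoid generated by the edge vectors; lists serve as multisets of edges, so that
  length is degree.\<close>

definition edge_sums :: "nat set set \<Rightarrow> (nat \<Rightarrow> real) set" where
  "edge_sums E = {(\<Sum>e\<leftarrow>es. indicat_real e) |es. set es \<subseteq> E}"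

lemma zero_in_edge_sums [simp]: "0 \<in> edge_sums E"
  unfolding edge_sums_def by (intro CollectI exI[of _ "[]"]) simp

lemma edge_sums_edge: "e \<in> E \<Longrightarrow> indicat_real e \<in> edge_sums E"
  unfolding edge_sums_def by (intro CollectI exI[of _ "[e]"]) simp

lemma edge_sums_add: "x \<in> edge_sums E \<Longrightarrow> y \<in> edge_sums E \<Longrightarrow> x + y \<in> edge_sums E"
  unfolding edge_sums_def
proof (elim CollectE exE conjE)
  fix es es' assume "x = (\<Sum>e\<leftarrow>es. indicat_real e)" "set es \<subseteq> E" "y = (\<Sum>e\<leftarrow>es'. indicat_real e)" "set es' \<subseteq> E"
  then show "x + y \<in> {(\<Sum>e\<leftarrow>es. indicat_real e) |es. set es \<subseteq> E}"
    by (intro CollectI exI[of _ "es @ es'"]) simp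
qed

lemma edge_sums_sum:
  "(\<And>i. i \<in> I \<Longrightarrow> f i \<in> edge_sums E) \<Longrightarrow> sum f I \<in> edge_sums E"
  by (induction I rule: infinite_finite_induct) (auto intro: edge_sums_add)

lemma edge_sums_of_nat: "x \<in> edge_sums E \<Longrightarrow> pointwise_scale (real n) x \<in> edge_sums E"
proof (induction n)
  case 0
  have "pointwise_scale (real 0) x = 0" by (simp add: fun_eq_iff)
  then show ?case by (simp only: zero_in_edge_sums)
next
  case (Suc n)
  have "pointwise_scale (real (Suc n)) x = x + pointwise_scale (real n) x"
    by (simp add: fun_eq_iff algebra_simps)
  then show ?case using edge_sums_add[OF Suc.prems Suc.IH[OF Suc.prems]] by (simp only:)
qed

section \<open>Paths and odd cycles as sums of edges\<close>

lemma indicator_insert_disjoint: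
  "x \<notin> A \<Longrightarrow> indicat_real (insert x A) = indicat_real {x} + indicat_real A"
  by (auto simp: fun_eq_iff indicator_def)

lemma indicator_pair: "x \<noteq> y \<Longrightarrow> indicat_real {x, y} = indicat_real {x} + indicat_real {y}"
  using indicator_insert_disjoint[of x "{y}"] by simp

text \<open>Every second edge of the path gives a perfect matching of its vertices.\<close>

lemma even_path_in_edge_sums:
  assumes "even (length xs)" "distinct xs" "successively (\<lambda>a b. {a, b} \<in> E) xs"
  shows "indicat_real (set xs) \<in> edge_sums E"
  using assms
proof (induction xs rule: induct_list012)
  case 1
  have "indicat_real (set ([] :: nat list)) = 0" by (simp add: fun_eq_iff)
  then show ?case by (simp only: zero_in_edge_sums)
next
  case (3 a b xs)
  then have "indicat_real (set xs) \<in> edge_sums E"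
    by (intro "3.IH"(1)) (auto simp: successively_Cons)
  moreover have "indicat_real (set (a # b # xs)) = indicat_real {a, b} + indicat_real (set xs)"
    using 3 by (auto simp: fun_eq_iff indicator_def)
  moreover have "indicat_real {a, b} \<in> edge_sums E" using 3 by (intro edge_sums_edge) simp
  ultimately show ?case by (simp only: edge_sums_add)
qed simp

lemma graph_cycle_rotate:
  assumes "graph_cycle E c"
  shows "graph_cycle E (rotate k c)"
proof -
  have len: "3 \<le> length c" and dist: "distinct c"
    and edge: "\<And>i. i < length c \<Longrightarrow> {c ! i, c ! (Suc i mod length c)} \<in> E"
    using assms by (auto simp: graph_cycle_def)
  have "{rotate k c ! i, rotate k c ! (Suc i mod length c)} \<in> E" if "i < length c" for i
  proof -
    have "Suc i mod length c < length c" using len by (intro mod_less_divisor) linarith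
    then have "rotate k c ! (Suc i mod length c) = c ! ((k + Suc i mod length c) mod length c)"
      by (simp add: nth_rotate)
    also have "(k + Suc i mod length c) mod length c = Suc ((k + i) mod length c) mod length c"
      by (simp add: mod_simps)
    finally have "{rotate k c ! i, rotate k c ! (Suc i mod length c)} =
        {c ! ((k + i) mod length c), c ! (Suc ((k + i) mod length c) mod length c)}"
      using that by (simp add: nth_rotate)
    moreover have "(k + i) mod length c < length c" using len by (intro mod_less_divisor) linarith
    ultimately show ?thesis using edge by simp
  qed
  then show ?thesis using len dist by (simp add: graph_cycle_def)
qed

text \<open>Without \<open>v\<close>, an odd cycle is a path with an even number of vertices. The
  cycle is rotated to start at \<open>v\<close>.\<close>

lemma odd_cycle_minus_vertex:
  assumes c: "graph_cycle E c" "odd (length c)" and v: "v \<in> set c"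
  shows "\<exists>y\<in>edge_sums E. indicat_real (set c) = indicat_real {v} + y"
proof -
  obtain k where k: "k < length c" "c ! k = v" using v by (auto simp: in_set_conv_nth)
  have cyc: "graph_cycle E (rotate k c)" using graph_cycle_rotate c by simp
  have "rotate k c \<noteq> []" using k by auto
  then obtain a xs where r: "rotate k c = a # xs" by (cases "rotate k c") auto
  have "a = rotate k c ! 0" using r by simp
  also have "\<dots> = v" using k by (subst nth_rotate) auto
  finally have a: "a = v" .
  have len: "length c = Suc (length xs)"
    using arg_cong[OF r, of length] by simp
  have dist: "distinct (v # xs)" using cyc r a by (simp add: graph_cycle_def)
  have "successively (\<lambda>a b. {a, b} \<in> E) xs"
    unfolding successively_conv_nth
  proof (intro allI impI)
    fix i assume "Suc i < length xs"
    then show "{xs ! i, xs ! Suc i} \<in> E"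
      using cyc r by (auto simp: graph_cycle_def dest: spec[of _ "Suc i"])
  qed
  then have "indicat_real (set xs) \<in> edge_sums E"
    using len c(2) dist by (intro even_path_in_edge_sums) auto
  moreover have "set c = insert v (set xs)"
    using set_rotate[of k c] r a by simp
  ultimately show ?thesis using dist indicator_insert_disjoint[of v "set xs"] by auto
qed

text \<open>The connecting edge covers one vertex of each cycle, and the two remaining paths are
  matched within themselves. This is where the odd cycle condition does its work.\<close>

lemma odd_cycle_pair_in_edge_sums:
  assumes "odd_cycle_condition E"
    and c: "graph_cycle E c" "odd (length c)" and c': "graph_cycle E c'" "odd (length c')"
    and disj: "set c \<inter> set c' = {}"
  shows "indicat_real (set c) + indicat_real (set c') \<in> edge_sums E"
proof -
  obtain v v' where v: "v \<in> set c" "v' \<in> set c'" and e: "{v, v'} \<in> E"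
    using assms unfolding odd_cycle_condition_def by blast
  obtain y where y: "y \<in> edge_sums E" "indicat_real (set c) = indicat_real {v} + y"
    using odd_cycle_minus_vertex[OF c v(1)] by blast
  obtain y' where y': "y' \<in> edge_sums E" "indicat_real (set c') = indicat_real {v'} + y'"
    using odd_cycle_minus_vertex[OF c' v(2)] by blast
  have "v \<noteq> v'" using v disj by auto
  then have "indicat_real (set c) + indicat_real (set c') = indicat_real {v, v'} + (y + y')"
    using y(2) y'(2) by (simp add: indicator_pair algebra_simps)
  then show ?thesis using y(1) y'(1) e by (simp add: edge_sums_add edge_sums_edge)
qed

lemma odd_cycles_in_edge_sums:
  assumes "odd_cycle_condition E" "even (length cs)"
    and "\<forall>c\<in>set cs. graph_cycle E c \<and> odd (length c)"
    and "sorted_wrt (\<lambda>c c'. set c \<inter> set c' = {}) cs"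
  shows "(\<Sum>c\<leftarrow>cs. indicat_real (set c)) \<in> edge_sums E"
  using assms(2-)
proof (induction cs rule: induct_list012)
  case (3 c c' cs)
  then have "(\<Sum>c\<leftarrow>cs. indicat_real (set c)) \<in> edge_sums E" by simp
  moreover have "indicat_real (set c) + indicat_real (set c') \<in> edge_sums E"
    using 3 by (intro odd_cycle_pair_in_edge_sums[OF assms(1)]) auto
  ultimately have "indicat_real (set c) + indicat_real (set c') + (\<Sum>c\<leftarrow>cs. indicat_real (set c)) \<in> edge_sums E"
    by (rule edge_sums_add[rotated])
  then show ?case by (simp only: list.map sum_list.Cons add.assoc)
qed auto

text \<open>The first vertex of a longest path lies on a second edge, whose other end must already
  be on the path and so closes a cycle.\<close>

lemma min_degree_two_has_cycle:
  assumes "finite F" "F \<noteq> {}" and card2: "\<And>e. e \<in> F \<Longrightarrow> card e = 2"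
    and deg2: "\<And>e v. \<lbrakk>e \<in> F; v \<in> e\<rbrakk> \<Longrightarrow> \<exists>e'\<in>F. e' \<noteq> e \<and> v \<in> e'"
  shows "\<exists>c. graph_cycle F c"
proof -
  define P where "P xs \<longleftrightarrow> distinct xs \<and> successively (\<lambda>a b. {a, b} \<in> F) xs \<and> set xs \<subseteq> \<Union>F" for xs
  have fin: "finite (\<Union>F)"
    using assms(1) card2 by (intro finite_Union) (auto intro: card_ge_0_finite)
  have bound: "length xs \<le> card (\<Union>F)" if "P xs" for xs
    using that fin by (metis P_def card_mono distinct_card)
  obtain e where e: "e \<in> F" using assms(2) by blast
  then obtain a b where ab: "e = {a, b}" "a \<noteq> b" using card2 by (meson card_2_iff)
  have "P [a, b]" using e ab by (auto simp: P_def)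
  then obtain xs where xs: "P xs" and max: "\<And>ys. P ys \<Longrightarrow> length ys \<le> length xs"
    using ex_has_greatest_nat[of P "[a, b]" length "Suc (card (\<Union>F))"] bound by (auto simp: less_Suc_eq_le)
  have "2 \<le> length xs" using max[OF \<open>P [a, b]\<close>] by simp
  then obtain v v' zs where vs: "xs = v # v' # zs"
    by (metis One_nat_def Suc_1 Suc_le_length_iff)
  have vv: "{v, v'} \<in> F" using xs vs by (simp add: P_def)
  then obtain e' where e': "e' \<in> F" "e' \<noteq> {v, v'}" "v \<in> e'" using deg2 by blast
  then obtain y where y: "e' = {v, y}" "y \<noteq> v"
    using card2 by (metis card_2_iff insert_absorb insert_commute insert_iff singleton_iff)
  have "y \<in> set xs"
  proof (rule ccontr)
    assume "y \<notin> set xs"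
    then have "P (y # xs)"
      using xs e' y vs by (auto simp: P_def insert_commute)
    then show False using max by fastforce
  qed
  then obtain j where j: "j < length xs" "xs ! j = y" by (auto simp: in_set_conv_nth)
  \<comment> \<open>Position 0 is \<open>v\<close> itself, and position 1 would give back the first
    edge of the path; hence the cycle has at least three vertices.\<close>
  have "j \<noteq> 0" "j \<noteq> 1" using j y e' vs by auto
  then have j2: "2 \<le> j" by simp
  have "graph_cycle F (take (Suc j) xs)"
    unfolding graph_cycle_def
  proof (intro conjI allI impI)
    have len: "length (take (Suc j) xs) = Suc j" using j by simp
    show "3 \<le> length (take (Suc j) xs)" using len j2 by simp
    show "distinct (take (Suc j) xs)" using xs by (simp add: P_def)
    fix i assume "i < length (take (Suc j) xs)"
    then have i: "i \<le> j" using len by simp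
    show "{take (Suc j) xs ! i, take (Suc j) xs ! (Suc i mod length (take (Suc j) xs))} \<in> F"
    proof (cases "i = j")
      case True
      have "take (Suc j) xs ! i = y" using True j by simp
      moreover have "take (Suc j) xs ! (Suc i mod length (take (Suc j) xs)) = v"
        unfolding len True using vs by simp
      ultimately show ?thesis using e' y by (simp only: insert_commute)
    next
      case False
      then have "{xs ! i, xs ! Suc i} \<in> F"
        using xs i j by (auto simp: P_def successively_conv_nth)
      then show ?thesis using len False i by simp
    qed
  qed
  then show ?thesis by blast
qed

section \<open>Edge coefficients along a cycle\<close>

lemma sum_Suc_mod:
  fixes f :: "nat \<Rightarrow> 'a::comm_monoid_add"
  assumes "0 < n"
  shows "(\<Sum>i<n. f (Suc i mod n)) = (\<Sum>i<n. f i)"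
proof -
  obtain m where n: "n = Suc m" using assms by (cases n) auto
  have "(\<Sum>i<Suc m. f (Suc i mod Suc m)) = (\<Sum>i<m. f (Suc i)) + f 0" by simp
  also have "\<dots> = (\<Sum>i<Suc m. f i)" by (subst sum.lessThan_Suc_shift) (simp add: add.commute)
  finally show ?thesis using n by simp
qed

context
  fixes F :: "nat set set" and c :: "nat list"
  assumes cycle: "graph_cycle F c"
begin

definition cycle_edge :: "nat \<Rightarrow> nat set" where
  "cycle_edge i = {c ! i, c ! (Suc i mod length c)}"

lemma cycle_length: "3 \<le> length c"
  using cycle by (simp add: graph_cycle_def)

lemma cycle_succ_less: "Suc i mod length c < length c"
  using cycle_length by (intro mod_less_divisor) linarith

lemma cycle_nth_eq_iff: "\<lbrakk>i < length c; j < length c\<rbrakk> \<Longrightarrow> c ! i = c ! j \<longleftrightarrow> i = j"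
  using cycle by (auto simp: graph_cycle_def nth_eq_iff_index_eq)

lemma cycle_edge_in: "i < length c \<Longrightarrow> cycle_edge i \<in> F"
  using cycle by (simp add: graph_cycle_def cycle_edge_def)

lemma succ_mod_neq: "i < length c \<Longrightarrow> Suc i mod length c \<noteq> i"
  using cycle_length by (auto simp: mod_Suc)

lemma indicator_cycle_edge:
  assumes "i < length c"
  shows "indicat_real (cycle_edge i) v = of_bool (c ! i = v) + of_bool (c ! (Suc i mod length c) = v)"
  using cycle_nth_eq_iff[OF assms cycle_succ_less, of i] succ_mod_neq[OF assms]
  by (auto simp: cycle_edge_def indicator_def)

lemma cycle_edge_inj: "inj_on cycle_edge {..<length c}"
proof (rule inj_onI)
  fix i j assume i: "i \<in> {..<length c}" and j: "j \<in> {..<length c}" and eq: "cycle_edge i = cycle_edge j"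
  show "i = j"
  proof (rule ccontr)
    assume "i \<noteq> j"
    \<comment> \<open>Two positions with the same edge would be successors of each other, which is
      impossible in a cycle of length at least three.\<close>
    then have "c ! i = c ! (Suc j mod length c)" "c ! j = c ! (Suc i mod length c)"
      using eq i j cycle_nth_eq_iff by (auto simp: cycle_edge_def doubleton_eq_iff)
    then have "i = Suc j mod length c" "j = Suc i mod length c"
      using i j cycle_nth_eq_iff cycle_succ_less by auto
    moreover have "Suc k mod length c = (if Suc k = length c then 0 else Suc k)" if "k < length c" for k
      using that by auto
    ultimately show False using i j cycle_length by (auto split: if_splits)
  qed
qed

lemma sum_cycle_indicators: "(\<Sum>i<length c. indicat_real (cycle_edge i) v) = 2 * indicat_real (set c) v"
proof -
  have one: "(\<Sum>i<length c. of_bool (c ! i = v)) = indicat_real (set c) v"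
  proof (cases "v \<in> set c")
    case True
    then obtain k where k: "k < length c" "c ! k = v" by (auto simp: in_set_conv_nth)
    then have "(\<Sum>i<length c. of_bool (c ! i = v)) = (\<Sum>i<length c. if i = k then 1 else (0::real))"
      using cycle_nth_eq_iff by (intro sum.cong) auto
    then show ?thesis using k True by simp
  qed (auto simp: in_set_conv_nth intro!: sum.neutral)
  have "(\<Sum>i<length c. indicat_real (cycle_edge i) v) =
      (\<Sum>i<length c. of_bool (c ! i = v)) + (\<Sum>i<length c. of_bool (c ! (Suc i mod length c) = v))"
    by (simp add: indicator_cycle_edge sum.distrib)
  also have "(\<Sum>i<length c. of_bool (c ! (Suc i mod length c) = v)) = (\<Sum>i<length c. of_bool (c ! i = v) :: real)"
    using cycle_length by (intro sum_Suc_mod) linarith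
  finally show ?thesis using one by simp
qed

text \<open>Consecutive edges carry opposite signs, also where a cycle of even length closes up, so
  the two contributions at each vertex cancel.\<close>

lemma even_cycle_alternating_sum:
  assumes "even (length c)"
  shows "(\<Sum>i<length c. (- 1) ^ i * indicat_real (cycle_edge i) v) = 0"
proof -
  have parity: "(- 1) ^ (Suc i mod length c) = - ((- 1) ^ i :: real)" for i
  proof -
    have "even (Suc i mod length c) \<longleftrightarrow> even (Suc i)" using assms by (rule dvd_mod_iff)
    then show ?thesis by (simp add: minus_one_power_iff)
  qed
  define f :: "nat \<Rightarrow> real" where "f i = (- 1) ^ i * of_bool (c ! i = v)" for i
  have "(\<Sum>i<length c. (- 1) ^ i * indicat_real (cycle_edge i) v) = (\<Sum>i<length c. f i - f (Suc i mod length c))"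
    by (intro sum.cong) (simp_all add: f_def parity indicator_cycle_edge distrib_left)
  also have "\<dots> = (\<Sum>i<length c. f i) - (\<Sum>i<length c. f (Suc i mod length c))"
    by (rule sum_subtractf)
  also have "(\<Sum>i<length c. f (Suc i mod length c)) = (\<Sum>i<length c. f i)"
    using cycle_length by (intro sum_Suc_mod) linarith
  also have "(\<Sum>i<length c. f i) - (\<Sum>i<length c. f i) = 0" by simp
  finally show ?thesis .
qed

text \<open>Modulo integers, \<open>a k\<close> equals \<open>(- 1) ^ k * a 0\<close>. The last
  index of an odd cycle is even, so closing up shows that \<open>a 0 + a 0\<close> is an
  integer.\<close>

lemma odd_cycle_half_integers:
  assumes odd: "odd (length c)" and int: "\<And>i. i < length c \<Longrightarrow> a i + a (Suc i mod length c) \<in> (\<int> :: real set)"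
    and i: "i < length c"
  shows "2 * a i \<in> \<int>"
proof -
  have alt: "a k - (- 1) ^ k * a 0 \<in> \<int>" if "k < length c" for k
    using that
  proof (induction k)
    case (Suc k)
    then have "a k - (- 1) ^ k * a 0 \<in> \<int>" "a k + a (Suc k) \<in> \<int>" using int[of k] by auto
    then have "(a k + a (Suc k)) - (a k - (- 1) ^ k * a 0) \<in> \<int>" by (rule Ints_diff[rotated])
    then show ?case by simp
  qed simp
  define m where "m = length c - 1"
  have m: "m < length c" "even m" "Suc m mod length c = 0" using odd cycle_length by (auto simp: m_def)
  have "(a m + a 0) - (a m - (- 1) ^ m * a 0) \<in> \<int>"
    using int[OF m(1)] alt[OF m(1)] unfolding m(3) by (rule Ints_diff)
  moreover have "(a m + a 0) - (a m - (- 1) ^ m * a 0) = 2 * a 0" using m(2) by simp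
  ultimately have a0: "2 * a 0 \<in> \<int>" by (simp only:)
  have "2 * (a i - (- 1) ^ i * a 0) \<in> \<int>" using alt[OF i] by (intro Ints_mult) auto
  moreover have "(- 1) ^ i * (2 * a 0) \<in> \<int>" by (rule Ints_mult[OF _ a0]) simp
  ultimately have "2 * (a i - (- 1) ^ i * a 0) + (- 1) ^ i * (2 * a 0) \<in> \<int>" by (rule Ints_add)
  then show ?thesis by (simp add: algebra_simps)
qed

end

text \<open>Moving along a linear relation between the edges with nonintegral coefficients until the first
  of these coefficients becomes integral.\<close>

lemma shift_to_integer:
  fixes l r :: "'a \<Rightarrow> real"
  assumes "finite F" and F: "\<And>e. e \<in> F \<Longrightarrow> l e \<notin> \<int>" and nonneg: "\<And>e. e \<in> F \<Longrightarrow> 0 \<le> l e"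
    and r: "e0 \<in> F" "r e0 \<noteq> 0"
  shows "\<exists>t. (\<forall>e\<in>F. 0 \<le> l e + t * r e) \<and> (\<exists>e\<in>F. l e + t * r e \<in> \<int>)"
proof -
  \<comment> \<open>The time at which \<open>l e + t * r e\<close> reaches the next integer in the
    direction of its motion. Floors of nonnegative numbers are nonnegative, so until the first such
    time no coefficient becomes negative.\<close>
  define T where "T e = (if 0 < r e then (\<lceil>l e\<rceil> - l e) / r e else (\<lfloor>l e\<rfloor> - l e) / r e)" for e
  define G where "G = {e\<in>F. r e \<noteq> 0}"
  have G: "finite G" "G \<noteq> {}" using assms by (auto simp: G_def)
  define e1 where "e1 = arg_min_on T G"
  have e1: "e1 \<in> G" unfolding e1_def by (rule arg_min_if_finite(1)[OF G])
  have le: "T e1 \<le> T e" if "e \<in> G" for e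
    unfolding e1_def using arg_min_least[OF G that, of T] .
  have Tnn: "0 \<le> T e" for e
  proof -
    have "0 \<le> \<lceil>l e\<rceil> - l e" "\<lfloor>l e\<rfloor> - l e \<le> 0" by (simp_all add: le_of_int_ceiling)
    then show ?thesis by (auto simp: T_def not_less intro: divide_nonneg_nonneg divide_nonpos_nonpos)
  qed
  have "0 \<le> l e + T e1 * r e" if e: "e \<in> F" for e
  proof -
    consider "0 \<le> r e" | "r e < 0" by linarith
    then show ?thesis
    proof cases
      case 1
      then have "0 \<le> T e1 * r e" using Tnn by simp
      then show ?thesis using nonneg[OF e] by simp
    next
      case 2
      then have "T e1 \<le> (\<lfloor>l e\<rfloor> - l e) / r e" using le[of e] e by (simp add: T_def G_def)
      then have "\<lfloor>l e\<rfloor> - l e \<le> T e1 * r e" using 2 by (simp add: field_simps)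
      moreover have "0 \<le> real_of_int \<lfloor>l e\<rfloor>" using nonneg[OF e] by simp
      ultimately show ?thesis by linarith
    qed
  qed
  moreover have "l e1 + T e1 * r e1 \<in> \<int>"
    using e1 by (simp add: T_def G_def)
  ultimately show ?thesis using e1 by (intro exI[of _ "T e1"]) (auto simp: G_def)
qed

text \<open>If the edges with nonintegral coefficient are linearly dependent, one of them can be made
  integral. Otherwise there are at most as many of them as vertices they meet; as none of these
  vertices lies on only one of them, they form disjoint cycles, which are odd by independence and
  have coefficients in \<open>1/2 + \<int>\<close>.\<close>

lemma edge_coefficient_rounding:
  fixes l :: "nat set \<Rightarrow> real"
  assumes "finite E" and card2: "\<And>e. e \<in> E \<Longrightarrow> card e = 2"
    and "\<And>e. e \<in> E \<Longrightarrow> 0 \<le> l e" and "\<And>v. (\<Sum>e\<in>E. l e * indicat_real e v) \<in> \<int>"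
  shows "\<exists>\<nu> cs. (\<forall>c\<in>set cs. graph_cycle E c \<and> odd (length c) \<and> set c \<subseteq> \<Union>{e\<in>E. l e \<notin> \<int>}) \<and>
           sorted_wrt (\<lambda>c c'. set c \<inter> set c' = {}) cs \<and>
           (\<forall>v. (\<Sum>e\<in>E. l e * indicat_real e v) =
              (\<Sum>e\<in>E. real (\<nu> e) * indicat_real e v) + (\<Sum>c\<leftarrow>cs. indicat_real (set c) v))"
  using assms(3,4)
proof (induction "card {e\<in>E. l e \<notin> \<int>}" arbitrary: l rule: less_induct)
  case (less l)
  note nonneg = less.prems(1) and int = less.prems(2)
  define F where "F = {e\<in>E. l e \<notin> \<int>}"
  have FE: "F \<subseteq> E" and finF: "finite F" using assms(1) by (auto simp: F_def)
  have finite_edge: "finite e" if "e \<in> E" for e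
    using card2[OF that] card_ge_0_finite[of e] by simp
  define N where "N v = {e\<in>F. v \<in> e}" for v
  consider (integral) "F = {}"
    | (dependent) r e0 where "e0 \<in> F" "r e0 \<noteq> 0" "\<And>v. (\<Sum>e\<in>F. r e * indicat_real e v) = 0"
    | (independent) "F \<noteq> {}" "\<And>r e0. \<lbrakk>\<And>v. (\<Sum>e\<in>F. r e * indicat_real e v) = 0; e0 \<in> F\<rbrakk> \<Longrightarrow> r e0 = 0"
    by blast
  then show ?case
  proof cases
    case integral
    then have "real (nat \<lfloor>l e\<rfloor>) = l e" if "e \<in> E" for e
      using that nonneg[OF that] by (auto simp: F_def elim!: Ints_cases)
    then show ?thesis by (intro exI[of _ "\<lambda>e. nat \<lfloor>l e\<rfloor>"] exI[of _ "[]"]) simp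
  next
    case (dependent r e0)
    have "l e \<notin> \<int>" "0 \<le> l e" if "e \<in> F" for e using that nonneg by (auto simp: F_def)
    then obtain t where t: "\<forall>e\<in>F. 0 \<le> l e + t * r e" "\<exists>e\<in>F. l e + t * r e \<in> \<int>"
      using shift_to_integer[of F l e0 r, OF finF _ _ dependent(1,2)] by blast
    define l' where "l' e = (if e \<in> F then l e + t * r e else l e)" for e
    define F' where "F' = {e\<in>E. l' e \<notin> \<int>}"
    have F': "F' \<subset> F" using t(2) by (auto simp: F'_def F_def l'_def)
    have sum_eq: "(\<Sum>e\<in>E. l' e * indicat_real e v) = (\<Sum>e\<in>E. l e * indicat_real e v)" for v
    proof -
      have "(\<Sum>e\<in>E. l' e * indicat_real e v) =
          (\<Sum>e\<in>E. l e * indicat_real e v + (if e \<in> F then t * (r e * indicat_real e v) else 0))"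
        by (intro sum.cong) (auto simp: l'_def algebra_simps)
      also have "\<dots> = (\<Sum>e\<in>E. l e * indicat_real e v) + t * (\<Sum>e\<in>F. r e * indicat_real e v)"
        using assms(1) FE by (simp add: sum.distrib sum_distrib_left Int_absorb1 flip: sum.inter_restrict)
      finally show ?thesis using dependent(3) by simp
    qed
    have "0 \<le> l' e" if "e \<in> E" for e using t(1) nonneg that by (simp add: l'_def)
    moreover have "card F' < card F" using F' finF by (rule psubset_card_mono[rotated])
    ultimately obtain \<nu> cs where "\<forall>c\<in>set cs. graph_cycle E c \<and> odd (length c) \<and> set c \<subseteq> \<Union>F'"
        "sorted_wrt (\<lambda>c c'. set c \<inter> set c' = {}) cs"
        "\<forall>v. (\<Sum>e\<in>E. l' e * indicat_real e v) =
           (\<Sum>e\<in>E. real (\<nu> e) * indicat_real e v) + (\<Sum>c\<leftarrow>cs. indicat_real (set c) v)"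
      using less.hyps[of l'] int unfolding sum_eq F'_def F_def by blast
    then show ?thesis
      using F' unfolding sum_eq F_def[symmetric] by (intro exI[of _ \<nu>] exI[of _ cs]) blast
  next
    case independent
    have intN: "(\<Sum>e\<in>N v. l e) \<in> \<int>" for v
    proof -
      have "(\<Sum>e\<in>E. l e * indicat_real e v) = (\<Sum>e\<in>F. l e * indicat_real e v) + (\<Sum>e\<in>E-F. l e * indicat_real e v)"
        using assms(1) FE by (simp add: sum.subset_diff add.commute)
      moreover have "(\<Sum>e\<in>E-F. l e * indicat_real e v) \<in> \<int>"
        by (intro Ints_sum) (auto simp: F_def indicator_def)
      moreover have "(\<Sum>e\<in>F. l e * indicat_real e v) = (\<Sum>e\<in>N v. l e)"
        using finF unfolding N_def by (intro sum.mono_neutral_cong_right) (auto simp: indicator_def)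
      ultimately have "(\<Sum>e\<in>N v. l e) = (\<Sum>e\<in>E. l e * indicat_real e v) - (\<Sum>e\<in>E-F. l e * indicat_real e v)"
        by simp
      then show ?thesis using int[of v] \<open>(\<Sum>e\<in>E-F. l e * indicat_real e v) \<in> \<int>\<close> by simp
    qed
    \<comment> \<open>A nonintegral coefficient alone at a vertex would make the sum there
      nonintegral.\<close>
    have other_edge: "\<exists>e'\<in>F. e' \<noteq> e \<and> v \<in> e'" if "e \<in> F" "v \<in> e" for e v
    proof (rule ccontr)
      assume "\<not> ?thesis"
      then have "N v = {e}" using that by (auto simp: N_def)
      then show False using intN[of v] that(1) by (simp add: F_def)
    qed
    have finV: "finite (\<Union>F)"
      using finF FE finite_edge by (intro finite_Union) auto
    have finN: "finite (N v)" for v using finF by (simp add: N_def)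
    have N_ge: "2 \<le> card (N v)" if "v \<in> \<Union>F" for v
    proof -
      obtain e where e: "e \<in> F" "v \<in> e" using \<open>v \<in> \<Union>F\<close> by blast
      then obtain e' where "e' \<in> F" "e' \<noteq> e" "v \<in> e'" using other_edge by blast
      with e have "e \<in> N v" "e' \<in> N v" "e \<noteq> e'" by (auto simp: N_def)
      then have "card {e, e'} \<le> card (N v)" using finN by (intro card_mono) auto
      then show ?thesis using \<open>e \<noteq> e'\<close> by simp
    qed
    \<comment> \<open>The edge vectors are independent and lie in the span of the unit vectors at
      the vertices they meet.\<close>
    have card_F: "card F \<le> card (\<Union>F)"
    proof -
      have indep: "pointwise.independent (indicat_real ` F)"
      proof (rule pointwise.independent_if_scalars_zero)
        fix f x assume f: "(\<Sum>x\<in>indicat_real ` F. pointwise_scale (f x) x) = 0" and x: "x \<in> indicat_real ` F"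
        then obtain e where e: "e \<in> F" "x = indicat_real e" by blast
        have "(\<Sum>e\<in>F. f (indicat_real e) * indicat_real e v) = 0" for v
        proof -
          have "(\<Sum>e\<in>F. f (indicat_real e) * indicat_real e v) =
              (\<Sum>e\<in>F. pointwise_scale (f (indicat_real e)) (indicat_real e)) v"
            unfolding sum_fun_apply by simp
          also have "(\<Sum>e\<in>F. pointwise_scale (f (indicat_real e)) (indicat_real e)) = 0"
            using f inj_on_subset[OF indicat_real_inj subset_UNIV] by (subst (asm) sum.reindex) auto
          finally show ?thesis by simp
        qed
        then show "f x = 0" using independent(2)[of "\<lambda>e. f (indicat_real e)"] e by blast
      qed (use finF in simp)
      have "indicat_real ` F \<subseteq> pointwise.span ((\<lambda>v. indicat_real {v}) ` \<Union>F)"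
      proof
        fix x assume "x \<in> indicat_real ` F"
        then obtain e where e: "e \<in> F" "x = indicat_real e" by blast
        have "finite e" using e FE finite_edge by blast
        then have "indicat_real e = (\<Sum>v\<in>e. indicat_real {v})"
          by (auto simp: fun_eq_iff sum_fun_apply indicator_def)
        moreover have "(\<Sum>v\<in>e. indicat_real {v}) \<in> pointwise.span ((\<lambda>v. indicat_real {v}) ` \<Union>F)"
          using e by (intro pointwise.span_sum pointwise.span_base) auto
        ultimately show "x \<in> pointwise.span ((\<lambda>v. indicat_real {v}) ` \<Union>F)" using e by simp
      qed
      then have "card (indicat_real ` F) \<le> card ((\<lambda>v. indicat_real {v}) ` \<Union>F)"
        using pointwise.independent_span_bound[OF _ indep] finV by blast
      also have "\<dots> \<le> card (\<Union>F)" using finV by (rule card_image_le)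
      finally show ?thesis
        using card_image[OF inj_on_subset[OF indicat_real_inj subset_UNIV], of F] by simp
    qed
    have "(\<Sum>v\<in>\<Union>F. card (N v)) = 2 * card F"
    proof -
      have "(\<Sum>v\<in>\<Union>F. card (N v)) = (\<Sum>v\<in>\<Union>F. \<Sum>e\<in>F. of_bool (v \<in> e))"
        using finF by (simp add: N_def sum.inter_filter[symmetric] of_bool_def)
      also have "\<dots> = (\<Sum>e\<in>F. \<Sum>v\<in>\<Union>F. of_bool (v \<in> e))" by (rule sum.swap)
      also have "\<dots> = (\<Sum>e\<in>F. card e)"
      proof (rule sum.cong[OF refl])
        fix e assume "e \<in> F"
        then have "{v \<in> \<Union>F. v \<in> e} = e" by blast
        then show "(\<Sum>v\<in>\<Union>F. of_bool (v \<in> e)) = card e"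
          using finV by (simp add: of_bool_def flip: sum.inter_filter)
      qed
      also have "\<dots> = 2 * card F" using FE card2 by (simp add: subset_iff)
      finally show ?thesis .
    qed
    \<comment> \<open>The degrees sum to twice the number of edges, hence to at most two per vertex
      on average, while each is at least two.\<close>
    then have "(\<Sum>v\<in>\<Union>F. 2) = (\<Sum>v\<in>\<Union>F. card (N v))"
      using card_F N_ge sum_mono[of "\<Union>F" "\<lambda>_. 2" "\<lambda>v. card (N v)"] by simp
    then have N2: "card (N v) = 2" if "v \<in> \<Union>F" for v
      using sum_mono_inv[of "\<lambda>_. 2" "\<Union>F" "\<lambda>v. card (N v)" v] N_ge that finV by simp
    obtain c where c: "graph_cycle F c"
      using min_degree_two_has_cycle[OF finF independent(1)] card2 FE other_edge by blast
    define n where "n = length c"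
    define C where "C = cycle_edge c ` {..<n}"
    have inj: "inj_on (cycle_edge c) {..<n}" unfolding n_def by (rule cycle_edge_inj[OF c])
    have CF: "C \<subseteq> F" using cycle_edge_in[OF c] by (auto simp: C_def n_def)
    have succ: "Suc i mod n < n" for i unfolding n_def by (rule cycle_succ_less[OF c])
    \<comment> \<open>As all degrees are two, a cycle contains every \<open>F\<close>-edge at its
      vertices: it is a whole component.\<close>
    have N_cycle: "N (c ! (Suc i mod n)) = {cycle_edge c i, cycle_edge c (Suc i mod n)}" if "i < n" for i
    proof -
      have in_edge: "c ! (Suc i mod n) \<in> cycle_edge c i" "c ! (Suc i mod n) \<in> cycle_edge c (Suc i mod n)"
        by (auto simp: cycle_edge_def[OF c] n_def)
      have "cycle_edge c i \<in> F" "cycle_edge c (Suc i mod n) \<in> F"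
        using that succ CF by (auto simp: C_def)
      then have sub: "{cycle_edge c i, cycle_edge c (Suc i mod n)} \<subseteq> N (c ! (Suc i mod n))"
        using in_edge by (simp add: N_def)
      have neq: "cycle_edge c i \<noteq> cycle_edge c (Suc i mod n)"
        using inj_onD[OF inj, of i "Suc i mod n"] that succ succ_mod_neq[OF c, of i] by (auto simp: n_def)
      have "c ! (Suc i mod n) \<in> \<Union>F" using in_edge(1) \<open>cycle_edge c i \<in> F\<close> by blast
      then show ?thesis using card_subset_eq[OF finN sub] N2 neq by simp
    qed
    have pair_int: "l (cycle_edge c i) + l (cycle_edge c (Suc i mod n)) \<in> \<int>" if "i < n" for i
    proof -
      have "cycle_edge c i \<noteq> cycle_edge c (Suc i mod n)"
        using inj_onD[OF inj, of i "Suc i mod n"] that succ succ_mod_neq[OF c, of i] by (auto simp: n_def)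
      then show ?thesis using intN[of "c ! (Suc i mod n)"] N_cycle[OF that] by simp
    qed
    have odd: "odd n"
    proof
      assume "even n"
      define r where "r e = (if e \<in> C then (- 1) ^ inv_into {..<n} (cycle_edge c) e else (0::real))" for e
      have r: "r (cycle_edge c i) = (- 1) ^ i" if "i < n" for i
        using that inj by (simp add: r_def C_def)
      have "(\<Sum>e\<in>F. r e * indicat_real e v) = 0" for v
      proof -
        have "(\<Sum>e\<in>F. r e * indicat_real e v) = (\<Sum>e\<in>C. r e * indicat_real e v)"
          using finF CF by (intro sum.mono_neutral_right) (auto simp: r_def)
        also have "\<dots> = (\<Sum>i<n. (- 1) ^ i * indicat_real (cycle_edge c i) v)"
          unfolding C_def using inj r by (simp add: sum.reindex)
        also have "\<dots> = 0" using even_cycle_alternating_sum[OF c] \<open>even n\<close> by (simp add: n_def)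
        finally show ?thesis .
      qed
      moreover have "0 < n" using cycle_length[OF c] unfolding n_def by linarith
      ultimately show False
        using independent(2)[of r "cycle_edge c 0"] CF r[of 0] by (auto simp: C_def)
    qed
    \<comment> \<open>Twice the coefficient is an integer and the coefficient is not, so it is a
      half-integer; being nonnegative, it is at least 1/2.\<close>
    have half: "l e - 1/2 \<in> \<int>" "0 \<le> l e - 1/2" if e: "e \<in> C" for e
    proof -
      obtain i where i: "i < n" "e = cycle_edge c i" using e by (auto simp: C_def)
      have "2 * l e \<in> \<int>"
        using odd_cycle_half_integers[OF c, of "\<lambda>i. l (cycle_edge c i)" i] odd pair_int i by (auto simp: n_def)
      then obtain k where k: "2 * l e = of_int k" by (auto elim: Ints_cases)
      have "odd k"
      proof
        assume "even k"
        then obtain m where "k = 2 * m" by blast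
        then have "l e = of_int m" using k by simp
        then show False using e CF by (auto simp: F_def)
      qed
      then obtain m where "k = 2 * m + 1" by (elim oddE)
      then have m: "l e - 1/2 = of_int m" using k by simp
      then show "l e - 1/2 \<in> \<int>" by simp
      have "0 \<le> l e" using e CF FE nonneg by blast
      then have "- 1 < real_of_int m" using m by linarith
      then have "0 \<le> m" by linarith
      then show "0 \<le> l e - 1/2" using m by simp
    qed
    \<comment> \<open>Each vertex of the cycle lies on two of its edges, so taking 1/2 off every
      edge removes exactly the indicator of the vertex set.\<close>
    define l' where "l' e = (if e \<in> C then l e - 1/2 else l e)" for e
    define F' where "F' = {e\<in>E. l' e \<notin> \<int>}"
    have F': "F' = F - C" using half(1) CF FE by (auto simp: F'_def F_def l'_def)
    have sum_eq: "(\<Sum>e\<in>E. l' e * indicat_real e v) = (\<Sum>e\<in>E. l e * indicat_real e v) - indicat_real (set c) v" for v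
    proof -
      have "(\<Sum>e\<in>E. l' e * indicat_real e v) =
          (\<Sum>e\<in>E. l e * indicat_real e v - (if e \<in> C then 1/2 * indicat_real e v else 0))"
        by (intro sum.cong) (auto simp: l'_def algebra_simps)
      also have "\<dots> = (\<Sum>e\<in>E. l e * indicat_real e v) - (\<Sum>e\<in>C. 1/2 * indicat_real e v)"
        using assms(1) FE CF by (simp add: sum_subtractf Int_absorb1 flip: sum.inter_restrict)
      also have "(\<Sum>e\<in>C. 1/2 * indicat_real e v) = 1/2 * (\<Sum>i<n. indicat_real (cycle_edge c i) v)"
        unfolding C_def using inj by (simp add: sum.reindex sum_distrib_left)
      also have "\<dots> = indicat_real (set c) v"
        using sum_cycle_indicators[OF c] by (simp add: n_def)
      finally show ?thesis .
    qed
    have "0 \<le> l' e" if "e \<in> E" for e using half(2) nonneg that by (simp add: l'_def)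
    moreover have "(\<Sum>e\<in>E. l' e * indicat_real e v) \<in> \<int>" for v
      unfolding sum_eq using int[of v] by (intro Ints_diff) (auto simp: indicator_def)
    moreover have "card F' < card F"
    proof (rule psubset_card_mono[OF finF])
      have "0 < n" using cycle_length[OF c] unfolding n_def by linarith
      then have "cycle_edge c 0 \<in> C" by (auto simp: C_def)
      then show "F' \<subset> F" using CF F' by blast
    qed
    ultimately obtain \<nu> cs where cs: "\<forall>c\<in>set cs. graph_cycle E c \<and> odd (length c) \<and> set c \<subseteq> \<Union>F'"
        "sorted_wrt (\<lambda>c c'. set c \<inter> set c' = {}) cs"
        "\<forall>v. (\<Sum>e\<in>E. l' e * indicat_real e v) =
           (\<Sum>e\<in>E. real (\<nu> e) * indicat_real e v) + (\<Sum>c\<leftarrow>cs. indicat_real (set c) v)"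
      using less.hyps[of l'] unfolding F'_def F_def by blast
    \<comment> \<open>The cycles found later lie on vertices of the remaining nonintegral edges; the
      induction statement records this location for the sake of disjointness.\<close>
    have disj: "set c \<inter> \<Union>F' = {}"
    proof -
      have False if v: "v \<in> set c" and e: "e \<in> F'" "v \<in> e" for v e
      proof -
        obtain j where j: "j < n" "c ! j = v" using v by (auto simp: in_set_conv_nth n_def)
        define i where "i = (if j = 0 then n - 1 else j - 1)"
        have i: "i < n" "Suc i mod n = j" using j by (auto simp: i_def)
        have "e \<in> N v" using e F' by (simp add: N_def)
        then have "e \<in> C" using N_cycle[OF i(1)] i j by (auto simp: C_def)
        then show False using e F' by blast
      qed
      then show ?thesis by blast
    qed
    have cV: "set c \<subseteq> \<Union>F"
    proof
      fix v assume "v \<in> set c"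
      then obtain j where "j < n" "c ! j = v" by (auto simp: in_set_conv_nth n_def)
      then show "v \<in> \<Union>F" using CF by (auto simp: C_def cycle_edge_def[OF c])
    qed
    have cE: "graph_cycle E c" using c FE by (auto simp: graph_cycle_def)
    show ?thesis unfolding F_def[symmetric]
    proof (intro exI[of _ \<nu>] exI[of _ "c # cs"] conjI)
      show "\<forall>c\<in>set (c # cs). graph_cycle E c \<and> odd (length c) \<and> set c \<subseteq> \<Union>F"
      proof
        fix ca assume "ca \<in> set (c # cs)"
        then consider "ca = c" | "ca \<in> set cs" by auto
        then show "graph_cycle E ca \<and> odd (length ca) \<and> set ca \<subseteq> \<Union>F"
        proof cases
          case 1
          then show ?thesis using cE odd cV by (simp add: n_def)
        next
          case 2
          then show ?thesis using cs(1) F' by blast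
        qed
      qed
      show "sorted_wrt (\<lambda>c c'. set c \<inter> set c' = {}) (c # cs)"
        using cs(1,2) disj by auto
      show "\<forall>v. (\<Sum>e\<in>E. l e * indicat_real e v) =
          (\<Sum>e\<in>E. real (\<nu> e) * indicat_real e v) + (\<Sum>c\<leftarrow>c # cs. indicat_real (set c) v)"
      proof
        fix v
        have "(\<Sum>e\<in>E. l e * indicat_real e v) = (\<Sum>e\<in>E. l' e * indicat_real e v) + indicat_real (set c) v"
          using sum_eq[of v] by simp
        also have "\<dots> = (\<Sum>e\<in>E. real (\<nu> e) * indicat_real e v) + (\<Sum>c\<leftarrow>c # cs. indicat_real (set c) v)"
          using cs(3) by simp
        finally show "(\<Sum>e\<in>E. l e * indicat_real e v) = \<dots>" .
      qed
    qed
  qed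
qed

section \<open>The cone of a matching-covered graph\<close>

definition half_degree :: "nat \<Rightarrow> (nat \<Rightarrow> real) \<Rightarrow> real" where
  "half_degree d x = (\<Sum>i\<in>{1..d}. x i) / 2"

text \<open>Only its points in the cone matter. It is in general larger than the group generated by
  the edge vectors: on a bipartite graph, for example, the balance between the two sides is not
  imposed.\<close>

definition even_lattice :: "nat \<Rightarrow> (nat \<Rightarrow> real) set" where
  "even_lattice d = {x. (\<forall>i. x i \<in> \<int>) \<and> half_degree d x \<in> \<int>}"

lemma half_degree_add: "half_degree d (x + y) = half_degree d x + half_degree d y"
  by (simp add: half_degree_def sum.distrib add_divide_distrib)

lemma half_degree_0: "half_degree d 0 = 0"
  by (simp add: half_degree_def)

lemma half_degree_indicator:
  assumes "A \<subseteq> {1..d}"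
  shows "half_degree d (indicat_real A) = real (card A) / 2"
  using assms by (simp add: half_degree_def indicator_def Int_absorb1 flip: sum.inter_restrict)

lemma half_degree_edge: "\<lbrakk>simple_graph d E; e \<in> E\<rbrakk> \<Longrightarrow> half_degree d (indicat_real e) = 1"
  by (simp add: half_degree_indicator simple_graph_def)

lemma half_degree_sum_list:
  "half_degree d (\<Sum>a\<leftarrow>as. f a) = (\<Sum>a\<leftarrow>as. half_degree d (f a))"
  by (induction as) (simp_all only: list.map sum_list.Nil sum_list.Cons half_degree_0 half_degree_add)

lemma half_degree_edge_sum:
  assumes "simple_graph d E" "set es \<subseteq> E"
  shows "half_degree d (\<Sum>e\<leftarrow>es. indicat_real e) = real (length es)"
proof -
  have "half_degree d (\<Sum>e\<leftarrow>es. indicat_real e) = (\<Sum>e\<leftarrow>es. 1)"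
    unfolding half_degree_sum_list using assms half_degree_edge
    by (intro arg_cong[of _ _ sum_list] map_cong) auto
  then show ?thesis by (simp add: sum_list_triv)
qed

lemma graded_cone_graph:
  assumes "simple_graph d E"
  shows "graded_cone pointwise_scale (indicat_real ` E) (half_degree d)"
proof unfold_locales
  have "finite E"
    using assms by (intro finite_subset[of E "Pow {1..d}"]) (auto simp: simple_graph_def)
  then show "finite (indicat_real ` E)" by simp
  show "half_degree d (x + y) = half_degree d x + half_degree d y" for x y
    by (rule half_degree_add)
  show "half_degree d (pointwise_scale c x) = c * half_degree d x" for c x
    by (simp add: half_degree_def sum_distrib_left)
  show "half_degree d a = 1" if "a \<in> indicat_real ` E" for a
    using that half_degree_edge[OF assms] by auto
qed

lemma odd_length_parity:
  assumes "\<forall>c\<in>set cs. odd (length c)"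
  shows "even (\<Sum>c\<leftarrow>cs. length c) \<longleftrightarrow> even (length cs)"
  using assms by (induction cs) auto

context
  fixes d :: nat and E :: "nat set set"
  assumes graph: "simple_graph d E"
begin

interpretation graph: graded_cone pointwise_scale "indicat_real ` E" "half_degree d"
  by (rule graded_cone_graph[OF graph])

lemma finite_edges: "finite E"
  using graph by (intro finite_subset[of E "Pow {1..d}"]) (auto simp: simple_graph_def)

lemma vertices_subset: "\<Union>E \<subseteq> {1..d}"
  using graph by (auto simp: simple_graph_def)

lemma edge_vector_sum:
  "(\<Sum>a\<in>indicat_real ` E. pointwise_scale (\<gamma> a) a) = (\<lambda>v. \<Sum>e\<in>E. \<gamma> (indicat_real e) * indicat_real e v)"
  by (simp add: fun_eq_iff sum_fun_apply sum.reindex inj_on_subset[OF indicat_real_inj])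

lemma graph_cone_iff:
  "x \<in> graph.cone \<longleftrightarrow> (\<exists>l. (\<forall>e\<in>E. 0 \<le> l e) \<and> x = (\<lambda>v. \<Sum>e\<in>E. l e * indicat_real e v))"
proof
  assume "x \<in> graph.cone"
  then show "\<exists>l. (\<forall>e\<in>E. 0 \<le> l e) \<and> x = (\<lambda>v. \<Sum>e\<in>E. l e * indicat_real e v)"
    unfolding graph.cone_def edge_vector_sum by fastforce
next
  assume "\<exists>l. (\<forall>e\<in>E. 0 \<le> l e) \<and> x = (\<lambda>v. \<Sum>e\<in>E. l e * indicat_real e v)"
  then obtain l where "\<forall>e\<in>E. 0 \<le> l e" "x = (\<lambda>v. \<Sum>e\<in>E. l e * indicat_real e v)" by blast
  then show "x \<in> graph.cone"
    unfolding graph.cone_def edge_vector_sum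
    by (intro CollectI exI[of _ "\<lambda>a. l (inv_into UNIV indicat_real a)"]) (simp add: inv_f_f[OF indicat_real_inj])
qed

lemma graph_open_cone_iff:
  "x \<in> graph.open_cone \<longleftrightarrow> (\<exists>l. (\<forall>e\<in>E. 0 < l e) \<and> x = (\<lambda>v. \<Sum>e\<in>E. l e * indicat_real e v))"
proof
  assume "x \<in> graph.open_cone"
  then show "\<exists>l. (\<forall>e\<in>E. 0 < l e) \<and> x = (\<lambda>v. \<Sum>e\<in>E. l e * indicat_real e v)"
    unfolding graph.open_cone_def edge_vector_sum by fastforce
next
  assume "\<exists>l. (\<forall>e\<in>E. 0 < l e) \<and> x = (\<lambda>v. \<Sum>e\<in>E. l e * indicat_real e v)"
  then obtain l where "\<forall>e\<in>E. 0 < l e" "x = (\<lambda>v. \<Sum>e\<in>E. l e * indicat_real e v)" by blast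
  then show "x \<in> graph.open_cone"
    unfolding graph.open_cone_def edge_vector_sum
    by (intro CollectI exI[of _ "\<lambda>a. l (inv_into UNIV indicat_real a)"]) (simp add: inv_f_f[OF indicat_real_inj])
qed

lemma edge_sum_in_cone:
  assumes "set es \<subseteq> E"
  shows "(\<Sum>e\<leftarrow>es. indicat_real e) \<in> graph.cone"
proof -
  have "(\<Sum>e\<leftarrow>es. indicat_real e) v = (\<Sum>e\<in>E. real (count_list es e) * indicat_real e v)" for v
    using assms
  proof (induction es)
    case (Cons f es)
    have "(\<Sum>e\<in>E. real (count_list (f # es) e) * indicat_real e v) =
        (\<Sum>e\<in>E. (if e = f then indicat_real f v else 0) + real (count_list es e) * indicat_real e v)"
      by (intro sum.cong) (auto simp: algebra_simps)
    also have "\<dots> = indicat_real f v + (\<Sum>e\<leftarrow>es. indicat_real e) v"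
      using Cons finite_edges by (simp add: sum.distrib)
    finally show ?case by simp
  qed simp
  then show ?thesis
    unfolding graph_cone_iff by (intro exI[of _ "\<lambda>e. real (count_list es e)"]) auto
qed

lemma edge_sum_in_lattice:
  assumes "set es \<subseteq> E"
  shows "(\<Sum>e\<leftarrow>es. indicat_real e) \<in> even_lattice d"
proof -
  have "(\<Sum>e\<leftarrow>es. indicat_real e) i \<in> \<int>" for i
    by (induction es) (auto simp: indicator_def)
  then show ?thesis
    unfolding even_lattice_def using half_degree_edge_sum[OF graph assms] by simp
qed

text \<open>Rounding leaves an edge sum and some disjoint odd cycles. The coordinate sum of
  \<open>x\<close> is even, so the number of these cycles is even, and they can be absorbed in
  pairs.\<close>

lemma cone_normal:
  assumes "odd_cycle_condition E" and L: "x \<in> even_lattice d" and cone: "x \<in> graph.cone"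
  shows "x \<in> edge_sums E"
proof -
  obtain l where l: "\<forall>e\<in>E. 0 \<le> l e" "x = (\<lambda>v. \<Sum>e\<in>E. l e * indicat_real e v)"
    using cone by (auto simp: graph_cone_iff)
  obtain \<nu> cs where cs: "\<forall>c\<in>set cs. graph_cycle E c \<and> odd (length c) \<and> set c \<subseteq> \<Union>{e\<in>E. l e \<notin> \<int>}"
      "sorted_wrt (\<lambda>c c'. set c \<inter> set c' = {}) cs"
      "\<forall>v. (\<Sum>e\<in>E. l e * indicat_real e v) =
         (\<Sum>e\<in>E. real (\<nu> e) * indicat_real e v) + (\<Sum>c\<leftarrow>cs. indicat_real (set c) v)"
    using edge_coefficient_rounding[OF finite_edges, of l] graph l L
    by (auto simp: simple_graph_def even_lattice_def)
  define y where "y = (\<Sum>e\<in>E. pointwise_scale (real (\<nu> e)) (indicat_real e))"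
  define z where "z = (\<Sum>c\<leftarrow>cs. indicat_real (set c))"
  have "(\<Sum>c\<leftarrow>cs. indicat_real (set c)) v = (\<Sum>c\<leftarrow>cs. indicat_real (set c) v)" for v
    by (induction cs) simp_all
  then have x: "x = y + z"
    using cs(3) by (simp add: l(2) y_def z_def fun_eq_iff sum_fun_apply)
  have y: "y \<in> edge_sums E"
    unfolding y_def by (intro edge_sums_sum edge_sums_of_nat edge_sums_edge)
  then obtain es where "set es \<subseteq> E" "y = (\<Sum>e\<leftarrow>es. indicat_real e)" by (auto simp: edge_sums_def)
  then have "half_degree d y \<in> \<int>" using half_degree_edge_sum[OF graph] by simp
  moreover have "half_degree d x \<in> \<int>" using L by (simp add: even_lattice_def)
  ultimately have "half_degree d z \<in> \<int>"
    using half_degree_add[of d y z] Ints_diff[of "half_degree d x" "half_degree d y"] by (simp add: x)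
  moreover have "half_degree d z = real (\<Sum>c\<leftarrow>cs. length c) / 2"
  proof -
    have "half_degree d (indicat_real (set c)) = real (length c) / 2" if "c \<in> set cs" for c
    proof -
      have "set c \<subseteq> \<Union>E" using cs(1) that by blast
      then have "set c \<subseteq> {1..d}" using vertices_subset by blast
      moreover have "distinct c" using cs(1) that by (simp add: graph_cycle_def)
      ultimately show ?thesis by (simp add: half_degree_indicator distinct_card)
    qed
    then have "half_degree d z = (\<Sum>c\<leftarrow>cs. real (length c) / 2)"
      unfolding z_def half_degree_sum_list by (intro arg_cong[of _ _ sum_list] map_cong) auto
    also have "\<dots> = real (\<Sum>c\<leftarrow>cs. length c) / 2" by (induction cs) (simp_all add: add_divide_distrib)
    finally show ?thesis .
  qed
  ultimately obtain k where "real (\<Sum>c\<leftarrow>cs. length c) / 2 = of_int k" by (auto elim: Ints_cases)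
  then have "real_of_int (int (\<Sum>c\<leftarrow>cs. length c)) = of_int (2 * k)" by simp
  then have "int (\<Sum>c\<leftarrow>cs. length c) = 2 * k" by (simp only: of_int_eq_iff)
  then have "even (\<Sum>c\<leftarrow>cs. length c)" by presburger
  then have "even (length cs)" using odd_length_parity[of cs] cs(1) by blast
  then have "z \<in> edge_sums E"
    unfolding z_def using cs(1,2) by (intro odd_cycles_in_edge_sums[OF assms(1)]) auto
  then show ?thesis unfolding x using y by (rule edge_sums_add[rotated])
qed

lemma component_eq:
  assumes "odd_cycle_condition E"
  shows "{x \<in> even_lattice d \<inter> graph.cone. half_degree d x = real k} =
           {(\<Sum>e\<leftarrow>es. indicat_real e) |es. set es \<subseteq> E \<and> length es = k}" (is "?L = ?R")
proof (intro equalityI subsetI)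
  fix x assume x: "x \<in> ?L"
  then obtain es where es: "x = (\<Sum>e\<leftarrow>es. indicat_real e)" "set es \<subseteq> E"
    using cone_normal[OF assms, of x] by (auto simp: edge_sums_def)
  then have "length es = k" using x half_degree_edge_sum[OF graph es(2)] by simp
  with es show "x \<in> ?R" by blast
next
  fix x assume "x \<in> ?R"
  then obtain es where es: "x = (\<Sum>e\<leftarrow>es. indicat_real e)" "set es \<subseteq> E" "length es = k" by blast
  then show "x \<in> ?L"
    using edge_sum_in_cone[OF es(2)] edge_sum_in_lattice[OF es(2)] half_degree_edge_sum[OF graph es(2)]
    by (simp only: mem_Collect_eq Int_iff simp_thms)
qed

lemma perfect_matching_indicator:
  assumes M: "perfect_matching d E M"
  shows "(\<Sum>f\<in>M. indicat_real f v) = indicat_real (\<Union>E) v"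
proof (cases "v \<in> \<Union>E")
  case True
  then have "v \<in> {1..d}" using vertices_subset by blast
  then obtain f where f: "f \<in> M" "v \<in> f" "\<And>g. \<lbrakk>g \<in> M; v \<in> g\<rbrakk> \<Longrightarrow> g = f"
    using M unfolding perfect_matching_def by blast
  have "finite M" using M finite_edges finite_subset by (auto simp: perfect_matching_def)
  have "indicat_real g v = (if g = f then 1 else 0)" if "g \<in> M" for g
    using f(2) f(3)[OF that] by (cases "g = f") (auto simp: indicator_def)
  then have "(\<Sum>f\<in>M. indicat_real f v) = (\<Sum>g\<in>M. if g = f then 1 else 0)"
    by (intro sum.cong) auto
  then show ?thesis using f(1) \<open>finite M\<close> True by simp
next
  case False
  then have "indicat_real f v = 0" if "f \<in> M" for f
    using M that by (auto simp: perfect_matching_def indicator_def)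
  then show ?thesis using False by simp
qed

theorem lattice_cone_graph:
  assumes covered: "matching_covered d E" and "odd_cycle_condition E"
  shows "lattice_cone pointwise_scale (indicat_real ` E) (half_degree d) (even_lattice d)
           (indicat_real (\<Union>E))"
proof unfold_locales
  \<comment> \<open>The union of the edges is the full vertex set except for the graph with a single
    vertex, whose cone and interior consist of 0 alone.\<close>
  let ?u = "indicat_real (\<Union>E)"
  obtain M where M: "\<And>e. e \<in> E \<Longrightarrow> perfect_matching d E (M e)" "\<And>e. e \<in> E \<Longrightarrow> e \<in> M e"
    using covered unfolding matching_covered_def by metis
  show "0 \<in> even_lattice d" by (simp add: even_lattice_def half_degree_def)
  show "x - y \<in> even_lattice d" if "x \<in> even_lattice d" "y \<in> even_lattice d" for x y
    using that by (simp add: even_lattice_def half_degree_def sum_subtractf diff_divide_distrib)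
  show "indicat_real ` E \<subseteq> even_lattice d"
  proof
    fix x assume "x \<in> indicat_real ` E"
    then obtain e where "e \<in> E" "x = indicat_real e" by blast
    then show "x \<in> even_lattice d" using edge_sum_in_lattice[of "[e]"] by simp
  qed
  show "finite {x \<in> even_lattice d \<inter> graph.cone. half_degree d x = real k}" for k
  proof -
    have "{(\<Sum>e\<leftarrow>es. indicat_real e) |es. set es \<subseteq> E \<and> length es = k} =
        (\<lambda>es. \<Sum>e\<leftarrow>es. indicat_real e) ` {es. set es \<subseteq> E \<and> length es = k}" by blast
    then show ?thesis
      unfolding component_eq[OF assms(2)] using finite_lists_length_eq[OF finite_edges] by simp
  qed
  show "half_degree d x \<in> \<nat>" if x: "x \<in> even_lattice d" "x \<in> graph.cone" for x
  proof -
    obtain es where "x = (\<Sum>e\<leftarrow>es. indicat_real e)" "set es \<subseteq> E"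
      using cone_normal[OF assms(2) x] by (auto simp: edge_sums_def)
    then show ?thesis using half_degree_edge_sum[OF graph] by simp
  qed
  show "?u \<in> even_lattice d"
  proof (cases "E = {}")
    case True
    then show ?thesis by (simp add: even_lattice_def half_degree_def)
  next
    case False
    then obtain e where e: "e \<in> E" by blast
    have "half_degree d ?u = (\<Sum>f\<in>M e. half_degree d (indicat_real f))"
      unfolding half_degree_def perfect_matching_indicator[OF M(1)[OF e], symmetric]
      by (subst sum.swap) (simp add: sum_divide_distrib)
    also have "\<dots> = (\<Sum>f\<in>M e. 1)"
      using M(1)[OF e] half_degree_edge[OF graph] by (intro sum.cong) (auto simp: perfect_matching_def)
    finally show ?thesis by (simp add: even_lattice_def indicator_def)
  qed
  show "?u \<in> graph.open_cone"
    unfolding graph_open_cone_iff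
  proof (intro exI conjI ballI)
    \<comment> \<open>The average of the matchings \<open>M e\<close> over all edges: each sums to
      \<open>?u\<close>, and the weight of \<open>f\<close> is positive because \<open>M f\<close>
      contains \<open>f\<close>.\<close>
    define l where "l f = (\<Sum>e\<in>E. of_bool (f \<in> M e)) / real (card E)" for f
    show "0 < l f" if "f \<in> E" for f
    proof -
      have "0 < card E" using that finite_edges card_gt_0_iff by blast
      moreover have "0 < (\<Sum>e\<in>E. of_bool (f \<in> M e) :: real)"
        using that finite_edges M(2) by (intro sum_pos2[of _ f]) auto
      ultimately show ?thesis by (simp add: l_def)
    qed
    show "?u = (\<lambda>v. \<Sum>f\<in>E. l f * indicat_real f v)"
    proof
      fix v
      have "(\<Sum>f\<in>E. l f * indicat_real f v) = (\<Sum>f\<in>E. \<Sum>e\<in>E. of_bool (f \<in> M e) * indicat_real f v) / real (card E)"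
        by (simp add: l_def sum_distrib_right sum_divide_distrib)
      also have "(\<Sum>f\<in>E. \<Sum>e\<in>E. of_bool (f \<in> M e) * indicat_real f v) =
          (\<Sum>e\<in>E. \<Sum>f\<in>E. of_bool (f \<in> M e) * indicat_real f v)"
        by (rule sum.swap)
      also have "\<dots> = (\<Sum>e\<in>E. ?u v)"
      proof (rule sum.cong[OF refl])
        fix e assume e: "e \<in> E"
        have "(\<Sum>f\<in>E. of_bool (f \<in> M e) * indicat_real f v) = (\<Sum>f\<in>M e. indicat_real f v)"
          using M(1)[OF e] finite_edges
          by (intro sum.mono_neutral_cong_right) (auto simp: perfect_matching_def)
        then show "(\<Sum>f\<in>E. of_bool (f \<in> M e) * indicat_real f v) = ?u v"
          using perfect_matching_indicator[OF M(1)[OF e]] by simp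
      qed
      also have "\<dots> / real (card E) = ?u v"
        using finite_edges by (cases "E = {}") auto
      finally show "?u v = (\<Sum>f\<in>E. l f * indicat_real f v)" by simp
    qed
  qed
  show "half_degree d ?u < half_degree d x"
    if x: "x \<in> even_lattice d" "x \<in> graph.open_cone" "x \<noteq> ?u" for x
  proof -
    obtain l where l: "\<forall>e\<in>E. 0 < l e" "x = (\<lambda>v. \<Sum>e\<in>E. l e * indicat_real e v)"
      using x(2) by (auto simp: graph_open_cone_iff)
    have ge: "?u v \<le> x v" for v
    proof (cases "v \<in> \<Union>E")
      case True
      then obtain e where e: "e \<in> E" "v \<in> e" by blast
      have "0 < x v"
        unfolding l(2) using e l(1) finite_edges
        by (intro sum_pos2[of _ e]) (auto simp: less_imp_le)
      moreover have "x v \<in> \<int>" using x(1) by (simp add: even_lattice_def)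
      ultimately show ?thesis using True by (auto elim!: Ints_cases)
    next
      case False
      then have "x v = 0" unfolding l(2) by (intro sum.neutral) (auto simp: indicator_def)
      then show ?thesis using False by simp
    qed
    obtain v where v: "x v \<noteq> ?u v" using x(3) by (auto simp: fun_eq_iff)
    have "v \<in> \<Union>E"
    proof (rule ccontr)
      assume "v \<notin> \<Union>E"
      then have "x v = 0" unfolding l(2) by (intro sum.neutral) (auto simp: indicator_def)
      then show False using v \<open>v \<notin> \<Union>E\<close> by simp
    qed
    then have "v \<in> {1..d}" using vertices_subset by blast
    moreover have "?u v < x v" using ge[of v] v by simp
    ultimately have "(\<Sum>i\<in>{1..d}. ?u i) < (\<Sum>i\<in>{1..d}. x i)"
      using ge by (intro sum_strict_mono_ex1) auto
    then show ?thesis by (simp add: half_degree_def)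
  qed
qed

end

section \<open>Monomials of the edge ring\<close>

interpretation mpoly: vector_space "mpoly_scale :: 'k::field \<Rightarrow> 'k mpoly \<Rightarrow> 'k mpoly"
  by (rule vector_space_mpoly_scale)

abbreviation monomial :: "(nat \<Rightarrow>\<^sub>0 nat) \<Rightarrow> 'k::field mpoly" where
  "monomial s \<equiv> Poly_Mapping.single s 1"

definition exponent :: "nat set \<Rightarrow> nat \<Rightarrow>\<^sub>0 nat" where
  "exponent e = (\<Sum>i\<in>e. Poly_Mapping.single i 1)"

definition edge_monoid :: "nat set set \<Rightarrow> (nat \<Rightarrow>\<^sub>0 nat) set" where
  "edge_monoid E = {(\<Sum>e\<leftarrow>es. exponent e) |es. set es \<subseteq> E}"

definition real_vector_of :: "(nat \<Rightarrow>\<^sub>0 nat) \<Rightarrow> nat \<Rightarrow> real" where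
  "real_vector_of s = (\<lambda>i. real (Poly_Mapping.lookup s i))"

lemma real_vector_of_add: "real_vector_of (s + t) = real_vector_of s + real_vector_of t"
  by (simp add: real_vector_of_def fun_eq_iff lookup_add)

lemma real_vector_of_inj: "inj real_vector_of"
  by (rule injI) (auto simp: real_vector_of_def fun_eq_iff intro: poly_mapping_eqI)

lemma lookup_exponent: "finite e \<Longrightarrow> Poly_Mapping.lookup (exponent e) i = of_bool (i \<in> e)"
  by (simp add: exponent_def lookup_sum lookup_single when_def)

lemma real_vector_of_exponent: "finite e \<Longrightarrow> real_vector_of (exponent e) = indicat_real e"
  by (simp add: real_vector_of_def fun_eq_iff lookup_exponent indicator_def)

lemma edge_monomial_eq: "edge_monomial e = monomial (exponent e)"
  unfolding edge_monomial_def mpoly_var_def exponent_def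
  by (induction e rule: infinite_finite_induct) (simp_all add: mult_single)

lemma prod_list_edge_monomial: "prod_list (map edge_monomial es) = monomial (\<Sum>e\<leftarrow>es. exponent e)"
  by (induction es) (simp_all add: edge_monomial_eq mult_single)

lemma mpoly_scale_monomial: "mpoly_scale c (monomial s) = Poly_Mapping.single s c"
  by (simp add: mpoly_scale_def mpoly_const_def mult_single)

lemma edge_monoid_zero: "0 \<in> edge_monoid E"
  unfolding edge_monoid_def by (intro CollectI exI[of _ "[]"]) simp

lemma edge_monoid_add: "\<lbrakk>s \<in> edge_monoid E; t \<in> edge_monoid E\<rbrakk> \<Longrightarrow> s + t \<in> edge_monoid E"
  unfolding edge_monoid_def
proof (elim CollectE exE conjE)
  fix es es' assume "s = (\<Sum>e\<leftarrow>es. exponent e)" "set es \<subseteq> E" "t = (\<Sum>e\<leftarrow>es'. exponent e)" "set es' \<subseteq> E"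
  then show "s + t \<in> {(\<Sum>e\<leftarrow>es. exponent e) |es. set es \<subseteq> E}"
    by (intro CollectI exI[of _ "es @ es'"]) simp
qed

lemma edge_monoid_exponent: "e \<in> E \<Longrightarrow> exponent e \<in> edge_monoid E"
  unfolding edge_monoid_def by (intro CollectI exI[of _ "[e]"]) simp

lemma mpoly_sum_monomials: "p = (\<Sum>s\<in>Poly_Mapping.keys p. Poly_Mapping.single s (Poly_Mapping.lookup p s))"
proof (rule poly_mapping_eqI)
  fix s
  have "Poly_Mapping.lookup (\<Sum>t\<in>Poly_Mapping.keys p. Poly_Mapping.single t (Poly_Mapping.lookup p t)) s =
      (\<Sum>t\<in>Poly_Mapping.keys p. if t = s then Poly_Mapping.lookup p s else 0)"
    unfolding lookup_sum by (intro sum.cong) (auto simp: lookup_single when_def)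
  then show "Poly_Mapping.lookup p s = Poly_Mapping.lookup (\<Sum>t\<in>Poly_Mapping.keys p. Poly_Mapping.single t (Poly_Mapping.lookup p t)) s"
    by (simp add: in_keys_iff)
qed

text \<open>The edge ring is the monoid algebra of \<open>edge_monoid\<close>, so membership is a
  condition on the support alone.\<close>

lemma edge_ring_carrier_iff:
  fixes p :: "'k::field mpoly"
  shows "p \<in> edge_ring_carrier E \<longleftrightarrow> Poly_Mapping.keys p \<subseteq> edge_monoid E"
proof
  assume "p \<in> edge_ring_carrier E"
  then show "Poly_Mapping.keys p \<subseteq> edge_monoid E"
  proof induction
    case (const c)
    then show ?case by (simp add: mpoly_const_def edge_monoid_zero)
  next
    case (edge e)
    then show ?case by (simp add: edge_monomial_eq edge_monoid_exponent)
  next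
    case (add p q)
    then show ?case using keys_add[of p q] by blast
  next
    case (mult p q)
    then show ?case using keys_mult[of p q] by (blast intro: edge_monoid_add)
  qed
next
  assume p: "Poly_Mapping.keys p \<subseteq> edge_monoid E"
  have zero: "(0 :: 'k mpoly) \<in> edge_ring_carrier E"
    using edge_ring_carrier.const[of 0 E] by (simp add: mpoly_const_def)
  have "(monomial s :: 'k mpoly) \<in> edge_ring_carrier E" if "s \<in> edge_monoid E" for s
  proof -
    have "(prod_list (map edge_monomial es) :: 'k mpoly) \<in> edge_ring_carrier E" if "set es \<subseteq> E" for es
      using that
    proof (induction es)
      case Nil
      show ?case using edge_ring_carrier.const[of 1 E] by (simp add: mpoly_const_def)
    next
      case (Cons e es)
      then show ?case by (auto intro: edge_ring_carrier.mult edge_ring_carrier.edge)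
    qed
    then show ?thesis using that by (auto simp: edge_monoid_def prod_list_edge_monomial)
  qed
  then have single: "Poly_Mapping.single s c \<in> edge_ring_carrier E" if "s \<in> edge_monoid E" for s and c :: 'k
    using edge_ring_carrier.mult[OF edge_ring_carrier.const[of c E], of "monomial s"] that
    by (simp add: mpoly_const_def mult_single)
  have "(\<Sum>s\<in>K. Poly_Mapping.single s (Poly_Mapping.lookup p s)) \<in> edge_ring_carrier E"
    if "finite K" "K \<subseteq> edge_monoid E" for K
    using that by (induction K) (auto intro: edge_ring_carrier.add zero single)
  then show "p \<in> edge_ring_carrier E"
    using p by (subst mpoly_sum_monomials) simp
qed

lemma independent_monomials: "finite S \<Longrightarrow> mpoly.independent ((monomial :: _ \<Rightarrow> 'k::field mpoly) ` S)"
proof (rule mpoly.independent_if_scalars_zero)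
  fix f :: "'k mpoly \<Rightarrow> 'k" and x :: "'k mpoly"
  assume S: "finite S" and f: "(\<Sum>x\<in>monomial ` S. mpoly_scale (f x) x) = 0" and x: "x \<in> monomial ` S"
  obtain s where s: "s \<in> S" "x = monomial s" using x by blast
  have "inj_on (monomial :: _ \<Rightarrow> 'k mpoly) S"
    by (rule inj_onI) (metis keys_single singleton_inject zero_neq_one)
  then have "0 = (\<Sum>t\<in>S. Poly_Mapping.single t (f (monomial t)))"
    using f by (simp add: sum.reindex mpoly_scale_monomial)
  then have "0 = Poly_Mapping.lookup (\<Sum>t\<in>S. Poly_Mapping.single t (f (monomial t))) s" by (metis lookup_zero)
  also have "\<dots> = (\<Sum>t\<in>S. if t = s then f (monomial s) else 0)"
    unfolding lookup_sum by (intro sum.cong) (auto simp: lookup_single when_def)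
  finally show "f x = 0" using S s by simp
qed simp

text \<open>Different lists of edges may have the same product, so the dimension is the number of
  distinct exponents; the injection \<open>real_vector_of\<close> turns these into lattice
  points.\<close>

lemma dim_edge_ring_component:
  assumes "finite E" and "\<And>e. e \<in> E \<Longrightarrow> finite e"
  shows "mpoly.dim (edge_ring_component E k :: 'k::field mpoly set) =
           card {(\<Sum>e\<leftarrow>es. indicat_real e) |es. set es \<subseteq> E \<and> length es = k}"
proof -
  define X where "X = {(\<Sum>e\<leftarrow>es. exponent e) |es. set es \<subseteq> E \<and> length es = k}"
  have "X = (\<lambda>es. \<Sum>e\<leftarrow>es. exponent e) ` {es. set es \<subseteq> E \<and> length es = k}"
    by (auto simp: X_def)
  then have fin: "finite X" using finite_lists_length_eq[OF assms(1)] by simp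
  have "{prod_list (map edge_monomial es) |es. set es \<subseteq> E \<and> length es = k} = (monomial :: _ \<Rightarrow> 'k mpoly) ` X"
    unfolding prod_list_edge_monomial X_def by blast
  then have "mpoly.dim (edge_ring_component E k :: 'k mpoly set) = card ((monomial :: _ \<Rightarrow> 'k mpoly) ` X)"
    unfolding edge_ring_component_def
    using mpoly.dim_span_eq_card_independent[OF independent_monomials[OF fin]] by simp
  also have "\<dots> = card X"
    by (intro card_image inj_onI) (metis keys_single singleton_inject zero_neq_one)
  also have "\<dots> = card (real_vector_of ` X)"
    by (intro card_image[symmetric] inj_on_subset[OF real_vector_of_inj subset_UNIV])
  also have "real_vector_of ` X = {(\<Sum>e\<leftarrow>es. indicat_real e) |es. set es \<subseteq> E \<and> length es = k}"
  proof -
    have rv: "real_vector_of (\<Sum>e\<leftarrow>es. exponent e) = (\<Sum>e\<leftarrow>es. indicat_real e)" if "set es \<subseteq> E" for es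
      using that
    proof (induction es)
      case Nil
      show ?case by (simp add: real_vector_of_def fun_eq_iff)
    next
      case (Cons e es)
      then show ?case
        using assms(2) by (simp add: real_vector_of_add real_vector_of_exponent)
    qed
    show ?thesis
      unfolding X_def
    proof (intro equalityI subsetI)
      fix x assume "x \<in> {(\<Sum>e\<leftarrow>es. indicat_real e) |es. set es \<subseteq> E \<and> length es = k}"
      then obtain es where es: "x = (\<Sum>e\<leftarrow>es. indicat_real e)" "set es \<subseteq> E" "length es = k" by blast
      then show "x \<in> real_vector_of ` {(\<Sum>e\<leftarrow>es. exponent e) |es. set es \<subseteq> E \<and> length es = k}"
        using rv[OF es(2)] by (intro image_eqI[of _ _ "\<Sum>e\<leftarrow>es. exponent e"]) auto
    qed (use rv in blast)
  qed
  finally show ?thesis .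
qed

text \<open>For a minimal separating set \<open>B\<close> of coordinates, each \<open>b \<in> B\<close> has a difference \<open>z b\<close> of monoid elements
  that vanishes on \<open>B\<close> except at \<open>b\<close>. These form a basis of the span: an integral multiple of an edge
  vector minus a suitable integral combination of the \<open>z b\<close> is a difference of monoid elements that
  vanishes on \<open>B\<close>, hence is zero.\<close>

lemma ex_separating_coordinates:
  assumes graph: "simple_graph d E"
  shows "\<exists>B. finite B \<and> card B = pointwise.dim (indicat_real ` E) \<and>
    (\<forall>s\<in>edge_monoid E. \<forall>t\<in>edge_monoid E. (\<forall>i\<in>B. Poly_Mapping.lookup s i = Poly_Mapping.lookup t i) \<longrightarrow> s = t) \<and>
    (\<forall>b\<in>B. \<exists>s\<in>edge_monoid E. \<exists>t\<in>edge_monoid E. (\<forall>i\<in>B-{b}. Poly_Mapping.lookup s i = Poly_Mapping.lookup t i) \<and> Poly_Mapping.lookup s b \<noteq> Poly_Mapping.lookup t b)"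
proof -
  define sep where "sep B \<longleftrightarrow> finite B \<and>
    (\<forall>s\<in>edge_monoid E. \<forall>t\<in>edge_monoid E. (\<forall>i\<in>B. Poly_Mapping.lookup s i = Poly_Mapping.lookup t i) \<longrightarrow> s = t)" for B
  have finE: "finite e" if "e \<in> E" for e
    using graph that by (metis card.infinite simple_graph_def zero_neq_numeral)
  have "sep {1..d}"
    unfolding sep_def
  proof (intro conjI ballI impI)
    have out: "Poly_Mapping.lookup s i = 0" if "s \<in> edge_monoid E" "i \<notin> {1..d}" for s i
    proof -
      have "Poly_Mapping.lookup (\<Sum>e\<leftarrow>es. exponent e) i = 0" if "set es \<subseteq> E" for es
        using that
      proof (induction es)
        case (Cons e es)
        then have "e \<subseteq> {1..d}" using graph by (simp add: simple_graph_def)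
        then have "i \<notin> e" using \<open>i \<notin> {1..d}\<close> by blast
        then show ?case using Cons finE by (simp add: lookup_add lookup_exponent)
      qed simp
      then show ?thesis using that by (auto simp: edge_monoid_def)
    qed
    fix s t assume st: "s \<in> edge_monoid E" "t \<in> edge_monoid E" "\<forall>i\<in>{1..d}. Poly_Mapping.lookup s i = Poly_Mapping.lookup t i"
    show "s = t"
    proof (rule poly_mapping_eqI)
      fix i show "Poly_Mapping.lookup s i = Poly_Mapping.lookup t i"
        using st out by (cases "i \<in> {1..d}") auto
    qed
  qed simp
  then obtain B where B: "sep B" and min: "\<And>B'. sep B' \<Longrightarrow> card B \<le> card B'"
    using ex_has_least_nat[of sep _ card] by blast
  have finB: "finite B" using B by (simp add: sep_def)
  have "\<exists>s t. s \<in> edge_monoid E \<and> t \<in> edge_monoid E \<and> (\<forall>i\<in>B-{b}. Poly_Mapping.lookup s i = Poly_Mapping.lookup t i) \<and> Poly_Mapping.lookup s b \<noteq> Poly_Mapping.lookup t b"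
    if b: "b \<in> B" for b
  proof -
    have "card (B - {b}) < card B" using b finB by (rule card_Diff1_less[rotated])
    then have "\<not> sep (B - {b})" using min by (meson not_le)
    then obtain s t where st: "s \<in> edge_monoid E" "t \<in> edge_monoid E"
        "\<forall>i\<in>B-{b}. Poly_Mapping.lookup s i = Poly_Mapping.lookup t i" "s \<noteq> t"
      using finB by (auto simp: sep_def)
    then have "Poly_Mapping.lookup s b \<noteq> Poly_Mapping.lookup t b" using B by (auto simp: sep_def)
    with st show ?thesis by blast
  qed
  then obtain s t where st: "\<And>b. b \<in> B \<Longrightarrow> s b \<in> edge_monoid E" "\<And>b. b \<in> B \<Longrightarrow> t b \<in> edge_monoid E"
      "\<And>b i. \<lbrakk>b \<in> B; i \<in> B - {b}\<rbrakk> \<Longrightarrow> Poly_Mapping.lookup (s b) i = Poly_Mapping.lookup (t b) i"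
      "\<And>b. b \<in> B \<Longrightarrow> Poly_Mapping.lookup (s b) b \<noteq> Poly_Mapping.lookup (t b) b"
    by metis
  define z where "z b = real_vector_of (s b) - real_vector_of (t b)" for b
  have z0: "z b i = 0" if "b \<in> B" "i \<in> B" "i \<noteq> b" for b i
    using st(3)[of b i] that by (simp add: z_def real_vector_of_def)
  have zb: "z b b \<noteq> 0" if "b \<in> B" for b
    using st(4)[OF that] by (simp add: z_def real_vector_of_def)
  have inj: "inj_on z B"
    by (rule inj_onI) (metis z0 zb)
  have indep: "pointwise.independent (z ` B)"
  proof (rule pointwise.independent_if_scalars_zero)
    fix f x assume f: "(\<Sum>x\<in>z ` B. pointwise_scale (f x) x) = 0" and "x \<in> z ` B"
    then obtain b where b: "b \<in> B" "x = z b" by blast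
    have "0 = (\<Sum>b'\<in>B. pointwise_scale (f (z b')) (z b')) b"
      using f inj by (simp add: sum.reindex)
    also have "\<dots> = (\<Sum>b'\<in>B. if b' = b then f (z b) * z b b else 0)"
      unfolding sum_fun_apply using z0 b by (intro sum.cong) auto
    finally show "f x = 0" using b finB zb by simp
  qed (use finB in simp)
  \<comment> \<open>The group generated by the monoid. In it, separation by \<open>B\<close> says
    that an element vanishing on \<open>B\<close> is 0; the price is that only integral combinations
    are allowed.\<close>
  define G where "G = {real_vector_of s - real_vector_of t |s t. s \<in> edge_monoid E \<and> t \<in> edge_monoid E}"
  have G0: "0 \<in> G" unfolding G_def using edge_monoid_zero by (intro CollectI exI[of _ 0]) simp
  have G_add: "x + y \<in> G" if xy: "x \<in> G" "y \<in> G" for x y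
  proof -
    obtain s t s' t' where "x = real_vector_of s - real_vector_of t" "y = real_vector_of s' - real_vector_of t'"
        "s \<in> edge_monoid E" "t \<in> edge_monoid E" "s' \<in> edge_monoid E" "t' \<in> edge_monoid E"
      using xy by (auto simp: G_def)
    then have "x + y = real_vector_of (s + s') - real_vector_of (t + t')" "s + s' \<in> edge_monoid E" "t + t' \<in> edge_monoid E"
      by (auto simp: real_vector_of_add edge_monoid_add)
    then show ?thesis unfolding G_def by blast
  qed
  have G_neg: "- x \<in> G" if "x \<in> G" for x
  proof -
    obtain s t where "x = real_vector_of s - real_vector_of t" "s \<in> edge_monoid E" "t \<in> edge_monoid E"
      using \<open>x \<in> G\<close> by (auto simp: G_def)
    then have "- x = real_vector_of t - real_vector_of s" by simp
    then show ?thesis using \<open>s \<in> edge_monoid E\<close> \<open>t \<in> edge_monoid E\<close> unfolding G_def by blast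
  qed
  have G_nat: "pointwise_scale (real n) x \<in> G" if "x \<in> G" for n x
  proof (induction n)
    case 0
    have "pointwise_scale (real 0) x = 0" by (simp add: fun_eq_iff)
    then show ?case using G0 by (simp only:)
  next
    case (Suc n)
    have "pointwise_scale (real (Suc n)) x = x + pointwise_scale (real n) x"
      by (simp add: fun_eq_iff algebra_simps)
    then show ?case using G_add[OF that Suc] by (simp only:)
  qed
  have G_int: "pointwise_scale c x \<in> G" if c: "c \<in> \<int>" and x: "x \<in> G" for c x
  proof -
    obtain k where k: "c = of_int k" using c by (auto elim: Ints_cases)
    show ?thesis
    proof (cases "0 \<le> k")
      case True
      then have "c = real (nat k)" using k by simp
      then show ?thesis using G_nat[OF x] by (simp only:)
    next
      case False
      then have "c = - real (nat (- k))" using k by simp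
      then have "pointwise_scale c x = - pointwise_scale (real (nat (- k))) x" by (simp add: fun_eq_iff)
      then show ?thesis using G_neg[OF G_nat[OF x]] by (simp only:)
    qed
  qed
  have G_sum: "(\<Sum>i\<in>I. f i) \<in> G" if "\<And>i. i \<in> I \<Longrightarrow> f i \<in> G" for I f
    using that by (induction I rule: infinite_finite_induct) (simp_all only: sum.infinite sum.empty sum.insert G0 G_add insert_iff simp_thms)
  have G_sep: "x = 0" if x: "x \<in> G" "\<And>i. i \<in> B \<Longrightarrow> x i = 0" for x
  proof -
    obtain s t where "x = real_vector_of s - real_vector_of t" "s \<in> edge_monoid E" "t \<in> edge_monoid E"
      using x(1) by (auto simp: G_def)
    moreover from this have "\<forall>i\<in>B. Poly_Mapping.lookup s i = Poly_Mapping.lookup t i"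
      using x(2) by (simp add: real_vector_of_def)
    ultimately show ?thesis using B by (auto simp: sep_def)
  qed
  have zG: "z b \<in> G" if "b \<in> B" for b
    using st(1,2)[OF that] by (auto simp: G_def z_def)
  have z_int: "z b i \<in> \<int>" for b i by (simp add: z_def real_vector_of_def)
  have span1: "indicat_real e \<in> pointwise.span (z ` B)" if e: "e \<in> E" for e
  proof -
    \<comment> \<open>Clearing of denominators: the vectors \<open>z b\<close> are diagonal on
      \<open>B\<close>, so the edge vector needs the coefficient
      \<open>indicat_real e b / z b b\<close>, and the product of all diagonal entries makes it
      integral.\<close>
    define n where "n = (\<Prod>b\<in>B. z b b)"
    define a where "a b = (\<Prod>b'\<in>B-{b}. z b' b') * indicat_real e b" for b
    have n: "n \<noteq> 0" "n \<in> \<int>" using zb finB z_int by (auto simp: n_def)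
    have a_int: "a b \<in> \<int>" for b
      unfolding a_def using z_int by (intro Ints_mult Ints_prod) (auto simp: indicator_def)
    have "indicat_real e = real_vector_of (exponent e) - real_vector_of 0"
      using real_vector_of_exponent[OF finE[OF e]] by (simp add: real_vector_of_def fun_eq_iff)
    then have eG: "indicat_real e \<in> G"
      unfolding G_def using edge_monoid_exponent[OF e] edge_monoid_zero by blast
    define v where "v = pointwise_scale n (indicat_real e) + - (\<Sum>b\<in>B. pointwise_scale (a b) (z b))"
    have vG: "v \<in> G"
      unfolding v_def using G_int[OF n(2) eG] G_int[OF a_int zG] by (intro G_add G_neg G_sum)
    have "v i = 0" if i: "i \<in> B" for i
    proof -
      have "(\<Sum>b\<in>B. pointwise_scale (a b) (z b)) i = (\<Sum>b\<in>B. if b = i then a i * z i i else 0)"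
        unfolding sum_fun_apply using z0 i by (intro sum.cong) auto
      then have "(\<Sum>b\<in>B. pointwise_scale (a b) (z b)) i = a i * z i i" using i finB by simp
      moreover have "n = z i i * (\<Prod>b'\<in>B-{i}. z b' b')"
        unfolding n_def using finB i by (rule prod.remove)
      ultimately show ?thesis by (simp add: v_def a_def)
    qed
    then have "v = 0" using G_sep[OF vG] by blast
    then have "pointwise_scale n (indicat_real e) = (\<Sum>b\<in>B. pointwise_scale (a b) (z b))"
      unfolding v_def by (simp only: add_eq_0_iff2 minus_minus)
    then have "indicat_real e = pointwise_scale (1 / n) (\<Sum>b\<in>B. pointwise_scale (a b) (z b))"
      using n(1) by (metis divide_self pointwise.scale_one pointwise.scale_scale times_divide_eq_left mult_1)
    then show ?thesis
      by (metis (no_types, lifting) imageI pointwise.span_base pointwise.span_scale pointwise.span_sum)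
  qed
  have span2: "z b \<in> pointwise.span (indicat_real ` E)" if b: "b \<in> B" for b
  proof -
    have "real_vector_of s \<in> pointwise.span (indicat_real ` E)" if s: "s \<in> edge_monoid E" for s
    proof -
      have "real_vector_of (\<Sum>e\<leftarrow>es. exponent e) \<in> pointwise.span (indicat_real ` E)" if "set es \<subseteq> E" for es
        using that
      proof (induction es)
        case Nil
        have "real_vector_of (\<Sum>e\<leftarrow>[]. exponent e) = 0" by (simp add: real_vector_of_def fun_eq_iff)
        then show ?case using pointwise.span_zero by (simp only:)
      next
        case (Cons e es)
        then have "real_vector_of (\<Sum>e\<leftarrow>e # es. exponent e) = indicat_real e + real_vector_of (\<Sum>e\<leftarrow>es. exponent e)"
          using finE by (simp add: real_vector_of_add real_vector_of_exponent)
        moreover have "indicat_real e + real_vector_of (\<Sum>e\<leftarrow>es. exponent e) \<in> pointwise.span (indicat_real ` E)"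
          using Cons by (intro pointwise.span_add pointwise.span_base Cons.IH) auto
        ultimately show ?case by (simp only:)
      qed
      then show ?thesis using s by (auto simp: edge_monoid_def)
    qed
    then show ?thesis unfolding z_def using st(1,2)[OF b] by (intro pointwise.span_diff)
  qed
  have "pointwise.span (z ` B) = pointwise.span (indicat_real ` E)"
    using span1 span2 by (intro pointwise.span_eq[THEN iffD2]) auto
  then have "pointwise.dim (indicat_real ` E) = card (z ` B)"
    by (rule pointwise.dim_eq_card[OF _ indep])
  then have "card B = pointwise.dim (indicat_real ` E)"
    using card_image[OF inj] by simp
  then show ?thesis
    using B st by (intro exI[of _ B]) (unfold sep_def, blast)
qed

section \<open>The Krull dimension of the edge ring\<close>

text \<open>The linear extension of a map on exponents; for additive \<open>f\<close> it is a ring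
  homomorphism, which realises the substitutions \<open>t\<^sub>i = 1\<close>.\<close>

definition push :: "((nat \<Rightarrow>\<^sub>0 nat) \<Rightarrow> (nat \<Rightarrow>\<^sub>0 nat)) \<Rightarrow> 'k::field mpoly \<Rightarrow> 'k mpoly" where
  "push f p = (\<Sum>s\<in>Poly_Mapping.keys p. Poly_Mapping.single (f s) (Poly_Mapping.lookup p s))"

lemma push_superset:
  "\<lbrakk>finite K; Poly_Mapping.keys p \<subseteq> K\<rbrakk> \<Longrightarrow>
     push f p = (\<Sum>s\<in>K. Poly_Mapping.single (f s) (Poly_Mapping.lookup p s))"
  unfolding push_def by (intro sum.mono_neutral_left) (auto simp: in_keys_iff)

lemma push_add: "push f (p + q) = push f p + push f q"
proof -
  let ?K = "Poly_Mapping.keys p \<union> Poly_Mapping.keys q"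
  have "push f (p + q) = (\<Sum>s\<in>?K. Poly_Mapping.single (f s) (Poly_Mapping.lookup (p + q) s))"
    using keys_add[of p q] by (intro push_superset) auto
  also have "\<dots> = (\<Sum>s\<in>?K. Poly_Mapping.single (f s) (Poly_Mapping.lookup p s)) +
      (\<Sum>s\<in>?K. Poly_Mapping.single (f s) (Poly_Mapping.lookup q s))"
    by (simp add: lookup_add single_add sum.distrib)
  finally show ?thesis using push_superset[of ?K p f] push_superset[of ?K q f] by simp
qed

lemma push_single [simp]: "push f (Poly_Mapping.single s c) = Poly_Mapping.single (f s) c"
  using push_superset[of "{s}" "Poly_Mapping.single s c" f] by simp

lemma push_zero [simp]: "push f 0 = 0"
  by (simp add: push_def)

lemma push_sum: "push f (sum g I) = (\<Sum>i\<in>I. push f (g i))"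
  by (induction I rule: infinite_finite_induct) (simp_all add: push_add)

lemma push_uminus: "push f (- p) = - push f p"
  using push_add[of f p "- p"] by (simp add: eq_neg_iff_add_eq_0 add.commute)

lemma push_mult:
  assumes "\<And>s t. f (s + t) = f s + f t"
  shows "push f (p * q) = push f p * push f q"
proof -
  have "p * q = (\<Sum>s\<in>Poly_Mapping.keys p. Poly_Mapping.single s (Poly_Mapping.lookup p s)) *
      (\<Sum>t\<in>Poly_Mapping.keys q. Poly_Mapping.single t (Poly_Mapping.lookup q t))"
    using mpoly_sum_monomials by metis
  then have "push f (p * q) = (\<Sum>s\<in>Poly_Mapping.keys p. \<Sum>t\<in>Poly_Mapping.keys q.
      Poly_Mapping.single (f s + f t) (Poly_Mapping.lookup p s * Poly_Mapping.lookup q t))"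
    by (simp add: sum_product push_sum mult_single assms)
  then show ?thesis by (simp add: push_def sum_product mult_single)
qed

lemma push_comp: "push g (push f p) = push (\<lambda>s. g (f s)) p"
  unfolding push_def[of f] push_def[of "\<lambda>s. g (f s)"] by (simp add: push_sum)

section \<open>Prime ideals from substitutions\<close>

definition restrict_exponent :: "nat set \<Rightarrow> (nat \<Rightarrow>\<^sub>0 nat) \<Rightarrow> (nat \<Rightarrow>\<^sub>0 nat)" where
  "restrict_exponent J = Poly_Mapping.mapp (\<lambda>i n. if i \<in> J then n else 0)"

lemma lookup_restrict_exponent:
  "Poly_Mapping.lookup (restrict_exponent J s) i = (if i \<in> J then Poly_Mapping.lookup s i else 0)"
  by (simp add: restrict_exponent_def lookup_mapp when_def in_keys_iff)

lemma restrict_exponent_add: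
  "restrict_exponent J (s + t) = restrict_exponent J s + restrict_exponent J t"
  by (rule poly_mapping_eqI) (simp add: lookup_restrict_exponent lookup_add)

lemma restrict_exponent_restrict:
  "J' \<subseteq> J \<Longrightarrow> restrict_exponent J' (restrict_exponent J s) = restrict_exponent J' s"
  by (rule poly_mapping_eqI) (auto simp: lookup_restrict_exponent)

lemma restrict_exponent_zero: "restrict_exponent J 0 = 0"
  by (rule poly_mapping_eqI) (simp add: lookup_restrict_exponent)

text \<open>The kernel of the substitution \<open>t\<^sub>i = 1\<close> for all \<open>i \<notin> J\<close>.\<close>

definition substitution_kernel :: "nat set set \<Rightarrow> nat set \<Rightarrow> 'k::field mpoly set" where
  "substitution_kernel E J = {p \<in> edge_ring_carrier E. push (restrict_exponent J) p = 0}"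

lemma edge_ring_simps [simp]:
  "carrier (edge_ring E) = edge_ring_carrier E"
  "x \<otimes>\<^bsub>edge_ring E\<^esub> y = x * y"
  "x \<oplus>\<^bsub>edge_ring E\<^esub> y = x + y"
  "\<zero>\<^bsub>edge_ring E\<^esub> = 0"
  "\<one>\<^bsub>edge_ring E\<^esub> = 1"
  by (simp_all add: edge_ring_def)

lemma
  shows edge_ring_zero: "(0 :: 'k::field mpoly) \<in> edge_ring_carrier E"
    and edge_ring_one: "(1 :: 'k::field mpoly) \<in> edge_ring_carrier E"
    and edge_ring_uminus: "(p :: 'k::field mpoly) \<in> edge_ring_carrier E \<Longrightarrow> - p \<in> edge_ring_carrier E"
  by (auto simp: edge_ring_carrier_iff edge_monoid_zero)

lemma edge_ring_prod:
  fixes f :: "'i \<Rightarrow> 'k::field mpoly"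
  shows "(\<And>i. i \<in> I \<Longrightarrow> f i \<in> edge_ring_carrier E) \<Longrightarrow> prod f I \<in> edge_ring_carrier E"
  by (induction I rule: infinite_finite_induct) (auto intro: edge_ring_carrier.mult edge_ring_one)

lemma edge_ring_sum:
  fixes f :: "'i \<Rightarrow> 'k::field mpoly"
  shows "(\<And>i. i \<in> I \<Longrightarrow> f i \<in> edge_ring_carrier E) \<Longrightarrow> sum f I \<in> edge_ring_carrier E"
  by (induction I rule: infinite_finite_induct) (auto intro: edge_ring_carrier.add edge_ring_zero)

lemma edge_ring_power:
  fixes p :: "'k::field mpoly"
  shows "p \<in> edge_ring_carrier E \<Longrightarrow> p ^ n \<in> edge_ring_carrier E"
  by (induction n) (auto intro: edge_ring_carrier.mult edge_ring_one)

text \<open>It is the kernel of a homomorphism into the polynomial ring, which is a domain.\<close>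

lemma primeideal_substitution_kernel:
  "primeideal (substitution_kernel E J) (edge_ring E :: 'k::field mpoly ring)"
proof -
  interpret R: cring "edge_ring E :: 'k mpoly ring" by (rule cring_edge_ring)
  have mult: "push (restrict_exponent J) (p * q) = push (restrict_exponent J) p * push (restrict_exponent J) q"
    for p q :: "'k mpoly"
    by (rule push_mult) (rule restrict_exponent_add)
  have minus: "\<ominus>\<^bsub>edge_ring E\<^esub> p = - p" if "p \<in> edge_ring_carrier E" for p :: "'k mpoly"
    using that edge_ring_uminus by (intro R.minus_equality) auto
  have sub: "subgroup (substitution_kernel E J) (add_monoid (edge_ring E :: 'k mpoly ring))"
  proof (rule R.add.subgroupI)
    show "substitution_kernel E J \<subseteq> carrier (edge_ring E :: 'k mpoly ring)"
      by (auto simp: substitution_kernel_def)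
    have "(0 :: 'k mpoly) \<in> substitution_kernel E J"
      by (simp add: substitution_kernel_def edge_ring_zero)
    then show "(substitution_kernel E J :: 'k mpoly set) \<noteq> {}" by blast
    show "\<ominus>\<^bsub>edge_ring E\<^esub> p \<in> substitution_kernel E J" if "p \<in> substitution_kernel E J" for p :: "'k mpoly"
      using that minus by (auto simp: substitution_kernel_def push_uminus edge_ring_uminus)
    show "p \<oplus>\<^bsub>edge_ring E\<^esub> q \<in> substitution_kernel E J"
      if "p \<in> substitution_kernel E J" "q \<in> substitution_kernel E J" for p q :: "'k mpoly"
      using that by (auto simp: substitution_kernel_def push_add edge_ring_carrier.add)
  qed
  show ?thesis
  proof (rule primeidealI)
    show "ideal (substitution_kernel E J) (edge_ring E :: 'k mpoly ring)"
      by (rule idealI[OF R.ring_axioms sub])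
        (auto simp: substitution_kernel_def mult edge_ring_carrier.mult)
    have "(1 :: 'k mpoly) \<notin> substitution_kernel E J"
      using push_single[of "restrict_exponent J" 0 "1 :: 'k"]
      by (simp add: substitution_kernel_def restrict_exponent_zero)
    then show "carrier (edge_ring E :: 'k mpoly ring) \<noteq> substitution_kernel E J"
      using edge_ring_one by auto
    show "p \<in> substitution_kernel E J \<or> q \<in> substitution_kernel E J"
      if "p \<in> carrier (edge_ring E)" "q \<in> carrier (edge_ring E)" "p \<otimes>\<^bsub>edge_ring E\<^esub> q \<in> substitution_kernel E J"
      for p q :: "'k mpoly"
      using that by (auto simp: substitution_kernel_def mult)
  qed (rule cring_edge_ring)
qed

text \<open>The binomial of \<open>s\<close> and \<open>t\<close> vanishes when only the exponents
  in \<open>J'\<close> are kept, but not when that of \<open>b\<close> is kept as well.\<close>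

lemma substitution_kernel_strict:
  assumes J: "J' \<subseteq> J" and b: "b \<in> J" and st: "s \<in> edge_monoid E" "t \<in> edge_monoid E"
    and eq: "\<And>i. i \<in> J' \<Longrightarrow> Poly_Mapping.lookup s i = Poly_Mapping.lookup t i"
    and neq: "Poly_Mapping.lookup s b \<noteq> Poly_Mapping.lookup t b"
  shows "(substitution_kernel E J :: 'k::field mpoly set) \<subset> substitution_kernel E J'"
proof
  show "(substitution_kernel E J :: 'k mpoly set) \<subseteq> substitution_kernel E J'"
  proof
    fix p :: "'k mpoly" assume p: "p \<in> substitution_kernel E J"
    have "push (restrict_exponent J') p = push (restrict_exponent J') (push (restrict_exponent J) p)"
      by (simp add: push_comp restrict_exponent_restrict[OF J])
    then show "p \<in> substitution_kernel E J'" using p by (simp add: substitution_kernel_def)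
  qed
  define p :: "'k mpoly" where "p = monomial s + - monomial t"
  have p: "p \<in> edge_ring_carrier E"
    unfolding p_def using st
    by (intro edge_ring_carrier.add edge_ring_uminus) (auto simp: edge_ring_carrier_iff)
  have push: "push (restrict_exponent K) p = monomial (restrict_exponent K s) - monomial (restrict_exponent K t)" for K
    by (simp only: p_def push_add push_uminus push_single diff_conv_add_uminus)
  have "restrict_exponent J' s = restrict_exponent J' t"
    using eq by (intro poly_mapping_eqI) (auto simp: lookup_restrict_exponent)
  then have "p \<in> substitution_kernel E J'" using p by (simp add: substitution_kernel_def push)
  moreover have "restrict_exponent J s \<noteq> restrict_exponent J t"
    using neq b lookup_restrict_exponent[of J _ b] by metis
  then have "(monomial (restrict_exponent J s) :: 'k mpoly) \<noteq> monomial (restrict_exponent J t)"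
    by (metis keys_single singleton_inject zero_neq_one)
  then have "p \<notin> substitution_kernel E J" by (simp add: substitution_kernel_def push)
  ultimately show "(substitution_kernel E J :: 'k mpoly set) \<noteq> substitution_kernel E J'" by blast
qed

section \<open>Upper bound for the length of a chain of primes\<close>

lemma (in vector_space) ex_linear_relation:
  assumes "finite I" "finite W" "f ` I \<subseteq> span W" "card W < card I"
  shows "\<exists>q. (\<exists>i\<in>I. q i \<noteq> 0) \<and> (\<Sum>i\<in>I. scale (q i) (f i)) = 0"
proof (cases "inj_on f I")
  case True
  then have "dependent (f ` I)"
    using independent_span_bound[OF assms(2) _ assms(3)] assms(4) card_image[OF True] by auto
  then obtain r where "\<exists>v\<in>f ` I. r v \<noteq> 0" "(\<Sum>v\<in>f ` I. scale (r v) v) = 0"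
    using dependent_finite[of "f ` I"] assms(1) by auto
  then show ?thesis
    using True by (intro exI[of _ "r \<circ> f"]) (auto simp: sum.reindex)
next
  case False
  \<comment> \<open>The family may repeat a vector, as different products of ring elements can
    coincide; a repetition is itself a relation.\<close>
  then obtain i j where ij: "i \<in> I" "j \<in> I" "i \<noteq> j" "f i = f j" by (auto simp: inj_on_def)
  define q :: "_ \<Rightarrow> 'a" where "q k = (if k = i then 1 else if k = j then - 1 else 0)" for k
  have "(\<Sum>k\<in>I. scale (q k) (f k)) = (\<Sum>k\<in>{i, j}. scale (q k) (f k))"
    using assms(1) ij by (intro sum.mono_neutral_right) (auto simp: q_def)
  also have "\<dots> = 0" using ij by (simp add: q_def)
  finally show ?thesis using ij(1) by (intro exI[of _ q]) (auto simp: q_def)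
qed

text \<open>Taking in a polynomial relation between the \<open>x\<^sub>i\<close> the lexicographically smallest monomial, the
  relation reads \<open>x\<^sub>0\<^sup>m\<^sup>0 (x\<^sub>1\<^sup>m\<^sup>1 (\<dots> (c + a\<^sub>n x\<^sub>n) \<dots>) + a\<^sub>0 x\<^sub>0) = 0\<close> with a constant \<open>c \<noteq> 0\<close>; by
  primality the inner factors lie successively in \<open>P\<^sub>0, P\<^sub>1, \<dots>\<close>.\<close>

lemma no_relation_along_prime_chain:
  fixes P :: "nat \<Rightarrow> 'k::field mpoly set" and x :: "nat \<Rightarrow> 'k mpoly"
  assumes prime: "\<And>i. i \<le> n \<Longrightarrow> primeideal (P i) (edge_ring E)"
    and x: "\<And>i. i < n \<Longrightarrow> x i \<in> P (Suc i)" "\<And>i. i < n \<Longrightarrow> x i \<notin> P i"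
    and chain: "\<And>i. i < n \<Longrightarrow> P i \<subseteq> P (Suc i)"
    and "j \<le> n" "finite S" "S \<noteq> {}" "\<And>\<alpha>. \<alpha> \<in> S \<Longrightarrow> q \<alpha> \<noteq> 0"
    and "\<And>\<alpha> \<beta>. \<lbrakk>\<alpha> \<in> S; \<beta> \<in> S; \<And>i. i \<in> {j..<n} \<Longrightarrow> \<alpha> i = \<beta> i\<rbrakk> \<Longrightarrow> \<alpha> = \<beta>"
  shows "(\<Sum>\<alpha>\<in>S. mpoly_const (q \<alpha>) * (\<Prod>i\<in>{j..<n}. x i ^ \<alpha> i)) \<notin> P j"
  using assms(5-)
proof (induction j arbitrary: S rule: inc_induct)
  case base
  then obtain \<alpha> where "\<alpha> \<in> S" by blast
  moreover have "\<beta> = \<alpha>" if "\<beta> \<in> S" for \<beta>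
    using base(4)[OF that \<open>\<alpha> \<in> S\<close>] by simp
  ultimately have \<alpha>: "S = {\<alpha>}" by blast
  interpret primeideal "P n" "edge_ring E" using prime by simp
  show ?case
  proof
    assume "(\<Sum>\<alpha>\<in>S. mpoly_const (q \<alpha>) * (\<Prod>i\<in>{n..<n}. x i ^ \<alpha> i)) \<in> P n"
    then have "mpoly_const (q \<alpha>) \<in> P n" using \<alpha> by simp
    then have "mpoly_const (inverse (q \<alpha>)) * mpoly_const (q \<alpha>) \<in> P n"
      using I_l_closed[of "mpoly_const (q \<alpha>)" "mpoly_const (inverse (q \<alpha>))"] by (simp add: edge_ring_carrier.const)
    moreover have "mpoly_const (inverse (q \<alpha>)) * mpoly_const (q \<alpha>) = 1"
      using base(3)[of \<alpha>] \<alpha> by (simp add: mpoly_const_def mult_single)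
    ultimately have "\<one>\<^bsub>edge_ring E\<^esub> \<in> P n" by simp
    then show False using one_imp_carrier I_notcarr by blast
  qed
next
  case (step j)
  define m where "m = Min ((\<lambda>\<alpha>. \<alpha> j) ` S)"
  have m_le: "m \<le> \<alpha> j" if "\<alpha> \<in> S" for \<alpha> using step.prems(1) that by (simp add: m_def)
  have "m \<in> (\<lambda>\<alpha>. \<alpha> j) ` S" unfolding m_def using step.prems(1,2) by (intro Min_in) auto
  \<comment> \<open>The terms with the least power of \<open>x j\<close>. They agree at
    \<open>j\<close>, so the remaining exponents still tell them apart; all other terms keep a
    factor \<open>x j\<close> after division by \<open>x j ^ m\<close>.\<close>
  define S' where "S' = {\<alpha>\<in>S. \<alpha> j = m}"
  have S': "finite S'" "S' \<noteq> {}" "S' \<subseteq> S"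
    using step.prems(1) \<open>m \<in> _\<close> by (auto simp: S'_def)
  define y where "y \<alpha> = mpoly_const (q \<alpha>) * (\<Prod>i\<in>{Suc j..<n}. x i ^ \<alpha> i)" for \<alpha>
  interpret Pj: primeideal "P j" "edge_ring E" using prime step.hyps by simp
  interpret PS: primeideal "P (Suc j)" "edge_ring E" using prime step.hyps by simp
  have xR: "x i \<in> edge_ring_carrier E" if "i < n" for i
    using x(1)[OF that] primeideal.axioms(1)[OF prime[of "Suc i"]] ideal.Icarr[of "P (Suc i)" "edge_ring E" "x i"] that
    by simp
  have yR: "y \<alpha> \<in> edge_ring_carrier E" for \<alpha>
    unfolding y_def using xR by (intro edge_ring_carrier.mult edge_ring_carrier.const edge_ring_prod edge_ring_power) auto
  show ?case
  proof
    assume "(\<Sum>\<alpha>\<in>S. mpoly_const (q \<alpha>) * (\<Prod>i\<in>{j..<n}. x i ^ \<alpha> i)) \<in> P j"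
    moreover have "(\<Sum>\<alpha>\<in>S. mpoly_const (q \<alpha>) * (\<Prod>i\<in>{j..<n}. x i ^ \<alpha> i)) =
        x j ^ m * (\<Sum>\<alpha>\<in>S. x j ^ (\<alpha> j - m) * y \<alpha>)"
      unfolding sum_distrib_left
    proof (rule sum.cong[OF refl])
      fix \<alpha> assume "\<alpha> \<in> S"
      then have "x j ^ \<alpha> j = x j ^ m * x j ^ (\<alpha> j - m)" using m_le by (simp flip: power_add)
      then show "mpoly_const (q \<alpha>) * (\<Prod>i\<in>{j..<n}. x i ^ \<alpha> i) = x j ^ m * (x j ^ (\<alpha> j - m) * y \<alpha>)"
        using step.hyps by (simp add: y_def prod.atLeast_Suc_lessThan mult.assoc mult.left_commute)
    qed
    ultimately have "x j ^ m * (\<Sum>\<alpha>\<in>S. x j ^ (\<alpha> j - m) * y \<alpha>) \<in> P j" by simp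
    moreover have sumR: "(\<Sum>\<alpha>\<in>T. x j ^ k \<alpha> * y \<alpha>) \<in> edge_ring_carrier E" for T k
      using xR step.hyps yR by (intro edge_ring_sum edge_ring_carrier.mult edge_ring_power) auto
    moreover have "x j ^ k \<notin> P j" for k
    proof (induction k)
      case 0
      show ?case using Pj.one_imp_carrier Pj.I_notcarr by auto
    next
      case (Suc k)
      then show ?case
        using Pj.I_prime[of "x j" "x j ^ k"] x(2) step.hyps xR[of j] edge_ring_power[OF xR[of j], of k] by auto
    qed
    ultimately have "(\<Sum>\<alpha>\<in>S. x j ^ (\<alpha> j - m) * y \<alpha>) \<in> P j"
      using Pj.I_prime[of "x j ^ m" "\<Sum>\<alpha>\<in>S. x j ^ (\<alpha> j - m) * y \<alpha>"] xR[of j] step.hyps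
        edge_ring_power[OF xR[of j], of m] by auto
    then have total: "(\<Sum>\<alpha>\<in>S. x j ^ (\<alpha> j - m) * y \<alpha>) \<in> P (Suc j)"
      using chain step.hyps by auto
    have rest: "x j * (\<Sum>\<alpha>\<in>S-S'. x j ^ (\<alpha> j - m - 1) * y \<alpha>) \<in> P (Suc j)"
      using PS.I_r_closed[of "x j" "\<Sum>\<alpha>\<in>S-S'. x j ^ (\<alpha> j - m - 1) * y \<alpha>"] sumR x(1) step.hyps by simp
    have split: "(\<Sum>\<alpha>\<in>S. x j ^ (\<alpha> j - m) * y \<alpha>) =
        (\<Sum>\<alpha>\<in>S'. y \<alpha>) + x j * (\<Sum>\<alpha>\<in>S-S'. x j ^ (\<alpha> j - m - 1) * y \<alpha>)"
    proof -
      have "(\<Sum>\<alpha>\<in>S'. x j ^ (\<alpha> j - m) * y \<alpha>) = (\<Sum>\<alpha>\<in>S'. y \<alpha>)"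
        by (intro sum.cong) (auto simp: S'_def)
      moreover have "(\<Sum>\<alpha>\<in>S-S'. x j ^ (\<alpha> j - m) * y \<alpha>) = x j * (\<Sum>\<alpha>\<in>S-S'. x j ^ (\<alpha> j - m - 1) * y \<alpha>)"
        unfolding sum_distrib_left
      proof (rule sum.cong[OF refl])
        fix \<alpha> assume "\<alpha> \<in> S - S'"
        then have "\<alpha> j - m = Suc (\<alpha> j - m - 1)" using m_le[of \<alpha>] by (auto simp: S'_def)
        then show "x j ^ (\<alpha> j - m) * y \<alpha> = x j * (x j ^ (\<alpha> j - m - 1) * y \<alpha>)"
          by (metis mult.assoc power_Suc)
      qed
      ultimately show ?thesis
        using sum.subset_diff[OF S'(3) step.prems(1), of "\<lambda>\<alpha>. x j ^ (\<alpha> j - m) * y \<alpha>"]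
        by (simp add: add.commute)
    qed
    have "mpoly_const (- 1) * (x j * (\<Sum>\<alpha>\<in>S-S'. x j ^ (\<alpha> j - m - 1) * y \<alpha>)) \<in> P (Suc j)"
      using PS.I_l_closed[OF rest, of "mpoly_const (- 1)"] by (simp add: edge_ring_carrier.const)
    then have "(\<Sum>\<alpha>\<in>S. x j ^ (\<alpha> j - m) * y \<alpha>) +
        mpoly_const (- 1) * (x j * (\<Sum>\<alpha>\<in>S-S'. x j ^ (\<alpha> j - m - 1) * y \<alpha>)) \<in> P (Suc j)"
      using PS.a_closed[OF total] by simp
    moreover have "mpoly_const (- 1) * p = - p" for p :: "'k mpoly"
      by (simp add: mpoly_const_def single_uminus)
    ultimately have "(\<Sum>\<alpha>\<in>S'. y \<alpha>) \<in> P (Suc j)" unfolding split by simp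
    moreover have "(\<Sum>\<alpha>\<in>S'. y \<alpha>) \<notin> P (Suc j)"
      unfolding y_def
    proof (rule step.IH[OF S'(1,2)])
      show "q \<alpha> \<noteq> 0" if "\<alpha> \<in> S'" for \<alpha> using step.prems(3) S'(3) that by blast
      show "\<alpha> = \<beta>" if "\<alpha> \<in> S'" "\<beta> \<in> S'" "\<And>i. i \<in> {Suc j..<n} \<Longrightarrow> \<alpha> i = \<beta> i" for \<alpha> \<beta>
      proof (rule step.prems(4))
        show "\<alpha> i = \<beta> i" if "i \<in> {j..<n}" for i
          using that \<open>\<alpha> \<in> S'\<close> \<open>\<beta> \<in> S'\<close> \<open>\<And>i. i \<in> {Suc j..<n} \<Longrightarrow> \<alpha> i = \<beta> i\<close>
          by (cases "i = j") (auto simp: S'_def)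
      qed (use that S' in auto)
    qed
    ultimately show False by simp
  qed
qed

text \<open>Only exponents in \<open>B\<close> are bounded: if \<open>B\<close> separates the
  monoid, this already leaves finitely many monomials.\<close>

definition degree_bounded :: "nat set \<Rightarrow> nat \<Rightarrow> 'k::field mpoly \<Rightarrow> bool" where
  "degree_bounded B m p \<longleftrightarrow> (\<forall>s\<in>Poly_Mapping.keys p. \<forall>i\<in>B. Poly_Mapping.lookup s i \<le> m)"

lemma degree_bounded_mult:
  assumes "degree_bounded B m p" "degree_bounded B m' q"
  shows "degree_bounded B (m + m') (p * q)"
  unfolding degree_bounded_def
proof (intro ballI)
  fix s i assume "s \<in> Poly_Mapping.keys (p * q)" "i \<in> B"
  then obtain a b where "s = a + b" "a \<in> Poly_Mapping.keys p" "b \<in> Poly_Mapping.keys q"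
    using keys_mult[of p q] by blast
  then show "Poly_Mapping.lookup s i \<le> m + m'"
    using assms \<open>i \<in> B\<close> by (auto simp: degree_bounded_def lookup_add add_mono)
qed

lemma degree_bounded_one: "degree_bounded B 0 1"
  by (simp add: degree_bounded_def)

lemma degree_bounded_power: "degree_bounded B m p \<Longrightarrow> degree_bounded B (k * m) (p ^ k)"
  by (induction k) (auto simp: degree_bounded_one degree_bounded_mult)

lemma degree_bounded_prod:
  "(\<And>i. i \<in> I \<Longrightarrow> degree_bounded B (m i) (p i)) \<Longrightarrow> degree_bounded B (\<Sum>i\<in>I. m i) (\<Prod>i\<in>I. p i)"
  by (induction I rule: infinite_finite_induct) (auto simp: degree_bounded_one degree_bounded_mult)

lemma degree_bounded_mono: "\<lbrakk>degree_bounded B m p; m \<le> m'\<rbrakk> \<Longrightarrow> degree_bounded B m' p"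
  by (meson degree_bounded_def order_trans)

lemma ex_degree_bound:
  assumes "finite B"
  shows "\<exists>m. degree_bounded B m p"
proof -
  let ?V = "(\<lambda>(s, i). Poly_Mapping.lookup s i) ` (Poly_Mapping.keys p \<times> B)"
  have "finite ?V" using assms by simp
  then have "degree_bounded B (Max (insert 0 ?V)) p"
    unfolding degree_bounded_def by (intro ballI Max_ge) auto
  then show ?thesis by blast
qed

lemma monomials_in_span:
  fixes p :: "'k::field mpoly"
  assumes "p \<in> edge_ring_carrier E" "degree_bounded B m p"
  shows "p \<in> mpoly.span (monomial ` {s \<in> edge_monoid E. \<forall>i\<in>B. Poly_Mapping.lookup s i \<le> m})"
proof -
  have "(\<Sum>s\<in>Poly_Mapping.keys p. mpoly_scale (Poly_Mapping.lookup p s) (monomial s)) \<in>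
      mpoly.span (monomial ` {s \<in> edge_monoid E. \<forall>i\<in>B. Poly_Mapping.lookup s i \<le> m})"
    using assms by (intro mpoly.span_sum mpoly.span_scale mpoly.span_base)
      (auto simp: edge_ring_carrier_iff degree_bounded_def)
  then show ?thesis
    using mpoly_sum_monomials[of p] by (simp add: mpoly_scale_monomial)
qed

lemma card_bounded_exponents:
  assumes "finite B"
    and sep: "\<And>s t. \<lbrakk>s \<in> T; t \<in> T; \<And>i. i \<in> B \<Longrightarrow> Poly_Mapping.lookup s i = Poly_Mapping.lookup t i\<rbrakk> \<Longrightarrow> s = t"
  shows "finite {s \<in> T. \<forall>i\<in>B. Poly_Mapping.lookup s i \<le> m}"
    and "card {s \<in> T. \<forall>i\<in>B. Poly_Mapping.lookup s i \<le> m} \<le> Suc m ^ card B"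
proof -
  let ?X = "{s \<in> T. \<forall>i\<in>B. Poly_Mapping.lookup s i \<le> m}"
  let ?r = "\<lambda>s. restrict (Poly_Mapping.lookup s) B"
  have inj: "inj_on ?r ?X"
  proof (rule inj_onI)
    fix s t assume "s \<in> ?X" "t \<in> ?X" and r: "?r s = ?r t"
    moreover have "Poly_Mapping.lookup s i = Poly_Mapping.lookup t i" if "i \<in> B" for i
      using fun_cong[OF r, of i] that by simp
    ultimately show "s = t" by (intro sep) auto
  qed
  have sub: "?r ` ?X \<subseteq> B \<rightarrow>\<^sub>E {..m}" by auto
  have fin: "finite (B \<rightarrow>\<^sub>E {..m})" using assms(1) by (intro finite_PiE) auto
  show "finite ?X" using finite_imageD[OF finite_subset[OF sub fin] inj] .
  have "card ?X = card (?r ` ?X)" using card_image[OF inj] by simp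
  also have "\<dots> \<le> card (B \<rightarrow>\<^sub>E {..m})" by (rule card_mono[OF fin sub])
  also have "\<dots> = Suc m ^ card B" using assms(1) by (simp add: card_PiE)
  finally show "card ?X \<le> Suc m ^ card B" .
qed

text \<open>Choose one element from each step of the chain. Their products with exponents up to
  \<open>K\<close> number \<open>Suc K ^ n\<close>, while the monomials they can involve grow only
  like \<open>K ^ card B\<close>. For \<open>n > card B\<close> this forces a linear relation,
  contrary to \<open>no_relation_along_prime_chain\<close>.\<close>

lemma prime_chain_length:
  fixes P :: "nat \<Rightarrow> 'k::field mpoly set"
  assumes prime: "\<And>i. i \<le> n \<Longrightarrow> primeideal (P i) (edge_ring E)"
    and chain: "\<And>i. i < n \<Longrightarrow> P i \<subset> P (Suc i)"
    and B: "finite B"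
    and sep: "\<And>s t. \<lbrakk>s \<in> edge_monoid E; t \<in> edge_monoid E;
      \<And>i. i \<in> B \<Longrightarrow> Poly_Mapping.lookup s i = Poly_Mapping.lookup t i\<rbrakk> \<Longrightarrow> s = t"
  shows "n \<le> card B"
proof (rule ccontr)
  assume "\<not> n \<le> card B"
  have "\<exists>x. x \<in> P (Suc i) \<and> x \<notin> P i" if "i < n" for i using chain[OF that] by blast
  then obtain x where x: "\<And>i. i < n \<Longrightarrow> x i \<in> P (Suc i)" "\<And>i. i < n \<Longrightarrow> x i \<notin> P i" by metis
  have xR: "x i \<in> edge_ring_carrier E" if "i < n" for i
    using x(1)[OF that] primeideal.axioms(1)[OF prime[of "Suc i"]] ideal.Icarr[of "P (Suc i)" "edge_ring E" "x i"] that
    by simp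
  have "\<forall>i. \<exists>m. degree_bounded B m (x i)" using ex_degree_bound[OF B] by blast
  then obtain m0 where m0: "\<And>i. degree_bounded B (m0 i) (x i)" by metis
  define m where "m = (\<Sum>i<n. m0 i)"
  have m: "degree_bounded B m (x i)" if "i < n" for i
    unfolding m_def using that by (intro degree_bounded_mono[OF m0] member_le_sum) auto
  \<comment> \<open>Chosen so that the number of monomials is at most
    \<open>K * Suc K ^ card B\<close>, just below \<open>Suc K ^ Suc (card B)\<close>.\<close>
  define K where "K = Suc (n * m) ^ card B"
  define I where "I = {..<n} \<rightarrow>\<^sub>E {..K}"
  define f where "f \<alpha> = (\<Prod>i\<in>{0..<n}. x i ^ \<alpha> i)" for \<alpha>
  define X where "X = {s \<in> edge_monoid E. \<forall>i\<in>B. Poly_Mapping.lookup s i \<le> n * (K * m)}"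
  have finI: "finite I" by (auto simp: I_def intro: finite_PiE)
  have cardI: "card I = Suc K ^ n" by (simp add: I_def card_PiE)
  have finX: "finite X" and cardX: "card X \<le> Suc (n * (K * m)) ^ card B"
    unfolding X_def using card_bounded_exponents[OF B, of "edge_monoid E"] sep by blast+
  have "Suc (n * (K * m)) \<le> Suc (n * m) * Suc K" by (simp add: algebra_simps)
  then have "card X \<le> (Suc (n * m) * Suc K) ^ card B"
    using cardX power_mono[of "Suc (n * (K * m))" "Suc (n * m) * Suc K" "card B"] by linarith
  also have "\<dots> = K * Suc K ^ card B" by (simp only: power_mult_distrib K_def)
  also have "\<dots> < Suc K ^ Suc (card B)" by simp
  also have "\<dots> \<le> Suc K ^ n" using \<open>\<not> n \<le> card B\<close> by (intro power_increasing) auto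
  finally have "card X < card I" using cardI by simp
  then have card_less: "card ((monomial :: _ \<Rightarrow> 'k mpoly) ` X) < card I"
    using card_image_le[OF finX, of "monomial :: _ \<Rightarrow> 'k mpoly"] by linarith
  have "f \<alpha> \<in> mpoly.span (monomial ` X)" if \<alpha>: "\<alpha> \<in> I" for \<alpha>
    unfolding X_def
  proof (rule monomials_in_span)
    show "f \<alpha> \<in> edge_ring_carrier E"
      unfolding f_def using xR by (intro edge_ring_prod edge_ring_power) auto
    have "degree_bounded B (\<Sum>i\<in>{0..<n}. \<alpha> i * m) (f \<alpha>)"
      unfolding f_def using m by (intro degree_bounded_prod degree_bounded_power) auto
    moreover have "(\<Sum>i\<in>{0..<n}. \<alpha> i * m) \<le> (\<Sum>i\<in>{0..<n}. K * m)"
      using \<alpha> by (intro sum_mono mult_right_mono) (auto simp: I_def PiE_def Pi_def)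
    ultimately show "degree_bounded B (n * (K * m)) (f \<alpha>)"
      using degree_bounded_mono by fastforce
  qed
  then have "f ` I \<subseteq> mpoly.span (monomial ` X)" by blast
  then obtain q where q: "\<exists>\<alpha>\<in>I. q \<alpha> \<noteq> 0" "(\<Sum>\<alpha>\<in>I. mpoly_scale (q \<alpha>) (f \<alpha>)) = 0"
    using mpoly.ex_linear_relation[OF finI finite_imageI[OF finX] _ card_less] by blast
  define S where "S = {\<alpha>\<in>I. q \<alpha> \<noteq> 0}"
  have "(\<Sum>\<alpha>\<in>S. mpoly_const (q \<alpha>) * (\<Prod>i\<in>{0..<n}. x i ^ \<alpha> i)) = (\<Sum>\<alpha>\<in>I. mpoly_scale (q \<alpha>) (f \<alpha>))"
    unfolding S_def f_def mpoly_scale_def using finI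
    by (intro sum.mono_neutral_left) (auto simp: mpoly_const_def)
  moreover have "0 \<in> P 0"
    using additive_subgroup.zero_closed[OF ideal.axioms(1)[OF primeideal.axioms(1)[OF prime[of 0]]]] by simp
  ultimately have "(\<Sum>\<alpha>\<in>S. mpoly_const (q \<alpha>) * (\<Prod>i\<in>{0..<n}. x i ^ \<alpha> i)) \<in> P 0" using q(2) by simp
  moreover have "(\<Sum>\<alpha>\<in>S. mpoly_const (q \<alpha>) * (\<Prod>i\<in>{0..<n}. x i ^ \<alpha> i)) \<notin> P 0"
  proof (rule no_relation_along_prime_chain[of n P E x])
    show "\<alpha> = \<beta>" if "\<alpha> \<in> S" "\<beta> \<in> S" "\<And>i. i \<in> {0..<n} \<Longrightarrow> \<alpha> i = \<beta> i" for \<alpha> \<beta>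
      using that by (intro PiE_ext[of \<alpha> "{..<n}" _ \<beta>]) (auto simp: S_def I_def)
    show "P i \<subseteq> P (Suc i)" if "i < n" for i using chain[OF that] by blast
  qed (use prime x q(1) finI in \<open>auto simp: S_def\<close>)
  ultimately show False by simp
qed

text \<open>Forgetting the coordinates in \<open>B\<close> one by one gives a chain of kernels with
  \<open>card B\<close> inclusions. Each is strict because no coordinate of \<open>B\<close> can be
  spared, and separation by \<open>B\<close> bounds all other chains.\<close>

theorem krull_dim_edge_ring:
  assumes graph: "simple_graph d E"
  shows "krull_dim (edge_ring E :: 'k::field mpoly ring) = enat (pointwise.dim (indicat_real ` E))"
proof -
  obtain B where B: "finite B" "card B = pointwise.dim (indicat_real ` E)"
    and sep: "\<And>s t. \<lbrakk>s \<in> edge_monoid E; t \<in> edge_monoid E;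
      \<And>i. i \<in> B \<Longrightarrow> Poly_Mapping.lookup s i = Poly_Mapping.lookup t i\<rbrakk> \<Longrightarrow> s = t"
    and min: "\<And>b. b \<in> B \<Longrightarrow> \<exists>s\<in>edge_monoid E. \<exists>t\<in>edge_monoid E.
      (\<forall>i\<in>B-{b}. Poly_Mapping.lookup s i = Poly_Mapping.lookup t i) \<and> Poly_Mapping.lookup s b \<noteq> Poly_Mapping.lookup t b"
    using ex_separating_coordinates[OF graph] by metis
  obtain bs where bs: "set bs = B" "distinct bs" using finite_distinct_list[OF B(1)] by blast
  have len: "length bs = card B" using bs distinct_card by fastforce
  let ?P = "\<lambda>i. substitution_kernel E (set (drop i bs)) :: 'k mpoly set"
  have "?P i \<subset> ?P (Suc i)" if i: "i < card B" for i
  proof -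
    have dr: "drop i bs = bs ! i # drop (Suc i) bs" using i len by (simp add: Cons_nth_drop_Suc)
    have "bs ! i \<in> B" using i len bs by auto
    then obtain s t where st: "s \<in> edge_monoid E" "t \<in> edge_monoid E"
        "\<forall>j\<in>B-{bs ! i}. Poly_Mapping.lookup s j = Poly_Mapping.lookup t j"
        "Poly_Mapping.lookup s (bs ! i) \<noteq> Poly_Mapping.lookup t (bs ! i)"
      using min by blast
    have "distinct (drop i bs)" using bs by simp
    then have "bs ! i \<notin> set (drop (Suc i) bs)" using dr by simp
    moreover have "set (drop (Suc i) bs) \<subseteq> B" using bs set_drop_subset by fastforce
    ultimately have "set (drop (Suc i) bs) \<subseteq> B - {bs ! i}" by blast
    then show ?thesis
      using dr st by (intro substitution_kernel_strict[of _ _ "bs ! i" s E t]) auto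
  qed
  then have "enat (card B) \<in> {enat n |n. \<exists>P. (\<forall>i\<le>n. primeideal (P i) (edge_ring E :: 'k mpoly ring)) \<and> (\<forall>i<n. P i \<subset> P (Suc i))}"
    using primeideal_substitution_kernel by (intro CollectI exI[of _ "card B"] conjI refl exI[of _ ?P]) auto
  moreover have "n \<le> card B"
    if "\<forall>i\<le>n. primeideal (P i) (edge_ring E :: 'k mpoly ring)" "\<forall>i<n. P i \<subset> P (Suc i)" for n P
    using that by (intro prime_chain_length[of n P E B]) (auto intro: B sep)
  ultimately show ?thesis
    unfolding krull_dim_def B(2)[symmetric] by (intro antisym Sup_least Sup_upper) auto
qed

theorem theorem3p13:
  fixes d :: nat and E :: "nat set set"
  assumes "simple_graph d E"
    and "connected_graph d E"
    and "matching_covered d E"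
    and "odd_cycle_condition E"
  shows "pseudo_gorenstein mpoly_scale
           (edge_ring E :: 'k::{alg_closed_field, field_char_0} mpoly ring)
           (edge_ring_component E)"
proof -
  interpret lattice_cone pointwise_scale "indicat_real ` E" "half_degree d" "even_lattice d"
    "indicat_real (\<Union>E)"
    by (rule lattice_cone_graph[OF assms(1,3,4)])
  have "finite e" if "e \<in> E" for e
    using assms(1) that by (metis card.infinite simple_graph_def zero_neq_numeral)
  \<comment> \<open>Both sides count the distinct sums of \<open>k\<close> edge vectors, on the left
    as independent monomials, on the right, by normality, as lattice points of degree
    \<open>k\<close>.\<close>
  then have "hilbert_series mpoly_scale (edge_ring_component E :: nat \<Rightarrow> 'k mpoly set) =
      count (even_lattice d \<inter> cone)"
    unfolding hilbert_series_def count_def component_eq[OF assms(1,4)]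
    using dim_edge_ring_component[where 'k = 'k, OF finite_edges[OF assms(1)]] by simp
  then show ?thesis
    unfolding pseudo_gorenstein_def
    using hilbert_numerator krull_dim_edge_ring[OF assms(1), where 'k = 'k] by auto
qed

end
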